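(* Let $\mathcal M$ be a non-empty set of probability mass functions on $\mathcal X$, let $\mathcal Q$ be a non-empty, bounded and convex set of rate matrices that has separately specified rows, with lower transition rate operator $\underline Q$ (the lower envelope of $\mathcal Q$), and let $L_t^s$ ($0\le t\le s$) be the lower transition operators corresponding to $\underline Q$. Then for any non-empty $u=t_0,\dots,t_n$ and $v=s_0,\dots,s_m$ in $\mathcal U$ such that $u<v$, and any $f\in\mathcal L(\mathcal X_{u\cup v})$: $$\underline{\mathbb E}^{\mathrm W}_{\mathcal Q,\mathcal M}[f(X_u,X_v)\mid X_u]=L_{t_n}^{s_0}L_{s_0}^{s_1}\cdots L_{s_{m-1}}^{s_m}f,$$ as functions on $\mathcal X_u$ (the value of the left-hand side at $x_u$ being the lower expectation conditional on $X_u=x_u$).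
   Context: State space and operators. $\mathcal X$ is a fixed finite non-empty state space; $\mathcal L(\mathcal X)$ is the set of all $f:\mathcal X\to\mathbb R$, with $\|f\|=\max_x|f(x)|$. A non-negatively homogeneous operator $A:\mathcal L(\mathcal X)\to\mathcal L(\mathcal X)$ has norm $\|A\|=\sup\{\|Af\|:\|f\|=1\}$. Matrices are real, indexed by $\mathcal X\times\mathcal X$, and act by $[Af](x)=\sum_yA(x,y)f(y)$. $I$ is the identity. A rate matrix is a matrix $Q$ with $\sum_yQ(x,y)=0$ for all $x$ and $Q(x,y)\ge0$ for $x\ne y$; $\mathcal R$ is the set of all of them. $\mathcal Q\subseteq\mathcal R$ is bounded if $\sup_{Q\in\mathcal Q}\|Q\|<\infty$, and has separately specified rows if $\mathcal Q=\{Q\in\mathcal R:(\forall x\in\mathcal X)\,Q(x,\cdot)\in\mathcal Q_x\}$ with $\mathcal Q_x=\{Q(x,\cdot):Q\in\mathcal Q\}$. Its lower envelope is $[\underline Qf](x)=\inf\{[Qf](x):Q\in\mathcal Q\}$. A lower transition operator is a map $\underline T:\mathcal L(\mathcal X)\to\mathcal L(\mathcal X)$ with $[\underline Tf](x)\ge\min f$, $\underline T(f+g)\ge\underline Tf+\underline Tg$ and $\underline T(\lambda f)=\lambda\underline Tf$ for $\lambda\ge0$. For $t\le s$, $\mathcal U_{[t,s]}$ is the set of finite sequences $v:\ t=t_0<\dots<t_n=s$; $\Delta_i=t_i-t_{i-1}$, $\sigma(v)=\max_i\Delta_i$ ($0$ if $n=0$), $\Phi_v=(I+\Delta_1\underline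 Q)\cdots(I+\Delta_n\underline Q)$ ($I$ if $n=0$). $L_t^s$ is the (existing, unique) lower transition operator such that for every $\epsilon>0$ there is $\delta>0$ with $\|L_t^s-\Phi_v\|\le\epsilon$ for all $v\in\mathcal U_{[t,s]}$ with $\sigma(v)\le\delta$. For a non-empty sequence $w=r_0<\dots<r_k$ and $s>r_k$, $L_{r_k}^s$ is applied to $g\in\mathcal L(\mathcal X_{w\cup\{s\}})$ by $[L_{r_k}^sg](x_w)=[L_{r_k}^s\,g(x_w,\cdot)](x_{r_k})$ for $x_w\in\mathcal X_w$, giving a function in $\mathcal L(\mathcal X_w)$. Stochastic processes. $\mathcal U$ is the set of all finite (possibly empty) strictly increasing sequences in $\mathbb R_{\ge0}$, identified with finite subsets; $\mathcal U_{<t}$ consists of those with all elements $<t$. "$t>u$" means $t$ exceeds every element of $u$ (true if $u=\emptyset$); $u<v$ means every element of $u$ is smaller than every element of $v$. $\mathcal X_u=\prod_{t\in u}\mathcal X$, elements $x_u=(x_t)_{t\in u}$; $\mathcal L(\mathcal X_u)$ is the set of real functions on $\mathcal X_u$. $\Omega$ is a fixed set of paths $\omega:\mathbb R_{\ge0}\to\mathcal X$ such that for every non-empty $u\in\mathcal U$ and $x_u\in\mathcal X_u$ some $\omega\in\Omega$ satisfies $\omega|_u=x_u$. $(X_t=x)=\{\omega\in\Omega:\omega(t)=x\}$, $(X_u=x_u)=\{\omega\in\Omega:\omega|_u=x_u\}$ ($=\Omega$ if $u=\emptyset$). $\mathcal A_u$ is the algebra of subsets of $\Omega$ generated by the events $(X_t=x)$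 with $x\in\mathcal X$ and $t\in u$ or $t>u$. $\mathcal C^{\mathrm{SP}}=\{(A,X_u=x_u):u\in\mathcal U,x_u\in\mathcal X_u,A\in\mathcal A_u\}$. A stochastic process is a map $P:\mathcal C^{\mathrm{SP}}\to\mathbb R$, written $P(A|C)$, that is coherent: for all $n\in\mathbb N$, $(A_i,C_i)\in\mathcal C^{\mathrm{SP}}$, $\lambda_i\in\mathbb R$ ($1\le i\le n$), $\max\{\sum_{i=1}^n\lambda_i\mathbb I_{C_i}(\omega)(P(A_i|C_i)-\mathbb I_{A_i}(\omega)):\omega\in\bigcup_iC_i\}\ge0$. $P(A)=P(A|\Omega)$. For $t\le s$, $u\in\mathcal U_{<t}$, $x_u\in\mathcal X_u$: $T_{t,x_u}^s(x,y)=P(X_s=y|X_t=x,X_u=x_u)$. $P$ is well-behaved if for all $t\ge0$, $u\in\mathcal U_{<t}$, $x_u\in\mathcal X_u$: $\limsup_{\Delta\to0^+}\frac1\Delta\|T_{t,x_u}^{t+\Delta}-I\|<\infty$ and, if $t>0$, $\limsup_{\Delta\to0^+}\frac1\Delta\|T_{t-\Delta,x_u}^{t}-I\|<\infty$. The outer partial derivative $\overline\partial T_{t,x_u}^t$ is the set of all $Q\in\mathcal R$ that are limits of $\frac1{\Delta_i}(T_{t,x_u}^{t+\Delta_i}-I)$ or, if $t>0$, of $\frac1{\Delta_i}(T_{t-\Delta_i,x_u}^t-I)$, for some sequence $\Delta_i\to0^+$. $P$ is consistent with $\mathcal Q$ if $\overline\partial T_{t,x_u}^t\subseteq\mathcal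 Q$ for all $t\ge0$, $u\in\mathcal U_{<t}$, $x_u\in\mathcal X_u$, and consistent with $\mathcal M$ if the mass function $x\mapsto P(X_0=x)$ is in $\mathcal M$. $\mathbb P^{\mathrm W}_{\mathcal Q,\mathcal M}$ is the set of all well-behaved stochastic processes consistent with $\mathcal Q$ and $\mathcal M$, and $\underline{\mathbb E}^{\mathrm W}_{\mathcal Q,\mathcal M}[f(X_u,X_v)|X_u=x_u]=\inf\{\sum_{x_v\in\mathcal X_v}f(x_u,x_v)P(X_v=x_v|X_u=x_u):P\in\mathbb P^{\mathrm W}_{\mathcal Q,\mathcal M}\}$. *)

theory Defs
  imports "HOL-Probability.Probability"
begin

text \<open>
  The state space is the finite type \<open>'x\<close>; a real function on it is a vector of type
  \<open>real ^ 'x\<close>, whose maximum norm is \<open>infnorm\<close>, and a matrix acts on it through \<open>*v\<close>.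
\<close>

definition op_norm :: "(real ^ 'x::finite \<Rightarrow> real ^ 'x) \<Rightarrow> real" where
  "op_norm A = (SUP f\<in>{f. infnorm f = 1}. infnorm (A f))"

definition rate_matrices :: "(real ^ 'x::finite ^ 'x) set" where
  "rate_matrices = {Q. (\<forall>x. (\<Sum>y\<in>UNIV. Q $ x $ y) = 0) \<and> (\<forall>x y. x \<noteq> y \<longrightarrow> 0 \<le> Q $ x $ y)}"

definition bounded_matrices :: "(real ^ 'x::finite ^ 'x) set \<Rightarrow> bool" where
  "bounded_matrices \<Q> \<longleftrightarrow> bdd_above ((\<lambda>Q. op_norm ((*v) Q)) ` \<Q>)"

definition separately_specified_rows :: "(real ^ 'x::finite ^ 'x) set \<Rightarrow> bool" where
  "separately_specified_rows \<Q> \<longleftrightarrow>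
     \<Q> = {Q \<in> rate_matrices. \<forall>x. Q $ x \<in> (\<lambda>Q'. Q' $ x) ` \<Q>}"

definition lower_envelope :: "(real ^ 'x::finite ^ 'x) set \<Rightarrow> real ^ 'x \<Rightarrow> real ^ 'x" where
  "lower_envelope \<Q> f = (\<chi> x. INF Q\<in>\<Q>. (Q *v f) $ x)"

definition lower_transition_operator :: "(real ^ 'x::finite \<Rightarrow> real ^ 'x) \<Rightarrow> bool" where
  "lower_transition_operator T \<longleftrightarrow>
     (\<forall>f x. (MIN y. f $ y) \<le> T f $ x) \<and>
     (\<forall>f g x. T f $ x + T g $ x \<le> T (f + g) $ x) \<and>
     (\<forall>f c. 0 \<le> c \<longrightarrow> T (c *\<^sub>R f) = c *\<^sub>R T f)"

definition partitions :: "real \<Rightarrow> real \<Rightarrow> real list set" where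
  "partitions t s = {v. v \<noteq> [] \<and> sorted_wrt (<) v \<and> hd v = t \<and> last v = s}"

fun mesh :: "real list \<Rightarrow> real" where
  "mesh (t # t' # v) = max (t' - t) (mesh (t' # v))"
| "mesh _ = 0"

text \<open>
  \<open>euler_product q [t\<^sub>0, \<dots>, t\<^sub>n]\<close> is the operator product
  \<open>(I + (t\<^sub>1 - t\<^sub>0) q) \<cdots> (I + (t\<^sub>n - t\<^sub>n\<^sub>-\<^sub>1) q)\<close>; its last factor is applied first.
\<close>

fun euler_product :: "(real ^ 'x::finite \<Rightarrow> real ^ 'x) \<Rightarrow> real list \<Rightarrow> real ^ 'x \<Rightarrow> real ^ 'x" where
  "euler_product q (t # t' # v) f =
     (let g = euler_product q (t' # v) f in g + (t' - t) *\<^sub>R q g)"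
| "euler_product q _ f = f"

definition lower_trans ::
  "(real ^ 'x::finite \<Rightarrow> real ^ 'x) \<Rightarrow> real \<Rightarrow> real \<Rightarrow> real ^ 'x \<Rightarrow> real ^ 'x" where
  "lower_trans q t s = (THE T. lower_transition_operator T \<and>
     (\<forall>\<epsilon>>0. \<exists>\<delta>>0. \<forall>v\<in>partitions t s. mesh v \<le> \<delta> \<longrightarrow>
        op_norm (\<lambda>f. T f - euler_product q v f) \<le> \<epsilon>))"

text \<open>
  A finite strictly increasing sequence of time points is identified with its set of elements.
\<close>

definition time_sets :: "real set set" where
  "time_sets = {u. finite u \<and> u \<subseteq> {0..}}"

definition time_sets_before :: "real \<Rightarrow> real set set" where
  "time_sets_before t = {u \<in> time_sets. \<forall>r\<in>u. r < t}"

definition tuples :: "real set \<Rightarrow> (real \<Rightarrow> 'x) set" where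
  "tuples u = u \<rightarrow>\<^sub>E UNIV"

text \<open>
  A real function on \<open>tuples u\<close> is a function of type \<open>(real \<Rightarrow> 'x) \<Rightarrow> real\<close>; only its
  values on \<open>tuples u\<close> matter. \<open>lower_trans_tuple q w s\<close> takes a function on
  \<open>tuples (insert s w)\<close> to one on \<open>tuples w\<close>, for non-empty \<open>w\<close> before \<open>s\<close>.
\<close>

definition lower_trans_tuple ::
  "(real ^ 'x::finite \<Rightarrow> real ^ 'x) \<Rightarrow> real set \<Rightarrow> real \<Rightarrow>
     ((real \<Rightarrow> 'x) \<Rightarrow> real) \<Rightarrow> (real \<Rightarrow> 'x) \<Rightarrow> real" where
  "lower_trans_tuple q w s g xw = lower_trans q (Max w) s (\<chi> y. g (xw(s := y))) $ xw (Max w)"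

text \<open>
  \<open>lower_trans_iter q u [s\<^sub>0, \<dots>, s\<^sub>m]\<close> is the composition of the operators from
  \<open>Max u\<close> to \<open>s\<^sub>0\<close>, from \<open>s\<^sub>0\<close> to \<open>s\<^sub>1\<close>, and so on, the last of which is applied first.
\<close>

fun lower_trans_iter ::
  "(real ^ 'x::finite \<Rightarrow> real ^ 'x) \<Rightarrow> real set \<Rightarrow> real list \<Rightarrow>
     ((real \<Rightarrow> 'x) \<Rightarrow> real) \<Rightarrow> (real \<Rightarrow> 'x) \<Rightarrow> real" where
  "lower_trans_iter q w [] g = g"
| "lower_trans_iter q w (s # ss) g =
     lower_trans_tuple q w s (lower_trans_iter q (insert s w) ss g)"

definition path_space :: "(real \<Rightarrow> 'x::finite) set \<Rightarrow> bool" where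
  "path_space \<Omega> \<longleftrightarrow> \<Omega> \<subseteq> ({0..} \<rightarrow>\<^sub>E UNIV) \<and>
     (\<forall>u\<in>time_sets. u \<noteq> {} \<longrightarrow> (\<forall>xu\<in>tuples u. \<exists>\<omega>\<in>\<Omega>. restrict \<omega> u = xu))"

definition state_event :: "(real \<Rightarrow> 'x) set \<Rightarrow> real \<Rightarrow> 'x \<Rightarrow> (real \<Rightarrow> 'x) set" where
  "state_event \<Omega> t x = {\<omega> \<in> \<Omega>. \<omega> t = x}"

definition tuple_event :: "(real \<Rightarrow> 'x) set \<Rightarrow> real set \<Rightarrow> (real \<Rightarrow> 'x) \<Rightarrow> (real \<Rightarrow> 'x) set" where
  "tuple_event \<Omega> u xu = {\<omega> \<in> \<Omega>. \<forall>t\<in>u. \<omega> t = xu t}"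

definition event_algebra :: "(real \<Rightarrow> 'x) set \<Rightarrow> real set \<Rightarrow> (real \<Rightarrow> 'x) set set" where
  "event_algebra \<Omega> u =
     algebra \<Omega> hull {state_event \<Omega> t x | t x. 0 \<le> t \<and> (t \<in> u \<or> (\<forall>r\<in>u. r < t))}"

definition process_domain :: "(real \<Rightarrow> 'x) set \<Rightarrow> ((real \<Rightarrow> 'x) set \<times> (real \<Rightarrow> 'x) set) set" where
  "process_domain \<Omega> =
     {(A, tuple_event \<Omega> u xu) | A u xu. u \<in> time_sets \<and> xu \<in> tuples u \<and> A \<in> event_algebra \<Omega> u}"

text \<open>
  The probability of \<open>A\<close> given \<open>C\<close> is written \<open>P (A, C)\<close>. The maximum in the coherence condition
  is taken over finitely many values, because the summands are combinations of indicators.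
\<close>

definition coherent ::
  "(real \<Rightarrow> 'x) set \<Rightarrow> ((real \<Rightarrow> 'x) set \<times> (real \<Rightarrow> 'x) set \<Rightarrow> real) \<Rightarrow> bool" where
  "coherent \<Omega> P \<longleftrightarrow>
     (\<forall>n\<ge>1. \<forall>(A :: nat \<Rightarrow> (real \<Rightarrow> 'x) set) C (c :: nat \<Rightarrow> real).
        (\<forall>i\<in>{1..n}. (A i, C i) \<in> process_domain \<Omega>) \<longrightarrow>
        0 \<le> Max ((\<lambda>\<omega>. \<Sum>i=1..n. c i * indicator (C i) \<omega> * (P (A i, C i) - indicator (A i) \<omega>))
                   ` (\<Union>i\<in>{1..n}. C i)))"

definition stochastic_process ::
  "(real \<Rightarrow> 'x) set \<Rightarrow> ((real \<Rightarrow> 'x) set \<times> (real \<Rightarrow> 'x) set \<Rightarrow> real) \<Rightarrow> bool" where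
  "stochastic_process \<Omega> P \<longleftrightarrow> P \<in> extensional (process_domain \<Omega>) \<and> coherent \<Omega> P"

definition trans_matrix ::
  "(real \<Rightarrow> 'x::finite) set \<Rightarrow> ((real \<Rightarrow> 'x) set \<times> (real \<Rightarrow> 'x) set \<Rightarrow> real) \<Rightarrow>
     real set \<Rightarrow> (real \<Rightarrow> 'x) \<Rightarrow> real \<Rightarrow> real \<Rightarrow> real ^ 'x ^ 'x" where
  "trans_matrix \<Omega> P u xu t s =
     (\<chi> x y. P (state_event \<Omega> s y, tuple_event \<Omega> (insert t u) (xu(t := x))))"

text \<open>
  The matrix from \<open>t - \<Delta>\<close> to \<open>t\<close> is meaningful only if \<open>t - \<Delta>\<close> is non-negative and exceeds
  every element of \<open>u\<close>. This holds for all small \<open>\<Delta> > 0\<close>, so the limits below are not affected.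
\<close>

definition well_behaved ::
  "(real \<Rightarrow> 'x::finite) set \<Rightarrow> ((real \<Rightarrow> 'x) set \<times> (real \<Rightarrow> 'x) set \<Rightarrow> real) \<Rightarrow> bool" where
  "well_behaved \<Omega> P \<longleftrightarrow>
     (\<forall>t\<ge>0. \<forall>u\<in>time_sets_before t. \<forall>xu\<in>tuples u.
        Limsup (at_right 0)
          (\<lambda>\<Delta>. ereal (1 / \<Delta> * op_norm ((*v) (trans_matrix \<Omega> P u xu t (t + \<Delta>) - mat 1)))) < \<infinity> \<and>
        (t > 0 \<longrightarrow> Limsup (at_right 0)
          (\<lambda>\<Delta>. ereal (1 / \<Delta> * op_norm ((*v) (trans_matrix \<Omega> P u xu (t - \<Delta>) t - mat 1)))) < \<infinity>))"

definition outer_derivative ::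
  "(real \<Rightarrow> 'x::finite) set \<Rightarrow> ((real \<Rightarrow> 'x) set \<times> (real \<Rightarrow> 'x) set \<Rightarrow> real) \<Rightarrow>
     real set \<Rightarrow> (real \<Rightarrow> 'x) \<Rightarrow> real \<Rightarrow> (real ^ 'x ^ 'x) set" where
  "outer_derivative \<Omega> P u xu t =
     {Q \<in> rate_matrices. \<exists>\<Delta> :: nat \<Rightarrow> real. filterlim \<Delta> (at_right 0) sequentially \<and>
        ((\<lambda>i. (1 / \<Delta> i) *\<^sub>R (trans_matrix \<Omega> P u xu t (t + \<Delta> i) - mat 1)) \<longlonglongrightarrow> Q \<or>
         (t > 0 \<and> (\<lambda>i. (1 / \<Delta> i) *\<^sub>R (trans_matrix \<Omega> P u xu (t - \<Delta> i) t - mat 1)) \<longlonglongrightarrow> Q))}"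

definition consistent_rates ::
  "(real \<Rightarrow> 'x::finite) set \<Rightarrow> ((real \<Rightarrow> 'x) set \<times> (real \<Rightarrow> 'x) set \<Rightarrow> real) \<Rightarrow>
     (real ^ 'x ^ 'x) set \<Rightarrow> bool" where
  "consistent_rates \<Omega> P \<Q> \<longleftrightarrow>
     (\<forall>t\<ge>0. \<forall>u\<in>time_sets_before t. \<forall>xu\<in>tuples u. outer_derivative \<Omega> P u xu t \<subseteq> \<Q>)"

definition consistent_initial ::
  "(real \<Rightarrow> 'x::finite) set \<Rightarrow> ((real \<Rightarrow> 'x) set \<times> (real \<Rightarrow> 'x) set \<Rightarrow> real) \<Rightarrow>
     'x pmf set \<Rightarrow> bool" where
  "consistent_initial \<Omega> P \<M> \<longleftrightarrow> (\<lambda>x. P (state_event \<Omega> 0 x, \<Omega>)) \<in> pmf ` \<M>"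

definition well_behaved_processes ::
  "(real \<Rightarrow> 'x::finite) set \<Rightarrow> (real ^ 'x ^ 'x) set \<Rightarrow> 'x pmf set \<Rightarrow>
     ((real \<Rightarrow> 'x) set \<times> (real \<Rightarrow> 'x) set \<Rightarrow> real) set" where
  "well_behaved_processes \<Omega> \<Q> \<M> =
     {P. stochastic_process \<Omega> P \<and> well_behaved \<Omega> P \<and>
         consistent_rates \<Omega> P \<Q> \<and> consistent_initial \<Omega> P \<M>}"

definition lower_expectation ::
  "(real \<Rightarrow> 'x::finite) set \<Rightarrow> (real ^ 'x ^ 'x) set \<Rightarrow> 'x pmf set \<Rightarrow>
     ((real \<Rightarrow> 'x) \<Rightarrow> real) \<Rightarrow> real set \<Rightarrow> real set \<Rightarrow> (real \<Rightarrow> 'x) \<Rightarrow> real" where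
  "lower_expectation \<Omega> \<Q> \<M> f u v xu =
     (INF P\<in>well_behaved_processes \<Omega> \<Q> \<M>.
        \<Sum>xv\<in>tuples v. f (merge u v (xu, xv)) * P (tuple_event \<Omega> v xv, tuple_event \<Omega> u xu))"

end

theory Submission
  imports Defs
begin

text \<open>
  For the lower bound, fix a process in the set and consider \<open>r \<mapsto> E((L\<^sub>r\<^sup>s g)(X\<^sub>r) | C)\<close>. Well-behavedness,
  consistency and compactness bound its increments from below by \<open>o(\<Delta>)\<close> on both sides of every \<open>r\<close>,
  so it is nondecreasing; since the conditioning event may record any finite history, the product
  rule turns this into the bound for several time points.

  For the upper bound, a finite net of \<open>\<Q>\<close> spans a compact convex \<open>H \<subseteq> \<Q>\<close> that nearly attains
  the lower envelope. On a fine finite set of time points a discrete-time process can be steered,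
  depending on its whole history, by rate matrices from \<open>H\<close> that nearly minimise the value function
  \<open>L\<^sub>a\<^sup>b \<cdots> f\<close>. A small admixture of the uniform distribution makes all histories possible, so its
  conditional probabilities are coherent. By Tychonoff these laws cluster, as the set of time points
  grows, at a coherent process. Whatever its history, the process moves from \<open>x\<close> in time \<open>\<Delta>\<close> by
  \<open>I + \<Delta> Q + O(\<Delta>\<^sup>2)\<close> for some \<open>Q \<in> H\<close>, because \<open>H\<close> is convex; hence, \<open>H\<close> being compact and
  the rows separately specified, all its outer derivatives lie in \<open>\<Q>\<close>.
\<close>

section \<open>Euler products of a lower transition rate operator\<close>

text \<open>A process here is a full conditional probability: it is prescribed on every conditioning
  event, also on those of probability zero, and consistency restricts the rates after every history.
  Laws that determine conditional probabilities only up to null events are therefore not enough,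
  which is why strictly positive laws are built and their conditional probabilities, not the laws
  themselves, are passed to the limit. The other obstacle is that \<open>\<Q>\<close> need not be
  closed: the infimum in the lower envelope may not be attained, and limits of rates from
  \<open>\<Q>\<close> may leave \<open>\<Q>\<close>. A compact \<open>H\<close> inside
  \<open>\<Q>\<close> cures the second defect and makes the first one arbitrarily small. The control
  must see the past because \<open>f\<close> depends on all times in \<open>u\<close> and
  \<open>v\<close>, so that the best rate at a time depends on the states recorded before. Two
  constants run through the estimates: \<open>m\<close> bounds the entries of the rate matrices, and
  \<open>M\<close>, the number of states times \<open>m\<close>, bounds their action in the maximum
  norm.\<close>

lemma infnorm_le_cart_iff: "infnorm (f :: real ^ 'x::finite) \<le> B \<longleftrightarrow> (\<forall>x. \<bar>f $ x\<bar> \<le> B)"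
proof
  assume "infnorm f \<le> B" then show "\<forall>x. \<bar>f $ x\<bar> \<le> B"
    using component_le_infnorm_cart[of f] order_trans by blast
next
  assume "\<forall>x. \<bar>f $ x\<bar> \<le> B"
  then show "infnorm f \<le> B" unfolding infnorm_cart by (intro cSup_least) auto
qed

lemma lower_transition_operatorD:
  assumes "lower_transition_operator T"
  shows "(MIN y. f $ y) \<le> T f $ x" "T f $ x + T g $ x \<le> T (f + g) $ x"
    "0 \<le> c \<Longrightarrow> T (c *\<^sub>R f) = c *\<^sub>R T f" "T 0 = 0"
proof -
  show "(MIN y. f $ y) \<le> T f $ x" "T f $ x + T g $ x \<le> T (f + g) $ x"
    and h: "0 \<le> c \<Longrightarrow> T (c *\<^sub>R f) = c *\<^sub>R T f" for c f
    using assms by (auto simp: lower_transition_operator_def)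
  show "T 0 = 0" using h[of 0 0] by simp
qed

lemma lower_transition_operator_ge:
  assumes T: "lower_transition_operator T" and "\<And>y. c \<le> f $ y"
  shows "c \<le> T f $ x"
proof -
  have "c \<le> (MIN y. f $ y)" using assms(2) by (subst Min_ge_iff) auto
  then show ?thesis using lower_transition_operatorD(1)[OF T, of f x] by linarith
qed

text \<open>Superadditivity at \<open>f\<close> and \<open>g - f\<close>, the latter being at least
  \<open>- c\<close>. The slack \<open>c\<close> lets one inequality yield both monotonicity and
  nonexpansiveness.\<close>

lemma lower_transition_operator_mono:
  assumes T: "lower_transition_operator T" and "\<And>y. f $ y \<le> g $ y + c"
  shows "T f $ x \<le> T g $ x + c"
proof -
  have "- c \<le> T (g - f) $ x"
    using assms(2) by (intro lower_transition_operator_ge[OF T]) (simp add: algebra_simps)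
  then show ?thesis using lower_transition_operatorD(2)[OF T, of f x "g - f"] by simp
qed

lemma lower_transition_operator_nonexpansive:
  assumes T: "lower_transition_operator T"
  shows "infnorm (T f - T g) \<le> infnorm (f - g)"
  unfolding infnorm_le_cart_iff
proof
  fix x
  have *: "\<bar>f $ y - g $ y\<bar> \<le> infnorm (f - g)" for y
    using component_le_infnorm_cart[of "f - g" y] by simp
  have "T f $ x \<le> T g $ x + infnorm (f - g)"
    by (intro lower_transition_operator_mono[OF T]) (smt (verit) *)
  moreover have "T g $ x \<le> T f $ x + infnorm (f - g)"
    by (intro lower_transition_operator_mono[OF T]) (smt (verit) *)
  ultimately show "\<bar>(T f - T g) $ x\<bar> \<le> infnorm (f - g)" by (simp add: abs_le_iff)
qed

lemma lower_transition_operator_infnorm_le: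
  assumes T: "lower_transition_operator T"
  shows "infnorm (T f) \<le> infnorm f"
  using lower_transition_operator_nonexpansive[OF T, of f 0] lower_transition_operatorD(4)[OF T]
  by simp

text \<open>The minimum axiom bounds only from below. The upper bound comes from the constant
  \<open>- c\<close>: the two images add up to at most \<open>T 0 = 0\<close>.\<close>

lemma lower_transition_operator_const:
  assumes T: "lower_transition_operator T"
  shows "T (\<chi> y. c) = (\<chi> y. c)"
proof (rule vec_eq_iff[THEN iffD2], rule allI)
  fix x
  have "c \<le> T (\<chi> y. c) $ x" by (intro lower_transition_operator_ge[OF T]) simp
  moreover have "- c \<le> T (\<chi> y. - c) $ x" by (intro lower_transition_operator_ge[OF T]) simp
  moreover have "T (\<chi> y. c) $ x + T (\<chi> y. - c) $ x \<le> T ((\<chi> y. c) + (\<chi> y. - c)) $ x"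
    by (rule lower_transition_operatorD(2)[OF T])
  moreover have "(\<chi> y. c) + (\<chi> y. - c) = (0 :: real ^ 'a)" by (simp add: vec_eq_iff)
  ultimately show "T (\<chi> y. c) $ x = (\<chi> y. c) $ x"
    using lower_transition_operatorD(4)[OF T] by simp
qed

lemma lower_transition_operator_id: "lower_transition_operator (\<lambda>f. f)"
  by (auto simp: lower_transition_operator_def)

lemma lower_transition_operator_compose:
  assumes S: "lower_transition_operator S" and T: "lower_transition_operator T"
  shows "lower_transition_operator (\<lambda>f. S (T f))"
  unfolding lower_transition_operator_def
proof (intro conjI allI impI)
  fix f g x
  show "(MIN y. f $ y) \<le> S (T f) $ x"
    using lower_transition_operatorD(1)[OF T] by (intro lower_transition_operator_ge[OF S])
  have "S (T f + T g) $ x \<le> S (T (f + g)) $ x + 0"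
    using lower_transition_operatorD(2)[OF T] by (intro lower_transition_operator_mono[OF S]) simp
  then show "S (T f) $ x + S (T g) $ x \<le> S (T (f + g)) $ x"
    using lower_transition_operatorD(2)[OF S, of "T f" x "T g"] by simp
qed (simp add: lower_transition_operatorD(3)[OF S] lower_transition_operatorD(3)[OF T])

section \<open>Partitions of an interval and concatenation of Euler products\<close>

lemma euler_product_append:
  "euler_product q (xs @ b # ys) f = euler_product q (xs @ [b]) (euler_product q (b # ys) f)"
proof (induction xs)
  case (Cons a xs) then show ?case by (cases xs) auto
qed simp

lemma mesh_nonneg: "0 \<le> mesh v"
  by (induction v rule: mesh.induct) auto

lemma mesh_Cons_mult_le:
  assumes "mesh (t # t' # v) * M \<le> c" "0 \<le> M"
  shows "(t' - t) * M \<le> c" "mesh (t' # v) * M \<le> c"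
  using assms by (simp_all add: max_mult_distrib_right)

text \<open>The cut point \<open>b\<close> belongs to both pieces, because a list of points stands
  for its gaps.\<close>

lemma mesh_append: "mesh (xs @ b # ys) = max (mesh (xs @ [b])) (mesh (b # ys))"
proof (induction xs)
  case Nil
  show ?case using mesh_nonneg[of "b # ys"] by simp
next
  case (Cons a xs) then show ?case by (cases xs) (auto simp: max.assoc)
qed

lemma sorted_wrt_hd_le_last:
  "sorted_wrt (<) v \<Longrightarrow> v \<noteq> [] \<Longrightarrow> hd v \<le> (last v :: real)"
  by (cases v) (auto simp: less_imp_le)

lemma sorted_wrt_between_hd_last:
  "sorted_wrt (<) v \<Longrightarrow> x \<in> set v \<Longrightarrow> hd v \<le> x \<and> x \<le> (last v :: real)"
proof (induction v)
  case (Cons a v)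
  show ?case
  proof (cases "v = []")
    case False
    then have "a < last v" using Cons.prems by simp
    then show ?thesis using Cons False by (cases "x = a") (simp_all add: less_imp_le)
  qed (use Cons in auto)
qed simp

lemma mesh_le_length: "sorted_wrt (<) v \<Longrightarrow> v \<noteq> [] \<Longrightarrow> mesh v \<le> last v - hd v"
proof (induction v rule: mesh.induct)
  case (1 t t' v)
  have "t' \<le> last (t' # v)" using sorted_wrt_hd_le_last[of "t' # v"] 1 by simp
  with 1 show ?case by auto
qed auto

lemma partitions_mesh_exists:
  assumes "t \<le> s" "0 < d"
  shows "\<exists>v\<in>partitions t s. mesh v \<le> d"
proof -
  \<comment> \<open>\<open>n\<close> counts steps of length \<open>d\<close> that suffice to reach
    \<open>s\<close>. The start \<open>t\<close> is generalised because each step puts a point in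
    front of the list.\<close>
  have "\<forall>t. t \<le> s \<longrightarrow> s - t \<le> real n * d \<longrightarrow> (\<exists>v\<in>partitions t s. mesh v \<le> d)" for n
  proof (induction n)
    case 0
    have "[s] \<in> partitions s s" "mesh [s] \<le> d" using \<open>0 < d\<close> by (auto simp: partitions_def)
    then show ?case by (auto intro!: bexI[of _ "[s]"] simp: order.antisym)
  next
    case (Suc n)
    show ?case
    proof (intro allI impI)
      fix t assume t: "t \<le> s" "s - t \<le> real (Suc n) * d"
      show "\<exists>v\<in>partitions t s. mesh v \<le> d"
      proof (cases "s - t \<le> d")
        case True
        show ?thesis
        proof (cases "t = s")
          case True then show ?thesis
            using \<open>0 < d\<close> by (intro bexI[of _ "[s]"]) (auto simp: partitions_def)
        next
          case False then show ?thesis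
            using t True \<open>0 < d\<close> by (intro bexI[of _ "[t, s]"]) (auto simp: partitions_def)
        qed
      next
        case False
        then obtain v where v: "v \<in> partitions (t + d) s" "mesh v \<le> d"
          using Suc.IH[rule_format, of "t + d"] t by (auto simp: algebra_simps)
        then show ?thesis using \<open>0 < d\<close>
          by (intro bexI[of _ "t # v"]; cases v) (auto simp: partitions_def)
      qed
    qed
  qed
  moreover obtain n :: nat where "(s - t) / d < real n" using reals_Archimedean2 by blast
  moreover from this have "s - t \<le> real n * d" using \<open>0 < d\<close> by (simp add: pos_divide_less_eq)
  ultimately show ?thesis using \<open>t \<le> s\<close> by blast
qed

text \<open>\<open>tl w\<close> drops the point \<open>b\<close>, with which \<open>v\<close>
  already ends; the gaps, and so the Euler factors, are exactly those of \<open>v\<close> followed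
  by those of \<open>w\<close>.\<close>

lemma partitions_append:
  assumes "v \<in> partitions a b" "w \<in> partitions b c"
  shows "v @ tl w \<in> partitions a c" "mesh (v @ tl w) = max (mesh v) (mesh w)"
    "euler_product q (v @ tl w) f = euler_product q v (euler_product q w f)"
proof -
  obtain xs where v: "v = xs @ [b]" using assms(1) that[of "butlast v"] append_butlast_last_id[of v] by (simp add: partitions_def)
  obtain ys where w: "w = b # ys" using assms(2) by (cases w) (auto simp: partitions_def)
  have "x < y" if "x \<in> set xs" "y \<in> set ys" for x y
    using that assms less_trans[of x b y] by (simp add: v w partitions_def sorted_wrt_append)
  then show "v @ tl w \<in> partitions a c" using assms unfolding v w
    by (cases xs; cases ys) (auto simp: partitions_def sorted_wrt_append)
  show "mesh (v @ tl w) = max (mesh v) (mesh w)" using mesh_append[of xs b ys] by (simp add: v w)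
  show "euler_product q (v @ tl w) f = euler_product q v (euler_product q w f)"
    using euler_product_append[of q xs b ys f] by (simp add: v w)
qed

section \<open>Operator norm and error estimates for Euler products\<close>

lemma op_norm_le:
  assumes "\<And>f. infnorm f = 1 \<Longrightarrow> infnorm (A f) \<le> e"
  shows "op_norm A \<le> e"
proof -
  have "infnorm (1 :: real ^ 'a) = 1"
    by (rule antisym, simp add: infnorm_le_cart_iff)
      (use component_le_infnorm_cart[of "1 :: real ^ 'a"] in \<open>auto\<close>)
  then show ?thesis unfolding op_norm_def
    using assms by (intro cSUP_least) auto
qed

text \<open>A real \<open>SUP\<close> bounds its members only if they are bounded above;
  \<open>B\<close> certifies that.\<close>

lemma op_norm_ge:
  assumes "\<And>f. infnorm f = 1 \<Longrightarrow> infnorm (A f) \<le> B" and "infnorm f = 1"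
  shows "infnorm (A f) \<le> op_norm A"
  unfolding op_norm_def using assms by (intro cSUP_upper) (auto intro!: bdd_aboveI2)

text \<open>The theory of \<open>lower_trans\<close> rests on two facts: \<open>q\<close> is
  Lipschitz in the maximum norm, and an Euler step of length at most \<open>1 / M\<close> is a lower
  transition operator, hence nonexpansive.\<close>

locale lower_rate =
  fixes q :: "real ^ 'x::finite \<Rightarrow> real ^ 'x" and M :: real
  assumes M_pos: "0 < M"
    and lipschitz: "infnorm (q f - q g) \<le> M * infnorm (f - g)"
    and step: "0 \<le> d \<Longrightarrow> d * M \<le> 1 \<Longrightarrow> lower_transition_operator (\<lambda>f. f + d *\<^sub>R q f)"
begin

abbreviation E where "E \<equiv> euler_product q"

lemma E_simps: "E (t # t' # v) = (\<lambda>f. E (t' # v) f + (t' - t) *\<^sub>R q (E (t' # v) f))"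
    "E [] = (\<lambda>f. f)" "E [t] = (\<lambda>f. f)"
  by (simp_all add: Let_def fun_eq_iff)

lemma q_zero: "q 0 = 0"
  using lower_transition_operatorD(4)[OF step[of "1 / M"]] M_pos by simp

lemma q_infnorm_le: "infnorm (q f) \<le> M * infnorm f"
  using lipschitz[of f 0] by (simp add: q_zero)

lemma euler_lower_transition_operator:
  "sorted_wrt (<) v \<Longrightarrow> mesh v * M \<le> 1 \<Longrightarrow> lower_transition_operator (E v)"
proof (induction v rule: mesh.induct)
  case (1 t t' v)
  have m: "(t' - t) * M \<le> 1" "mesh (t' # v) * M \<le> 1"
    using mesh_Cons_mult_le[OF 1(3)] M_pos by auto
  have "lower_transition_operator (\<lambda>f. f + (t' - t) *\<^sub>R q f)"
    using 1(2) m by (intro step) auto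
  moreover have "lower_transition_operator (E (t' # v))" using 1 m by simp
  ultimately show ?case
    using lower_transition_operator_compose[of "\<lambda>f. f + (t' - t) *\<^sub>R q f" "E (t' # v)"]
    by (simp only: E_simps)
qed (simp_all only: E_simps lower_transition_operator_id)

text \<open>The steps telescope: each adds a multiple of \<open>q h\<close>, where \<open>h\<close>
  is no larger than \<open>g\<close> because the factors applied before are nonexpansive.\<close>

lemma euler_minus_id:
  "sorted_wrt (<) v \<Longrightarrow> v \<noteq> [] \<Longrightarrow> mesh v * M \<le> 1 \<Longrightarrow>
    infnorm (E v g - g) \<le> M * (last v - hd v) * infnorm g"
proof (induction v rule: mesh.induct)
  case (1 t t' v)
  have m: "mesh (t' # v) * M \<le> 1"
    using mesh_Cons_mult_le[OF 1(4)] M_pos by auto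
  let ?h = "E (t' # v) g"
  have "infnorm ?h \<le> infnorm g"
    using 1 m by (intro lower_transition_operator_infnorm_le euler_lower_transition_operator) auto
  then have "infnorm ((t' - t) *\<^sub>R q ?h) \<le> (t' - t) * (M * infnorm g)"
    using 1(2) order_trans[OF q_infnorm_le[of ?h] mult_left_mono[of "infnorm ?h" "infnorm g" M]] M_pos
    by (auto simp: infnorm_mul intro!: mult_left_mono)
  moreover have "infnorm (E (t # t' # v) g - g) \<le> infnorm (?h - g) + infnorm ((t' - t) *\<^sub>R q ?h)"
    using infnorm_triangle[of "?h - g" "(t' - t) *\<^sub>R q ?h"] by (simp add: Let_def algebra_simps)
  moreover have "infnorm (?h - g) \<le> M * (last (t' # v) - t') * infnorm g"
    using 1 m by simp
  ultimately show ?case by (simp add: algebra_simps)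
qed (simp_all add: infnorm_0)

text \<open>A step uses \<open>q\<close> at the current vector instead of at \<open>g\<close>; by
  the Lipschitz property and \<open>euler_minus_id\<close> the deviation is proportional to the
  length already covered. The recursion produces \<open>D\<^sup>2 + d * D\<close>, which is below
  the square of the whole length.\<close>

lemma euler_first_order:
  "sorted_wrt (<) v \<Longrightarrow> v \<noteq> [] \<Longrightarrow> mesh v * M \<le> 1 \<Longrightarrow>
    infnorm (E v g - g - (last v - hd v) *\<^sub>R q g) \<le> M\<^sup>2 * (last v - hd v)\<^sup>2 * infnorm g"
proof (induction v rule: mesh.induct)
  case (1 t t' v)
  have m: "mesh (t' # v) * M \<le> 1"
    using mesh_Cons_mult_le[OF 1(4)] M_pos by auto
  let ?h = "E (t' # v) g" and ?D = "last (t' # v) - t'" and ?d = "t' - t"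
  have D: "0 \<le> ?D" "0 \<le> ?d" using sorted_wrt_hd_le_last[of "t' # v"] 1(2) by auto
  have "infnorm (q ?h - q g) \<le> M * (M * ?D * infnorm g)"
  proof (rule order_trans[OF lipschitz mult_left_mono])
    show "infnorm (?h - g) \<le> M * ?D * infnorm g" using euler_minus_id[of "t' # v" g] 1 m by simp
  qed (use M_pos in simp)
  then have a: "infnorm (?d *\<^sub>R (q ?h - q g)) \<le> ?d * (M * (M * ?D * infnorm g))"
    using D by (simp add: infnorm_mul mult_left_mono)
  have b: "infnorm (?h - g - ?D *\<^sub>R q g) \<le> M\<^sup>2 * ?D\<^sup>2 * infnorm g"
    using 1 m by simp
  have eq: "E (t # t' # v) g - g - (last (t # t' # v) - hd (t # t' # v)) *\<^sub>R q g
      = (?h - g - ?D *\<^sub>R q g) + ?d *\<^sub>R (q ?h - q g)"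
    by (simp add: Let_def algebra_simps)
  have "infnorm (E (t # t' # v) g - g - (last (t # t' # v) - hd (t # t' # v)) *\<^sub>R q g)
      \<le> M\<^sup>2 * ?D\<^sup>2 * infnorm g + ?d * (M * (M * ?D * infnorm g))"
    using infnorm_triangle[of "?h - g - ?D *\<^sub>R q g" "?d *\<^sub>R (q ?h - q g)"] a b
    unfolding eq by linarith
  also have "\<dots> = M\<^sup>2 * infnorm g * (?D\<^sup>2 + ?d * ?D)" by (simp add: algebra_simps power2_eq_square)
  also have "\<dots> \<le> M\<^sup>2 * infnorm g * (?D + ?d)\<^sup>2"
  proof (intro mult_left_mono)
    have "x\<^sup>2 + y * x \<le> (x + y)\<^sup>2" if "0 \<le> x" "0 \<le> y" for x y :: real
      using that by (simp add: power2_eq_square algebra_simps)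
    then show "?D\<^sup>2 + ?d * ?D \<le> (?D + ?d)\<^sup>2" using D by blast
    show "0 \<le> M\<^sup>2 * infnorm g" by (simp add: infnorm_pos_le)
  qed
  also have "\<dots> = M\<^sup>2 * (last (t # t' # v) - hd (t # t' # v))\<^sup>2 * infnorm g" by (simp add: algebra_simps)
  finally show ?case .
qed (simp_all add: infnorm_0)

text \<open>Refining one step of length \<open>d\<close> costs at most
  \<open>M\<^sup>2 * d\<^sup>2\<close> by \<open>euler_first_order\<close>, hence at most
  \<open>M\<^sup>2 * d\<close> times the mesh. Euler steps being nonexpansive, the local errors add
  up without amplification.\<close>

lemma euler_refine:
  "v \<noteq> [] \<Longrightarrow> sorted_wrt (<) v \<Longrightarrow> v' \<in> partitions (hd v) (last v) \<Longrightarrow> set v \<subseteq> set v' \<Longrightarrow>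
    mesh v * M \<le> 1 \<Longrightarrow>
    mesh v' \<le> mesh v \<and> infnorm (E v g - E v' g) \<le> M\<^sup>2 * mesh v * (last v - hd v) * infnorm g"
proof (induction v arbitrary: v' rule: mesh.induct)
  case (1 t b v)
  have "b \<in> set v'" using 1 by auto
  \<comment> \<open>Cut the refinement at the second point of the coarse partition:
    \<open>xs @ [b]\<close> refines its first step alone, \<open>b # ys\<close> the rest.\<close>
  then obtain xs ys where v': "v' = xs @ b # ys" by (auto dest: split_list)
  have "t < b" using 1 by simp
  then have xs: "xs \<noteq> []" "hd xs = t" using 1(4) by (cases xs; auto simp: v' partitions_def)+
  have p1: "xs @ [b] \<in> partitions t b" using 1(4) xs by (auto simp: v' partitions_def sorted_wrt_append)
  have p2: "b # ys \<in> partitions (hd (b # v)) (last (b # v))"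
    using 1(4) by (auto simp: v' partitions_def sorted_wrt_append)
  have "x \<notin> set xs" if "x \<in> set (b # v)" for x
  proof
    assume "x \<in> set xs"
    then have "x < b" using 1(4) by (simp add: v' partitions_def sorted_wrt_append)
    then show False using that 1(3) by auto
  qed
  then have sub: "set (b # v) \<subseteq> set (b # ys)" using 1(5) by (auto simp: v')
  have m: "mesh (b # v) * M \<le> 1" "(b - t) * M \<le> 1"
    using mesh_Cons_mult_le[OF 1(6)] M_pos by auto
  have IH: "mesh (b # ys) \<le> mesh (b # v)"
      "infnorm (E (b # v) g - E (b # ys) g) \<le> M\<^sup>2 * mesh (b # v) * (last (b # v) - b) * infnorm g"
    using 1(1)[OF _ _ p2 sub m(1)] 1(3) by auto
  have mx: "mesh (xs @ [b]) \<le> b - t" using mesh_le_length[of "xs @ [b]"] p1 by (auto simp: partitions_def)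
  have mesh': "mesh v' \<le> mesh (t # b # v)"
    using mx IH(1) by (auto simp: v' mesh_append[of xs b ys])
  let ?h = "E (b # v) g" and ?h' = "E (b # ys) g" and ?d = "b - t" and ?m = "mesh (t # b # v)"
  have "mesh (b # ys) * M \<le> 1" using IH(1) m M_pos by (meson mult_right_mono less_imp_le order_trans)
  then have h': "infnorm ?h' \<le> infnorm g"
    using p2 by (intro lower_transition_operator_infnorm_le euler_lower_transition_operator) (auto simp: partitions_def)
  have mx': "mesh (xs @ [b]) * M \<le> 1" using mx m M_pos by (meson mult_right_mono less_imp_le order_trans)
  \<comment> \<open>The coarse step carries the inductive error without enlarging it.\<close>
  have a: "infnorm ((?h + ?d *\<^sub>R q ?h) - (?h' + ?d *\<^sub>R q ?h')) \<le> infnorm (?h - ?h')"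
    using lower_transition_operator_nonexpansive[OF step[OF _ m(2)], of ?h ?h'] \<open>t < b\<close> by simp
  have "infnorm (E (xs @ [b]) ?h' - ?h' - ?d *\<^sub>R q ?h') \<le> M\<^sup>2 * ?d\<^sup>2 * infnorm ?h'"
    using euler_first_order[of "xs @ [b]" ?h'] p1 mx' by (auto simp: partitions_def)
  also have "\<dots> \<le> M\<^sup>2 * (?d * ?m) * infnorm g"
    using h' \<open>t < b\<close> infnorm_pos_le[of ?h'] unfolding power2_eq_square[of ?d]
    by (intro mult_mono mult_left_mono) auto
  finally have b: "infnorm ((?h' + ?d *\<^sub>R q ?h') - E (xs @ [b]) ?h') \<le> M\<^sup>2 * (?d * ?m) * infnorm g"
    by (subst infnorm_sub) (simp add: algebra_simps)
  have "M\<^sup>2 * mesh (b # v) * (last (b # v) - b) * infnorm g \<le> M\<^sup>2 * ?m * (last (b # v) - b) * infnorm g"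
    using infnorm_pos_le[of g] sorted_wrt_hd_le_last[of "b # v"] 1(3)
    by (intro mult_right_mono mult_left_mono) auto
  moreover have "E v' g = E (xs @ [b]) ?h'" by (simp add: v' euler_product_append[of q xs b ys])
  then have "infnorm (E (t # b # v) g - E v' g) \<le>
     infnorm ((?h + ?d *\<^sub>R q ?h) - (?h' + ?d *\<^sub>R q ?h')) + infnorm ((?h' + ?d *\<^sub>R q ?h') - E (xs @ [b]) ?h')"
    using infnorm_triangle[of "(?h + ?d *\<^sub>R q ?h) - (?h' + ?d *\<^sub>R q ?h')" "(?h' + ?d *\<^sub>R q ?h') - E (xs @ [b]) ?h'"]
    by (simp only: euler_product.simps Let_def diff_add_cancel) (simp add: algebra_simps)
  ultimately have "infnorm (E (t # b # v) g - E v' g) \<le>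
     M\<^sup>2 * ?m * (last (b # v) - b) * infnorm g + M\<^sup>2 * (?d * ?m) * infnorm g"
    using a b IH(2) by linarith
  also have "\<dots> = M\<^sup>2 * ?m * (last (t # b # v) - hd (t # b # v)) * infnorm g" by (simp add: algebra_simps)
  finally show ?case using mesh' by blast
next
  case ("2_2" a)
  then have "v' = [a]" by (cases v') (auto simp: partitions_def split: if_splits)
  then show ?case by (simp add: infnorm_0)
qed simp

lemma euler_diff:
  assumes "v \<in> partitions t s" "w \<in> partitions t s" "mesh v * M \<le> 1" "mesh w * M \<le> 1"
  shows "infnorm (E v g - E w g) \<le> M\<^sup>2 * (mesh v + mesh w) * (s - t) * infnorm g"
proof -
  \<comment> \<open>The common refinement, with which both products are compared.\<close>
  define r where "r = sorted_list_of_set (set v \<union> set w)"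
  have le: "t \<le> x \<and> x \<le> s" if "x \<in> set v \<union> set w" for x
    using sorted_wrt_between_hd_last[of v x] sorted_wrt_between_hd_last[of w x] that assms
    by (auto simp: partitions_def)
  have mem: "t \<in> set v" "s \<in> set v" using assms(1) by (auto simp: partitions_def)
  have sr: "sorted_wrt (<) r" "set r = set v \<union> set w" by (auto simp: r_def)
  have ne: "r \<noteq> []" using mem sr(2) by auto
  have "hd r \<in> set v \<union> set w" "last r \<in> set v \<union> set w" 
    using ne sr(2) hd_in_set[of r] last_in_set[of r] by auto
  then have "hd r \<ge> t" "last r \<le> s" using le[of "hd r"] le[of "last r"] by auto
  moreover have "hd r \<le> x" "x \<le> last r" if "x \<in> set r" for x
    using that sr(1) sorted_wrt_between_hd_last[of r x] by auto
  ultimately have "hd r = t" "last r = s" 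
    using mem sr(2) by (auto intro!: order.antisym)
  then have r: "r \<in> partitions t s" using sr(1) ne by (auto simp: partitions_def)
  have "infnorm (E v g - E r g) \<le> M\<^sup>2 * mesh v * (s - t) * infnorm g"
    using euler_refine[of v r g] assms r sr by (auto simp: partitions_def)
  moreover have "infnorm (E w g - E r g) \<le> M\<^sup>2 * mesh w * (s - t) * infnorm g"
    using euler_refine[of w r g] assms r sr by (auto simp: partitions_def)
  moreover have "infnorm (E v g - E w g) \<le> infnorm (E v g - E r g) + infnorm (E w g - E r g)"
    using infnorm_triangle[of "E v g - E r g" "E r g - E w g"] by (simp add: infnorm_sub)
  ultimately show ?thesis by (simp add: algebra_simps)
qed

end

section \<open>Existence, uniqueness and semigroup property of the limit operators\<close>

lemma nonpos_of_le_small_multiples: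
  assumes "0 < c" "\<And>d. 0 < d \<Longrightarrow> d \<le> c \<Longrightarrow> a \<le> d * (K :: real)"
  shows "a \<le> 0"
proof (rule ccontr)
  assume a: "\<not> a \<le> 0"
  then have "0 < a / (2 * (\<bar>K\<bar> + 1))" by simp
  \<comment> \<open>The \<open>+ 1\<close> avoids division by zero when \<open>K = 0\<close>; the
    factor \<open>2\<close> leaves the contradiction \<open>a \<le> a / 2\<close>.\<close>
  define d where "d = min c (a / (2 * (\<bar>K\<bar> + 1)))"
  have d: "0 < d" "d \<le> c" "d \<le> a / (2 * (\<bar>K\<bar> + 1))" using assms(1) a by (auto simp: d_def)
  have "a \<le> d * \<bar>K\<bar>" using assms(2)[OF d(1,2)] d(1) by (meson abs_ge_self mult_left_mono less_imp_le order_trans)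
  also have "\<dots> \<le> d * (\<bar>K\<bar> + 1)" using d by simp
  also have "\<dots> \<le> a / 2" using d(3) by (simp add: field_simps)
  finally show False using a by simp
qed

lemma convergent_of_rate:
  fixes X :: "nat \<Rightarrow> real"
  assumes "\<And>n m. \<bar>X n - X m\<bar> \<le> K * (1 / (real n + 1) + 1 / (real m + 1))"
  shows "convergent X"
proof -
  have "Cauchy X"
  proof (rule CauchyI)
    fix e :: real assume "0 < e"
    obtain N :: nat where N: "2 * \<bar>K\<bar> / e < real N" using reals_Archimedean2 by blast
    show "\<exists>M. \<forall>m\<ge>M. \<forall>n\<ge>M. norm (X m - X n) < e"
    proof (intro exI allI impI)
      fix m n assume "N \<le> m" "N \<le> n"
      then have *: "1 / (real m + 1) \<le> 1 / (real N + 1)" "1 / (real n + 1) \<le> 1 / (real N + 1)"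
        by (auto intro!: divide_left_mono)
      have "\<bar>X m - X n\<bar> \<le> \<bar>K\<bar> * (1 / (real m + 1) + 1 / (real n + 1))"
        using assms[of m n] by (smt (verit) mult_right_mono divide_nonneg_nonneg of_nat_0_le_iff)
      also have "\<dots> \<le> \<bar>K\<bar> * (1 / (real N + 1) + 1 / (real N + 1))"
        using * by (intro mult_left_mono add_mono) auto
      also have "\<dots> = 2 * \<bar>K\<bar> / (real N + 1)" by simp
      also have "\<dots> < e" using N \<open>0 < e\<close> by (simp add: field_simps)
      finally show "norm (X m - X n) < e" by simp
    qed
  qed
  then show ?thesis by (rule Cauchy_convergent)
qed

context lower_rate
begin

text \<open>The limit is taken componentwise along one sequence of partitions. The estimate for an
  arbitrary \<open>v\<close> survives because \<open>euler_diff\<close> compares \<open>v\<close>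
  with every member of that sequence.\<close>

lemma euler_limit_exists:
  assumes "t \<le> s"
  shows "\<exists>T. lower_transition_operator T \<and> (\<forall>v\<in>partitions t s. mesh v * M \<le> 1 \<longrightarrow>
    (\<forall>g. infnorm (T g - E v g) \<le> M\<^sup>2 * mesh v * (s - t) * infnorm g))"
proof -
  \<comment> \<open>The factor \<open>1 / M\<close> gives \<open>mesh v * M \<le> 1\<close> already
    at \<open>n = 0\<close>, so that every product of the sequence is a lower transition
    operator.\<close>
  have "\<forall>n. \<exists>v\<in>partitions t s. mesh v \<le> 1 / (M * (real n + 1))" for n :: nat
    using assms M_pos by (intro allI partitions_mesh_exists) auto
  then obtain vn where vn: "vn n \<in> partitions t s" "mesh (vn n) \<le> 1 / (M * (real n + 1))" for n :: nat
    by metis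
  have mvn: "mesh (vn n) * M \<le> 1 / (real n + 1)" for n
    using mult_right_mono[OF vn(2)[of n], of M] M_pos by simp
  then have mvn1: "mesh (vn n) * M \<le> 1" for n
    using order_trans[OF mvn[of n], of 1] by (simp add: divide_le_eq)
  have vns: "sorted_wrt (<) (vn n)" for n using vn(1)[of n] by (simp add: partitions_def)
  have near: "\<bar>E v g $ x - E (vn n) g $ x\<bar> \<le> M * (s - t) * infnorm g * (mesh v * M + 1 / (real n + 1))"
    if "v \<in> partitions t s" "mesh v * M \<le> 1" for v n g x
  proof -
    have "\<bar>E v g $ x - E (vn n) g $ x\<bar> \<le> infnorm (E v g - E (vn n) g)"
      using component_le_infnorm_cart[of "E v g - E (vn n) g" x] by simp
    also have "\<dots> \<le> M\<^sup>2 * (mesh v + mesh (vn n)) * (s - t) * infnorm g"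
      using that vn mvn1 by (intro euler_diff) auto
    also have "\<dots> = M * (s - t) * infnorm g * (mesh v * M + mesh (vn n) * M)"
      by (simp add: power2_eq_square algebra_simps)
    also have "\<dots> \<le> M * (s - t) * infnorm g * (mesh v * M + 1 / (real n + 1))"
      using mvn[of n] M_pos assms infnorm_pos_le[of g] by (intro mult_left_mono) auto
    finally show ?thesis .
  qed
  have "convergent (\<lambda>n. E (vn n) g $ x)" for g x
  proof (rule convergent_of_rate[of _ "M * (s - t) * infnorm g"])
    fix n m
    have "0 \<le> M * (s - t) * infnorm g" using M_pos assms infnorm_pos_le[of g] by simp
    from mult_left_mono[OF mvn[of n] this] near[OF vn(1)[of n] mvn1[of n], of g x m]
    show "\<bar>E (vn n) g $ x - E (vn m) g $ x\<bar> \<le> M * (s - t) * infnorm g * (1 / (real n + 1) + 1 / (real m + 1))"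
      by (simp add: distrib_left)
  qed
  define T where "T g = (\<chi> x. lim (\<lambda>n. E (vn n) g $ x))" for g
  have T: "(\<lambda>n. E (vn n) g $ x) \<longlonglongrightarrow> T g $ x" for g x
    using \<open>convergent (\<lambda>n. E (vn n) g $ x)\<close> by (simp add: T_def convergent_LIMSEQ_iff)
  have Eltr: "lower_transition_operator (E (vn n))" for n
    using vns mvn1 by (intro euler_lower_transition_operator)
  have "lower_transition_operator T"
    unfolding lower_transition_operator_def
  proof (intro conjI allI impI)
    fix f g x
    show "(MIN y. f $ y) \<le> T f $ x"
      using lower_transition_operatorD(1)[OF Eltr] by (intro LIMSEQ_le_const[OF T]) auto
    show "T f $ x + T g $ x \<le> T (f + g) $ x"
      using lower_transition_operatorD(2)[OF Eltr]
      by (intro LIMSEQ_le[OF tendsto_add[OF T T] T]) auto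
  next
    fix f and c :: real assume "0 \<le> c"
    have "T (c *\<^sub>R f) $ x = (c *\<^sub>R T f) $ x" for x
    proof (rule LIMSEQ_unique[OF T])
      show "(\<lambda>n. E (vn n) (c *\<^sub>R f) $ x) \<longlonglongrightarrow> (c *\<^sub>R T f) $ x"
        using tendsto_mult_left[OF T, of c] lower_transition_operatorD(3)[OF Eltr \<open>0 \<le> c\<close>] by simp
    qed
    then show "T (c *\<^sub>R f) = c *\<^sub>R T f" by (simp add: vec_eq_iff)
  qed
  moreover have "infnorm (T g - E v g) \<le> M\<^sup>2 * mesh v * (s - t) * infnorm g"
    if v: "v \<in> partitions t s" "mesh v * M \<le> 1" for v g
    unfolding infnorm_le_cart_iff
  proof
    fix x
    have "(\<lambda>n. 1 / (real n + 1)) \<longlonglongrightarrow> 0" by real_asymp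
    then have "(\<lambda>n. M * (s - t) * infnorm g * (mesh v * M + 1 / (real n + 1))) \<longlonglongrightarrow>
        M * (s - t) * infnorm g * (mesh v * M + 0)"
      by (intro tendsto_intros)
    moreover have "(\<lambda>n. \<bar>E v g $ x - E (vn n) g $ x\<bar>) \<longlonglongrightarrow> \<bar>E v g $ x - T g $ x\<bar>"
      by (intro tendsto_intros T)
    ultimately have "\<bar>E v g $ x - T g $ x\<bar> \<le> M * (s - t) * infnorm g * (mesh v * M + 0)"
      using near[OF v] by (intro LIMSEQ_le[of _ _ _ "M * (s - t) * infnorm g * (mesh v * M + 0)"]) auto
    then show "\<bar>(T g - E v g) $ x\<bar> \<le> M\<^sup>2 * mesh v * (s - t) * infnorm g"
      by (simp add: power2_eq_square algebra_simps abs_minus_commute)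
  qed
  ultimately show ?thesis by blast
qed

text \<open>This discharges the \<open>THE\<close> in \<open>lower_trans\<close>: the operator with
  the explicit error bound meets the condition, and any other candidate is approximated by the same
  Euler products. Later proofs use \<open>lower_trans\<close> only through these two facts and their
  consequences.\<close>

lemma lower_trans_euler:
  assumes "t \<le> s"
  shows "lower_transition_operator (lower_trans q t s)"
    and "v \<in> partitions t s \<Longrightarrow> mesh v * M \<le> 1 \<Longrightarrow>
      infnorm (lower_trans q t s g - E v g) \<le> M\<^sup>2 * mesh v * (s - t) * infnorm g"
proof -
  obtain T where T: "lower_transition_operator T"
    and TE: "\<And>v g. v \<in> partitions t s \<Longrightarrow> mesh v * M \<le> 1 \<Longrightarrow>
      infnorm (T g - E v g) \<le> M\<^sup>2 * mesh v * (s - t) * infnorm g"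
    using euler_limit_exists[OF assms] by blast
  have eq: "lower_trans q t s = T"
    unfolding lower_trans_def
  proof (rule the_equality, intro conjI T allI impI)
    fix e :: real assume "0 < e"
    \<comment> \<open>\<open>1 / M\<close> puts the partition into the range of the estimate; the
      other term makes the error at most \<open>e\<close>, with \<open>+ 1\<close> for the case
      \<open>s = t\<close>.\<close>
    define d where "d = min (1 / M) (e / (M\<^sup>2 * (s - t) + 1))"
    have pos: "0 < M\<^sup>2 * (s - t) + 1" using assms by (simp add: add_nonneg_pos)
    have "d \<le> 1 / M" "d \<le> e / (M\<^sup>2 * (s - t) + 1)" by (auto simp: d_def)
    then have d: "0 < d" "d * M \<le> 1" "d * (M\<^sup>2 * (s - t) + 1) \<le> e"
      using M_pos \<open>0 < e\<close> pos by (simp_all only: pos_le_divide_eq) (simp add: d_def)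
    show "\<exists>\<delta>>0. \<forall>v\<in>partitions t s. mesh v \<le> \<delta> \<longrightarrow> op_norm (\<lambda>f. T f - E v f) \<le> e"
    proof (intro exI[of _ d] conjI ballI impI d(1) op_norm_le)
      fix v f assume v: "v \<in> partitions t s" "mesh v \<le> d" and f: "infnorm (f :: real ^ 'x) = 1"
      have "mesh v * M \<le> 1" using v(2) d(2) M_pos by (meson mult_right_mono less_imp_le order_trans)
      then have "infnorm (T f - E v f) \<le> M\<^sup>2 * mesh v * (s - t) * infnorm f" using v(1) TE by blast
      also have "\<dots> = mesh v * (M\<^sup>2 * (s - t))" by (simp add: f algebra_simps)
      also have "\<dots> \<le> d * (M\<^sup>2 * (s - t) + 1)" using v(2) d(1) assms by (intro mult_mono) auto
      finally show "infnorm (T f - E v f) \<le> e" using d(3) by simp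
    qed
  next
    fix S assume S: "lower_transition_operator S \<and> (\<forall>\<epsilon>>0. \<exists>\<delta>>0. \<forall>v\<in>partitions t s. mesh v \<le> \<delta> \<longrightarrow>
        op_norm (\<lambda>f. S f - E v f) \<le> \<epsilon>)"
    \<comment> \<open>\<open>op_norm\<close> sees unit vectors only; homogeneity extends the
      agreement to all vectors below.\<close>
    have unit: "S f = T f" if f: "infnorm f = 1" for f
    proof -
      have "infnorm (S f - T f) \<le> 0 + e" if "0 < e" for e
      proof -
        obtain \<delta> where \<delta>: "0 < \<delta>" "\<And>v. v\<in>partitions t s \<Longrightarrow> mesh v \<le> \<delta> \<Longrightarrow> op_norm (\<lambda>f. S f - E v f) \<le> e"
          using S \<open>0 < e\<close> by blast
        have "infnorm (S f - T f) - e \<le> 0"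
        proof (rule nonpos_of_le_small_multiples)
          show "0 < min \<delta> (1 / M)" using \<delta>(1) M_pos by simp
          fix d assume d: "0 < d" "d \<le> min \<delta> (1 / M)"
          obtain v where v: "v \<in> partitions t s" "mesh v \<le> d"
            using partitions_mesh_exists[OF assms d(1)] by blast
          have "d * M \<le> 1" using d M_pos by (simp add: field_simps)
          then have m: "mesh v * M \<le> 1" using v(2) M_pos by (meson mult_right_mono less_imp_le order_trans)
          have "lower_transition_operator (E v)"
            using v m by (intro euler_lower_transition_operator) (auto simp: partitions_def)
          \<comment> \<open>Both operators are nonexpansive, so their difference is bounded by
            \<open>2\<close> on the unit sphere and \<open>op_norm\<close> is a genuine
            bound.\<close>
          then have "infnorm (S f - E v f) \<le> 2" if "infnorm f = 1" for f
            using infnorm_triangle[of "S f" "- E v f"] that S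
              lower_transition_operator_infnorm_le[of S f] lower_transition_operator_infnorm_le[of "E v" f]
            by (simp add: infnorm_neg)
          then have "infnorm (S f - E v f) \<le> e"
            using op_norm_ge[of "\<lambda>f. S f - E v f" 2 f] f \<delta>(2)[OF v(1)] v(2) d(2) by force
          moreover have "infnorm (T f - E v f) \<le> mesh v * (M\<^sup>2 * (s - t))"
            using TE[OF v(1) m, of f] f by (simp add: algebra_simps)
          moreover have "mesh v * (M\<^sup>2 * (s - t)) \<le> d * (M\<^sup>2 * (s - t))"
            using v(2) assms by (intro mult_right_mono) auto
          moreover have "infnorm (S f - T f) \<le> infnorm (S f - E v f) + infnorm (T f - E v f)"
            using infnorm_triangle[of "S f - E v f" "E v f - T f"] by (simp add: infnorm_sub)
          ultimately show "infnorm (S f - T f) - e \<le> d * (M\<^sup>2 * (s - t))" by linarith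
        qed
        then show ?thesis by simp
      qed
      then have "infnorm (S f - T f) \<le> 0" by (rule field_le_epsilon)
      then show ?thesis using infnorm_eq_0[of "S f - T f"] infnorm_pos_le[of "S f - T f"] by simp
    qed
    show "S = T"
    proof
      fix f show "S f = T f"
      proof (cases "f = 0")
        case True then show ?thesis using S T lower_transition_operatorD(4) by metis
      next
        case False
        define c where "c = infnorm f"
        have c: "0 < c" using False infnorm_pos_lt[of f] by (simp add: c_def)
        have "infnorm ((1 / c) *\<^sub>R f) = 1" using c by (simp add: infnorm_mul c_def)
        from unit[OF this] have "c *\<^sub>R S ((1 / c) *\<^sub>R f) = c *\<^sub>R T ((1 / c) *\<^sub>R f)" by simp
        then have "S (c *\<^sub>R (1 / c) *\<^sub>R f) = T (c *\<^sub>R (1 / c) *\<^sub>R f)"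
          using S T c lower_transition_operatorD(3) by (metis less_imp_le)
        then show ?thesis using c by simp
      qed
    qed
  qed
  show "lower_transition_operator (lower_trans q t s)" using T eq by simp
  show "v \<in> partitions t s \<Longrightarrow> mesh v * M \<le> 1 \<Longrightarrow>
      infnorm (lower_trans q t s g - E v g) \<le> M\<^sup>2 * mesh v * (s - t) * infnorm g"
    using TE eq by simp
qed

lemma lower_trans_first_order:
  assumes "t < s" "(s - t) * M \<le> 1"
  shows "infnorm (lower_trans q t s g - g - (s - t) *\<^sub>R q g) \<le> M\<^sup>2 * (s - t)\<^sup>2 * infnorm g"
  using lower_trans_euler(2)[of t s "[t, s]" g] assms
  by (simp add: partitions_def Let_def power2_eq_square algebra_simps)

text \<open>The Euler product of a concatenated partition factors exactly. What remains are three
  approximation errors, all multiples of the mesh bound \<open>d\<close>.\<close>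

lemma lower_trans_semigroup:
  assumes "t \<le> r" "r \<le> s"
  shows "lower_trans q t r (lower_trans q r s g) = lower_trans q t s g"
proof -
  let ?A = "lower_trans q t r" and ?B = "lower_trans q r s" and ?C = "lower_trans q t s"
  have "infnorm (?A (?B g) - ?C g) \<le> 0"
  proof (rule nonpos_of_le_small_multiples)
    show "0 < 1 / M" using M_pos by simp
    fix d assume d: "0 < d" "d \<le> 1 / M"
    obtain v w where v: "v \<in> partitions t r" "mesh v \<le> d" and w: "w \<in> partitions r s" "mesh w \<le> d"
      using partitions_mesh_exists d(1) assms by metis
    have dM: "d * M \<le> 1" using d M_pos by (simp add: field_simps)
    have m: "mesh v * M \<le> 1" "mesh w * M \<le> 1"
      using v(2) w(2) dM M_pos by (meson mult_right_mono less_imp_le order_trans)+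
    have "max (mesh v) (mesh w) \<le> d" using v w by simp
    note vw = partitions_append[OF v(1) w(1)]
    have mvw: "mesh (v @ tl w) * M \<le> 1" using m M_pos by (simp add: vw(2) max_mult_distrib_right)
    have Ev: "lower_transition_operator (E v)"
      using v m by (intro euler_lower_transition_operator) (auto simp: partitions_def)
    have i: "M\<^sup>2 * x * y * infnorm h \<le> d * (M\<^sup>2 * y * infnorm g)"
      if "x \<le> d" "0 \<le> x" "0 \<le> y" "infnorm h \<le> infnorm g" for x y and h :: "real ^ 'x"
    proof -
      have "M\<^sup>2 * x * y * infnorm h = x * (M\<^sup>2 * y * infnorm h)" by (simp add: algebra_simps)
      also have "\<dots> \<le> d * (M\<^sup>2 * y * infnorm g)"
        using that infnorm_pos_le[of h] by (intro mult_mono mult_left_mono) auto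
      finally show ?thesis .
    qed
    have Bg: "infnorm (?B g) \<le> infnorm g"
      by (rule lower_transition_operator_infnorm_le[OF lower_trans_euler(1)[OF assms(2)]])
    have "infnorm (?A (?B g) - E v (?B g)) \<le> d * (M\<^sup>2 * (r - t) * infnorm g)"
      using order_trans[OF lower_trans_euler(2)[OF assms(1) v(1) m(1)] i[OF v(2) mesh_nonneg _ Bg]] assms by simp
    moreover have "infnorm (E v (?B g) - E v (E w g)) \<le> d * (M\<^sup>2 * (s - r) * infnorm g)"
      using order_trans[OF lower_transition_operator_nonexpansive[OF Ev]
          order_trans[OF lower_trans_euler(2)[OF assms(2) w(1) m(2)] i[OF w(2) mesh_nonneg]]] assms by simp
    moreover have "infnorm (?C g - E v (E w g)) \<le> d * (M\<^sup>2 * (s - t) * infnorm g)"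
      using order_trans[OF lower_trans_euler(2)[OF _ vw(1) mvw] i[OF _ mesh_nonneg], of g] assms
        \<open>max (mesh v) (mesh w) \<le> d\<close> by (simp add: vw)
    moreover have "infnorm (?A (?B g) - ?C g) \<le> infnorm (?A (?B g) - E v (?B g))
        + infnorm (E v (?B g) - E v (E w g)) + infnorm (?C g - E v (E w g))"
      using infnorm_triangle[of "?A (?B g) - E v (?B g)" "E v (?B g) - E v (E w g)"]
        infnorm_triangle[of "?A (?B g) - E v (E w g)" "E v (E w g) - ?C g"]
      by (simp add: infnorm_sub)
    ultimately show "infnorm (?A (?B g) - ?C g) \<le> d * (M\<^sup>2 * (r - t) * infnorm g
        + M\<^sup>2 * (s - r) * infnorm g + M\<^sup>2 * (s - t) * infnorm g)"
      by (simp add: distrib_left)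
  qed
  then show ?thesis using infnorm_eq_0[of "?A (?B g) - ?C g"] infnorm_pos_le[of "?A (?B g) - ?C g"] by simp
qed

end

section \<open>Bounded sets of rate matrices and their lower envelope\<close>

lemma infnorm_axis: "infnorm (axis y 1 :: real ^ 'x::finite) = 1"
proof (rule antisym)
  show "infnorm (axis y 1 :: real ^ 'x) \<le> 1" by (auto simp: infnorm_le_cart_iff axis_def)
  show "1 \<le> infnorm (axis y 1 :: real ^ 'x)"
    using component_le_infnorm_cart[of "axis y 1 :: real ^ 'x" y] by (simp add: axis_def)
qed

lemma matrix_vector_component_le:
  fixes A :: "real ^ 'x::finite ^ 'y::finite"
  assumes "\<And>y. \<bar>A $ x $ y\<bar> \<le> b"
  shows "\<bar>(A *v f) $ x\<bar> \<le> real CARD('x) * b * infnorm f"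
proof -
  have "\<bar>(A *v f) $ x\<bar> \<le> (\<Sum>y\<in>UNIV. \<bar>A $ x $ y * f $ y\<bar>)"
    by (simp add: matrix_vector_mult_def)
  also have "\<dots> \<le> (\<Sum>y\<in>(UNIV :: 'x set). b * infnorm f)"
    using assms component_le_infnorm_cart[of f]
    by (intro sum_mono) (auto simp: abs_mult intro!: mult_mono order_trans[OF abs_ge_zero assms])
  finally show ?thesis by simp
qed

lemma op_norm_matrix_le:
  fixes A :: "real ^ 'x::finite ^ 'x"
  assumes "\<And>x y. \<bar>A $ x $ y\<bar> \<le> b"
  shows "op_norm ((*v) A) \<le> real CARD('x) * b"
proof (rule op_norm_le)
  fix f :: "real ^ 'x" assume "infnorm f = 1"
  then show "infnorm (A *v f) \<le> real CARD('x) * b"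
    using matrix_vector_component_le[of A _ b f] assms by (simp add: infnorm_le_cart_iff)
qed

lemma matrix_entry_le_op_norm:
  fixes A :: "real ^ 'x::finite ^ 'x"
  shows "\<bar>A $ x $ y\<bar> \<le> op_norm ((*v) A)"
proof -
  \<comment> \<open>Some entry bound makes the supremum behind \<open>op_norm\<close> finite; the
    entry is then read off at a basis vector.\<close>
  obtain b where b: "\<And>x y. \<bar>A $ x $ y\<bar> \<le> b"
  proof
    fix x y show "\<bar>A $ x $ y\<bar> \<le> (MAX p. \<bar>A $ fst p $ snd p\<bar>)"
      by (rule Max_ge) (auto intro: rev_image_eqI[of "(x, y)"])
  qed
  have "\<bar>A $ x $ y\<bar> = \<bar>(A *v axis y 1) $ x\<bar>" by (simp add: matrix_vector_mult_basis column_def)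
  also have "\<dots> \<le> infnorm (A *v axis y 1)" by (rule component_le_infnorm_cart)
  also have "\<dots> \<le> op_norm ((*v) A)"
  proof (rule op_norm_ge[OF _ infnorm_axis])
    fix f :: "real ^ 'x" assume "infnorm f = 1"
    then show "infnorm (A *v f) \<le> real CARD('x) * b"
      using matrix_vector_component_le[of A _ b f] b by (simp add: infnorm_le_cart_iff)
  qed
  finally show ?thesis .
qed

lemma bounded_matrices_entries:
  assumes "bounded_matrices \<Q>"
  obtains m where "0 < m" "\<And>Q x y. Q \<in> \<Q> \<Longrightarrow> \<bar>Q $ x $ y\<bar> \<le> m"
proof -
  obtain B where B: "\<And>Q. Q \<in> \<Q> \<Longrightarrow> op_norm ((*v) Q) \<le> B"
    using assms by (auto simp: bounded_matrices_def bdd_above_def)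
  show ?thesis
  proof (rule that[of "max B 1"])
    fix Q x y assume "Q \<in> \<Q>"
    then show "\<bar>Q $ x $ y\<bar> \<le> max B 1" using B matrix_entry_le_op_norm[of Q x y] by fastforce
  qed simp
qed

text \<open>\<open>m\<close> serves the entrywise estimates for transition rows, \<open>M\<close>
  the operator estimates, by \<open>row_le\<close>.\<close>

locale rate_set =
  fixes \<Q> :: "(real ^ 'x::finite ^ 'x) set" and m M :: real
  assumes M_eq: "M = real CARD('x) * m" and nonempty: "\<Q> \<noteq> {}" and rate: "\<Q> \<subseteq> rate_matrices" and m_pos: "0 < m"
    and entry_le: "Q \<in> \<Q> \<Longrightarrow> \<bar>Q $ x $ y\<bar> \<le> m"
begin

abbreviation "qlow \<equiv> lower_envelope \<Q>"

lemma M_ge: "m \<le> M" "0 < M"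
proof -
  have "1 \<le> real CARD('x)" using zero_less_card_finite[where 'a='x] by linarith
  then show "m \<le> M" using m_pos by (simp add: M_eq)
  then show "0 < M" using m_pos by linarith
qed

lemma row_le: "Q \<in> \<Q> \<Longrightarrow> \<bar>(Q *v f) $ x\<bar> \<le> M * infnorm f"
  unfolding M_eq by (rule matrix_vector_component_le) (rule entry_le)

lemma qlow_le: "Q \<in> \<Q> \<Longrightarrow> qlow f $ x \<le> (Q *v f) $ x"
  unfolding lower_envelope_def
  using row_le[of _ f x] by (auto intro!: cINF_lower bdd_belowI2[of _ "- (M * infnorm f)"] simp: abs_le_iff minus_le_iff)

lemma qlow_ge: "(\<And>Q. Q \<in> \<Q> \<Longrightarrow> c \<le> (Q *v f) $ x) \<Longrightarrow> c \<le> qlow f $ x"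
  unfolding lower_envelope_def using nonempty by (auto intro!: cINF_greatest)

lemma qlow_approx: "0 < e \<Longrightarrow> \<exists>Q\<in>\<Q>. (Q *v f) $ x < qlow f $ x + e"
  using qlow_ge[of "qlow f $ x + e" f x] by (metis less_add_same_cancel1 not_le)

text \<open>Together with the zero row sums of \<open>Q\<close> this makes \<open>I + d Q\<close> a
  stochastic matrix. The diagonal stays nonnegative because \<open>m \<le> M\<close>.\<close>

lemma step_nonneg:
  assumes "Q \<in> \<Q>" "0 \<le> d" "d * M \<le> 1"
  shows "0 \<le> (if x = y then 1 else 0) + d * Q $ x $ y"
proof (cases "x = y")
  case True
  have "d * m \<le> 1" using assms M_ge by (meson mult_left_mono order_trans)
  then have "\<bar>d * Q $ x $ y\<bar> \<le> 1"
    using entry_le[OF assms(1), of x y] assms(2) by (auto simp: abs_mult intro: order_trans[OF mult_left_mono])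
  then show ?thesis using True by simp
next
  case False then show ?thesis using assms rate by (auto simp: rate_matrices_def)
qed

text \<open>Superadditivity and homogeneity pass to an infimum of linear maps. The minimum property
  holds because each \<open>I + d Q\<close> with \<open>d * M \<le> 1\<close> is stochastic, so that
  its values are averages of \<open>f\<close>.\<close>

sublocale lower_rate qlow M
proof
  show "0 < M" by (rule M_ge)
  have le: "qlow f $ x \<le> qlow g $ x + M * infnorm (f - g)" for f g x
  proof -
    have "qlow f $ x - M * infnorm (f - g) \<le> qlow g $ x"
    proof (rule qlow_ge)
      fix Q assume Q: "Q \<in> \<Q>"
      have "(Q *v f) $ x = (Q *v g) $ x + (Q *v (f - g)) $ x"
        by (simp add: matrix_vector_mult_diff_distrib)
      then show "qlow f $ x - M * infnorm (f - g) \<le> (Q *v g) $ x"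
        using qlow_le[OF Q, of f x] row_le[OF Q, of "f - g" x] by linarith
    qed
    then show ?thesis by simp
  qed
  show "infnorm (qlow f - qlow g) \<le> M * infnorm (f - g)" for f g
    unfolding infnorm_le_cart_iff
  proof
    fix x
    have "infnorm (g - f) = infnorm (f - g)" by (rule infnorm_sub)
    then show "\<bar>(qlow f - qlow g) $ x\<bar> \<le> M * infnorm (f - g)"
      using le[of f x g] le[of g x f] by (simp add: abs_le_iff)
  qed
  have superadd: "qlow f $ x + qlow g $ x \<le> qlow (f + g) $ x" for f g x
    using qlow_le[of _ f x] qlow_le[of _ g x]
    by (intro qlow_ge) (simp add: matrix_vector_right_distrib add_mono)
  have hom: "c * qlow f $ x \<le> qlow (c *\<^sub>R f) $ x" if "0 \<le> c" for f c x
    using qlow_le[of _ f x] that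
    by (intro qlow_ge) (simp add: matrix_vector_mult_scaleR mult_left_mono)
  have hom: "qlow (c *\<^sub>R f) = c *\<^sub>R qlow f" if "0 \<le> c" for f c
  proof -
    have "qlow (c *\<^sub>R f) $ x = c * qlow f $ x" for x
    \<comment> \<open>For \<open>c > 0\<close> the reverse inequality is the first one applied with
      \<open>1 / c\<close>; for \<open>c = 0\<close> any member of \<open>\<Q>\<close> shows that
      the infimum is not positive.\<close>
    proof (cases "c = 0")
      case True
      obtain Q where "Q \<in> \<Q>" using nonempty by blast
      then show ?thesis using hom[OF that, of f x] qlow_le[of Q 0 x] True by simp
    next
      case False
      then have "(1 / c) * qlow (c *\<^sub>R f) $ x \<le> qlow f $ x"
        using hom[of "1 / c" "c *\<^sub>R f" x] that by simp
      then have "qlow (c *\<^sub>R f) $ x \<le> c * qlow f $ x" using False that by (simp add: field_simps)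
      then show ?thesis using hom[OF that, of f x] by simp
    qed
    then show ?thesis by (simp add: vec_eq_iff)
  qed
  fix d assume d: "0 \<le> d" "d * M \<le> 1"
  show "lower_transition_operator (\<lambda>f. f + d *\<^sub>R qlow f)"
    unfolding lower_transition_operator_def
  proof (intro conjI allI impI)
    fix f g :: "real ^ 'x" and x
    show "(MIN y. f $ y) \<le> (f + d *\<^sub>R qlow f) $ x"
    proof (cases "d = 0")
      case False
      then have "0 < d" using d by simp
      \<comment> \<open>The claim is solved for \<open>qlow f\<close>, so that it can be shown for
        each \<open>Q\<close> separately.\<close>
      have "((MIN y. f $ y) - f $ x) / d \<le> qlow f $ x"
      proof (rule qlow_ge)
        fix Q assume Q: "Q \<in> \<Q>"
        have "(MIN y. f $ y) = (\<Sum>y\<in>UNIV. ((if x = y then 1 else 0) + d * Q $ x $ y) * (MIN y. f $ y))"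
          using Q rate by (subst sum_distrib_right[symmetric])
            (auto simp: sum.distrib sum_distrib_left[symmetric] rate_matrices_def)
        also have "\<dots> \<le> (\<Sum>y\<in>UNIV. ((if x = y then 1 else 0) + d * Q $ x $ y) * f $ y)"
          by (intro sum_mono mult_left_mono step_nonneg[OF Q d]) simp
        also have "\<dots> = (\<Sum>y\<in>UNIV. (if x = y then f $ y else 0) + d * (Q $ x $ y * f $ y))"
          by (intro sum.cong) (auto simp: algebra_simps)
        also have "\<dots> = f $ x + d * (Q *v f) $ x"
          by (simp add: matrix_vector_mult_def sum.distrib sum_distrib_left[symmetric])
        finally show "((MIN y. f $ y) - f $ x) / d \<le> (Q *v f) $ x" using \<open>0 < d\<close> by (simp add: field_simps)
      qed
      then show ?thesis using \<open>0 < d\<close> by (simp add: field_simps)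
    qed simp
  next
    fix f g :: "real ^ 'x" and x
    show "(f + d *\<^sub>R qlow f) $ x + (g + d *\<^sub>R qlow g) $ x \<le> (f + g + d *\<^sub>R qlow (f + g)) $ x"
      using mult_left_mono[OF superadd[of f x g] d(1)] by (simp add: distrib_left)
  qed (simp add: hom algebra_simps)
qed

end

section \<open>Coherent conditional probabilities\<close>

lemma event_algebra_memI:
  assumes "\<And>\<A>. algebra \<Omega> \<A> \<Longrightarrow>
    (\<And>t x. 0 \<le> t \<Longrightarrow> t \<in> u \<or> (\<forall>r\<in>u. r < t) \<Longrightarrow> state_event \<Omega> t x \<in> \<A>) \<Longrightarrow> A \<in> \<A>"
  shows "A \<in> event_algebra \<Omega> u"
  unfolding event_algebra_def hull_def
proof (rule InterI)
  fix \<A> assume "\<A> \<in> {t. algebra \<Omega> t \<and> {state_event \<Omega> t x |t x. 0 \<le> t \<and> (t \<in> u \<or> (\<forall>r\<in>u. r < t))} \<subseteq> t}"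
  then have "algebra \<Omega> \<A>" and sub: "{state_event \<Omega> t x |t x. 0 \<le> t \<and> (t \<in> u \<or> (\<forall>r\<in>u. r < t))} \<subseteq> \<A>"
    by simp_all
  then show "A \<in> \<A>" by (intro assms subsetD[OF sub]) auto
qed

lemma event_algebra_memD:
  assumes "A \<in> event_algebra \<Omega> u" "algebra \<Omega> \<A>"
    "\<And>t x. 0 \<le> t \<Longrightarrow> t \<in> u \<or> (\<forall>r\<in>u. r < t) \<Longrightarrow> state_event \<Omega> t x \<in> \<A>"
  shows "A \<in> \<A>"
proof -
  have "{state_event \<Omega> t x |t x. 0 \<le> t \<and> (t \<in> u \<or> (\<forall>r\<in>u. r < t))} \<subseteq> \<A>" using assms(3) by auto
  then have "event_algebra \<Omega> u \<subseteq> \<A>" unfolding event_algebra_def using assms(2) by (intro hull_minimal)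
  then show ?thesis using assms(1) by blast
qed

lemma state_event_in_event_algebra:
  "0 \<le> t \<Longrightarrow> t \<in> u \<or> (\<forall>r\<in>u. r < t) \<Longrightarrow> state_event \<Omega> t x \<in> event_algebra \<Omega> u"
  by (rule event_algebra_memI)

text \<open>The hull is the intersection of all algebras that contain the state events, and the
  closure properties are inherited from each of them; \<open>Pow \<Omega>\<close> shows that its
  members are subsets of \<open>\<Omega>\<close>.\<close>

lemma algebra_event_algebra: "algebra \<Omega> (event_algebra \<Omega> u)"
proof -
  have "algebra \<Omega> (Pow \<Omega>)" by (rule algebra_Pow)
  then have sub: "A \<subseteq> \<Omega>" if "A \<in> event_algebra \<Omega> u" for A
    using event_algebra_memD[OF that, of "Pow \<Omega>"] by (auto simp: state_event_def)
  moreover have "{} \<in> event_algebra \<Omega> u"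
    by (rule event_algebra_memI) (simp add: algebra_iff_Un)
  moreover have "\<Omega> - A \<in> event_algebra \<Omega> u" if "A \<in> event_algebra \<Omega> u" for A
  proof (rule event_algebra_memI)
    fix \<A> assume \<A>: "algebra \<Omega> \<A>"
      "\<And>t x. 0 \<le> t \<Longrightarrow> t \<in> u \<or> (\<forall>r\<in>u. r < t) \<Longrightarrow> state_event \<Omega> t x \<in> \<A>"
    show "\<Omega> - A \<in> \<A>" using \<A>(1) event_algebra_memD[OF that \<A>] by (simp add: algebra_iff_Un)
  qed
  moreover have "A \<union> B \<in> event_algebra \<Omega> u"
    if "A \<in> event_algebra \<Omega> u" "B \<in> event_algebra \<Omega> u" for A B
  proof (rule event_algebra_memI)
    fix \<A> assume \<A>: "algebra \<Omega> \<A>"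
      "\<And>t x. 0 \<le> t \<Longrightarrow> t \<in> u \<or> (\<forall>r\<in>u. r < t) \<Longrightarrow> state_event \<Omega> t x \<in> \<A>"
    show "A \<union> B \<in> \<A>"
      using \<A>(1) event_algebra_memD[OF that(1) \<A>] event_algebra_memD[OF that(2) \<A>] by (simp add: algebra_iff_Un)
  qed
  ultimately show ?thesis by (auto simp: algebra_iff_Un)
qed

interpretation event_algebra: algebra \<Omega> "event_algebra \<Omega> u" for \<Omega> u
  by (rule algebra_event_algebra)

lemma tuple_event_in_event_algebra:
  assumes "finite w" "\<And>t. t \<in> w \<Longrightarrow> 0 \<le> t \<and> (t \<in> u \<or> (\<forall>r\<in>u. r < t))"
  shows "tuple_event \<Omega> w x \<in> event_algebra \<Omega> u"
  using assms
proof (induction w)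
  case empty then show ?case by (simp add: tuple_event_def event_algebra.top)
next
  case (insert t w)
  have "tuple_event \<Omega> (insert t w) x = state_event \<Omega> t (x t) \<inter> tuple_event \<Omega> w x"
    by (auto simp: tuple_event_def state_event_def)
  then show ?case using insert by (auto intro!: event_algebra.Int state_event_in_event_algebra)
qed

lemma path_space_pick:
  assumes "path_space \<Omega>" "finite w" "w \<subseteq> {0..}"
  shows "\<exists>\<omega>\<in>\<Omega>. \<forall>t\<in>w. \<omega> t = x t"
proof -
  \<comment> \<open>\<open>path_space\<close> promises paths only for non-empty time sets; adding
    \<open>0\<close> covers the empty one.\<close>
  have w: "insert 0 w \<in> time_sets" using assms by (auto simp: time_sets_def)
  have "restrict x (insert 0 w) \<in> tuples (insert 0 w)" by (auto simp: tuples_def)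
  moreover have "\<exists>\<omega>\<in>\<Omega>. restrict \<omega> (insert 0 w) = xu" if "xu \<in> tuples (insert 0 w)" for xu
    using assms(1) w that unfolding path_space_def by auto
  ultimately obtain \<omega> where \<omega>: "\<omega> \<in> \<Omega>" "restrict \<omega> (insert 0 w) = restrict x (insert 0 w)"
    by metis
  have "\<omega> t = x t" if "t \<in> w" for t using fun_cong[OF \<omega>(2), of t] that by simp
  then show ?thesis using \<omega>(1) by blast
qed

lemma tuple_event_nonempty:
  "path_space \<Omega> \<Longrightarrow> u \<in> time_sets \<Longrightarrow> tuple_event \<Omega> u xu \<noteq> {}"
  using path_space_pick[of \<Omega> u xu] by (auto simp: time_sets_def tuple_event_def)

lemma tuple_event_insert:
  "s \<notin> u \<Longrightarrow> tuple_event \<Omega> (insert s u) (xu(s := y)) = state_event \<Omega> s y \<inter> tuple_event \<Omega> u xu"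
  by (auto simp: tuple_event_def state_event_def)

lemma tuples_insert: "xu \<in> tuples u \<Longrightarrow> xu(s := y) \<in> tuples (insert s u)"
  by (auto simp: tuples_def PiE_def extensional_def)

lemma time_sets_insert: "u \<in> time_sets \<Longrightarrow> 0 \<le> s \<Longrightarrow> insert s u \<in> time_sets"
  by (auto simp: time_sets_def)

lemma process_domainI:
  "u \<in> time_sets \<Longrightarrow> xu \<in> tuples u \<Longrightarrow> A \<in> event_algebra \<Omega> u \<Longrightarrow> (A, tuple_event \<Omega> u xu) \<in> process_domain \<Omega>"
  unfolding process_domain_def by blast

text \<open>\<open>\<Omega>\<close> may be infinite, while \<open>Max\<close> is meaningful only on
  finite sets; each summand takes at most three values.\<close>

lemma finite_gain_image:
  fixes c p :: "'i \<Rightarrow> real"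
  assumes "finite I"
  shows "finite ((\<lambda>\<omega>. \<Sum>i\<in>I. c i * indicator (C i) \<omega> * (p i - indicator (A i) \<omega>)) ` S)"
  using assms
proof (induction I)
  case (insert i I)
  let ?f = "\<lambda>\<omega>. \<Sum>i\<in>I. c i * indicator (C i) \<omega> * (p i - indicator (A i) \<omega>)"
  have "(\<lambda>\<omega>. \<Sum>i\<in>insert i I. c i * indicator (C i) \<omega> * (p i - indicator (A i) \<omega>)) ` S
      \<subseteq> (\<lambda>(a, b). a + b) ` ({0, c i * p i, c i * (p i - 1)} \<times> ?f ` S)"
  proof (rule image_subsetI)
    fix \<omega> assume "\<omega> \<in> S"
    have "c i * indicator (C i) \<omega> * (p i - indicator (A i) \<omega>) \<in> {0, c i * p i, c i * (p i - 1)}"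
      by (auto simp: indicator_def)
    then show "(\<Sum>i\<in>insert i I. c i * indicator (C i) \<omega> * (p i - indicator (A i) \<omega>))
        \<in> (\<lambda>(a, b). a + b) ` ({0, c i * p i, c i * (p i - 1)} \<times> ?f ` S)"
      using insert(1,2) \<open>\<omega> \<in> S\<close>
      by (intro image_eqI[of _ _ "(c i * indicator (C i) \<omega> * (p i - indicator (A i) \<omega>), ?f \<omega>)"]) auto
  qed
  then show ?case by (rule finite_subset) (use insert in auto)
qed (simp add: image_constant_conv)

section \<open>Rules of probability as consequences of coherence\<close>

locale coherent_process =
  fixes \<Omega> :: "(real \<Rightarrow> 'x::finite) set" and P
  assumes path_space: "path_space \<Omega>" and process: "stochastic_process \<Omega> P"
begin

text \<open>Three bets are enough for every rule below; shorter arguments repeat a bet with stake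
  \<open>0\<close>.\<close>

lemma coherent_three:
  assumes dom: "(A1, C1) \<in> process_domain \<Omega>" "(A2, C2) \<in> process_domain \<Omega>" "(A3, C3) \<in> process_domain \<Omega>"
    and gain: "\<And>\<omega>. \<omega> \<in> C1 \<union> C2 \<union> C3 \<Longrightarrow>
      c1 * indicator C1 \<omega> * (P (A1, C1) - indicator A1 \<omega>) +
      c2 * indicator C2 \<omega> * (P (A2, C2) - indicator A2 \<omega>) +
      c3 * indicator C3 \<omega> * (P (A3, C3) - indicator A3 \<omega>) \<le> \<kappa>"
  shows "0 \<le> \<kappa>"
proof -
  define A :: "nat \<Rightarrow> _" where "A i = (if i = 1 then A1 else if i = 2 then A2 else A3)" for i
  define C :: "nat \<Rightarrow> _" where "C i = (if i = 1 then C1 else if i = 2 then C2 else C3)" for i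
  define c :: "nat \<Rightarrow> _" where "c i = (if i = 1 then c1 else if i = 2 then c2 else c3)" for i
  let ?g = "\<lambda>\<omega>. \<Sum>i=1..3. c i * indicator (C i) \<omega> * (P (A i, C i) - indicator (A i) \<omega>)"
  have iv: "{1..3} = {1, 2, 3 :: nat}" by auto
  have U: "(\<Union>i\<in>{1..3}. C i) = C1 \<union> C2 \<union> C3" unfolding iv by (simp add: C_def Un_ac)
  have g: "?g \<omega> = c1 * indicator C1 \<omega> * (P (A1, C1) - indicator A1 \<omega>) +
      c2 * indicator C2 \<omega> * (P (A2, C2) - indicator A2 \<omega>) +
      c3 * indicator C3 \<omega> * (P (A3, C3) - indicator A3 \<omega>)" for \<omega>
    unfolding iv by (simp add: A_def C_def c_def)
  have "\<forall>i\<in>{1..3}. (A i, C i) \<in> process_domain \<Omega>" using dom unfolding iv by (simp add: A_def C_def)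
  then have "0 \<le> Max (?g ` (\<Union>i\<in>{1..3}. C i))"
    using process unfolding stochastic_process_def coherent_def by simp
  moreover have "C1 \<noteq> {}" using dom(1) tuple_event_nonempty[OF path_space] by (auto simp: process_domain_def)
  then have "Max (?g ` (\<Union>i\<in>{1..3}. C i)) \<le> \<kappa>"
  proof (subst Max_le_iff)
    show "finite (?g ` (\<Union>i\<in>{1..3}. C i))" by (rule finite_gain_image) simp
    show "?g ` (\<Union>i\<in>{1..3}. C i) \<noteq> {}" using \<open>C1 \<noteq> {}\<close> unfolding U by blast
    show "\<forall>a\<in>?g ` (\<Union>i\<in>{1..3}. C i). a \<le> \<kappa>" unfolding U ball_simps g using gain by blast
  qed
  ultimately show ?thesis by simp
qed

text \<open>Reversing all stakes turns a constant gain into its negative, so a riskless gain must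
  vanish.\<close>

lemma coherent_three_eq:
  assumes dom: "(A1, C1) \<in> process_domain \<Omega>" "(A2, C2) \<in> process_domain \<Omega>" "(A3, C3) \<in> process_domain \<Omega>"
    and gain: "\<And>\<omega>. \<omega> \<in> C1 \<union> C2 \<union> C3 \<Longrightarrow>
      c1 * indicator C1 \<omega> * (P (A1, C1) - indicator A1 \<omega>) +
      c2 * indicator C2 \<omega> * (P (A2, C2) - indicator A2 \<omega>) +
      c3 * indicator C3 \<omega> * (P (A3, C3) - indicator A3 \<omega>) = \<kappa>"
  shows "\<kappa> = 0"
proof -
  have "0 \<le> \<kappa>"
    by (rule coherent_three[OF dom]) (rule eq_refl[OF gain])
  moreover have "0 \<le> - \<kappa>"
  proof (rule coherent_three[OF dom])
    fix \<omega> assume "\<omega> \<in> C1 \<union> C2 \<union> C3"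
    from gain[OF this] show "(- c1) * indicator C1 \<omega> * (P (A1, C1) - indicator A1 \<omega>) +
      (- c2) * indicator C2 \<omega> * (P (A2, C2) - indicator A2 \<omega>) +
      (- c3) * indicator C3 \<omega> * (P (A3, C3) - indicator A3 \<omega>) \<le> - \<kappa>" by simp
  qed
  ultimately show ?thesis by simp
qed

context
  fixes u :: "real set" and xu :: "real \<Rightarrow> 'x"
  assumes u: "u \<in> time_sets" and xu: "xu \<in> tuples u"
begin

abbreviation "C \<equiv> tuple_event \<Omega> u xu"

text \<open>The bet with stake \<open>1\<close> gains at most its price
  \<open>P (A, C)\<close>.\<close>

lemma prob_nonneg:
  assumes "A \<in> event_algebra \<Omega> u"
  shows "0 \<le> P (A, C)"
proof (rule coherent_three)
  show "(A, C) \<in> process_domain \<Omega>" "(A, C) \<in> process_domain \<Omega>" "(A, C) \<in> process_domain \<Omega>"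
    using assms by (auto intro!: process_domainI u xu)
  show "1 * indicator C \<omega> * (P (A, C) - indicator A \<omega>) + 0 * indicator C \<omega> * (P (A, C) - indicator A \<omega>)
      + 0 * indicator C \<omega> * (P (A, C) - indicator A \<omega>) \<le> P (A, C)" if "\<omega> \<in> C \<union> C \<union> C" for \<omega>
    using that by simp
qed

lemma prob_one:
  assumes "A \<in> event_algebra \<Omega> u" "C \<subseteq> A"
  shows "P (A, C) = 1"
proof -
  have dom: "(A, C) \<in> process_domain \<Omega>" using assms by (auto intro!: process_domainI u xu)
  have "P (A, C) - 1 = 0"
  proof (rule coherent_three_eq[OF dom dom dom])
    show "1 * indicator C \<omega> * (P (A, C) - indicator A \<omega>) + 0 * indicator C \<omega> * (P (A, C) - indicator A \<omega>)
        + 0 * indicator C \<omega> * (P (A, C) - indicator A \<omega>) = P (A, C) - 1" if "\<omega> \<in> C \<union> C \<union> C" for \<omega>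
    proof -
      have "\<omega> \<in> A" "\<omega> \<in> C" using that assms(2) by auto
      then show ?thesis by simp
    qed
  qed
  then show ?thesis by simp
qed

lemma prob_zero:
  assumes "A \<in> event_algebra \<Omega> u" "C \<inter> A = {}"
  shows "P (A, C) = 0"
proof -
  have dom: "(A, C) \<in> process_domain \<Omega>" using assms by (auto intro!: process_domainI u xu)
  have "P (A, C) = 0"
  proof (rule coherent_three_eq[OF dom dom dom])
    show "1 * indicator C \<omega> * (P (A, C) - indicator A \<omega>) + 0 * indicator C \<omega> * (P (A, C) - indicator A \<omega>)
        + 0 * indicator C \<omega> * (P (A, C) - indicator A \<omega>) = P (A, C)" if "\<omega> \<in> C \<union> C \<union> C" for \<omega>
    proof -
      have "\<omega> \<notin> A" "\<omega> \<in> C" using that assms(2) by auto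
      then show ?thesis by simp
    qed
  qed
  then show ?thesis by simp
qed

text \<open>The stakes \<open>1\<close>, \<open>1\<close> and \<open>- 1\<close> cancel the
  indicators of a disjoint union.\<close>

lemma prob_Un:
  assumes "A \<in> event_algebra \<Omega> u" "B \<in> event_algebra \<Omega> u" "A \<inter> B = {}"
  shows "P (A \<union> B, C) = P (A, C) + P (B, C)"
proof -
  have "P (A, C) + P (B, C) - P (A \<union> B, C) = 0"
  proof (rule coherent_three_eq)
    show "(A, C) \<in> process_domain \<Omega>" "(B, C) \<in> process_domain \<Omega>" "(A \<union> B, C) \<in> process_domain \<Omega>"
      using assms by (auto intro!: process_domainI u xu event_algebra.Un)
    fix \<omega> assume "\<omega> \<in> C \<union> C \<union> C"
    then show "1 * indicator C \<omega> * (P (A, C) - indicator A \<omega>) + 1 * indicator C \<omega> * (P (B, C) - indicator B \<omega>)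
        + (- 1) * indicator C \<omega> * (P (A \<union> B, C) - indicator (A \<union> B) \<omega>) = P (A, C) + P (B, C) - P (A \<union> B, C)"
      using assms(3) by (cases "\<omega> \<in> A"; cases "\<omega> \<in> B"; auto)
  qed
  then show ?thesis by simp
qed

lemma prob_UN:
  assumes "finite Y" "\<And>y. y \<in> Y \<Longrightarrow> A y \<in> event_algebra \<Omega> u" "disjoint_family_on A Y"
  shows "P (\<Union>y\<in>Y. A y, C) = (\<Sum>y\<in>Y. P (A y, C))"
  using assms
proof (induction Y)
  case empty then show ?case using prob_zero[of "{}"] by simp
next
  case (insert y Y)
  have "A y \<inter> (\<Union>y\<in>Y. A y) = {}" using insert(2,5) by (auto simp: disjoint_family_on_def)
  moreover have "disjoint_family_on A Y" using insert(5) by (auto simp: disjoint_family_on_def)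
  ultimately show ?case using insert prob_Un[of "A y" "\<Union>y\<in>Y. A y"] by auto
qed

lemma prob_sum_states:
  assumes "A \<in> event_algebra \<Omega> u" "0 \<le> s" "s \<in> u \<or> (\<forall>r\<in>u. r < s)"
  shows "P (A, C) = (\<Sum>y\<in>UNIV. P (A \<inter> state_event \<Omega> s y, C))"
proof -
  have "A \<subseteq> \<Omega>" using assms(1) event_algebra.sets_into_space by blast
  then have "A = (\<Union>y\<in>UNIV. A \<inter> state_event \<Omega> s y)" by (auto simp: state_event_def)
  moreover have "P (\<Union>y\<in>UNIV. A \<inter> state_event \<Omega> s y, C) = (\<Sum>y\<in>UNIV. P (A \<inter> state_event \<Omega> s y, C))"
  proof (rule prob_UN)
    show "A \<inter> state_event \<Omega> s y \<in> event_algebra \<Omega> u" for y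
      using event_algebra.Int[OF assms(1) state_event_in_event_algebra[OF assms(2,3)]] .
    show "disjoint_family_on (\<lambda>y. A \<inter> state_event \<Omega> s y) UNIV"
      by (auto simp: disjoint_family_on_def state_event_def)
  qed simp
  ultimately show ?thesis by metis
qed

lemma prob_sum_one:
  assumes "0 \<le> s" "s \<in> u \<or> (\<forall>r\<in>u. r < s)"
  shows "(\<Sum>y\<in>UNIV. P (state_event \<Omega> s y, C)) = 1"
proof -
  have "\<Omega> \<inter> state_event \<Omega> s y = state_event \<Omega> s y" for y by (auto simp: state_event_def)
  moreover have "P (\<Omega>, C) = 1" by (rule prob_one) (auto simp: event_algebra.top tuple_event_def)
  ultimately show ?thesis using prob_sum_states[OF event_algebra.top assms] by simp
qed

text \<open>On \<open>C\<close> the indicators cancel for the stakes \<open>1\<close>,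
  \<open>- P (A, ?D)\<close> and \<open>- 1\<close>, the last bet being called off outside
  \<open>?D\<close>. No division occurs, so states of conditional probability zero are
  included.\<close>

lemma prob_product:
  assumes "A \<in> event_algebra \<Omega> u" "A \<in> event_algebra \<Omega> (insert s u)" "0 \<le> s" "\<forall>r\<in>u. r < s"
  shows "P (A \<inter> state_event \<Omega> s y, C) =
    P (A, tuple_event \<Omega> (insert s u) (xu(s := y))) * P (state_event \<Omega> s y, C)"
proof -
  let ?D = "tuple_event \<Omega> (insert s u) (xu(s := y))" and ?S = "state_event \<Omega> s y"
  have S: "?S \<in> event_algebra \<Omega> u" using assms by (intro state_event_in_event_algebra) auto
  have "s \<notin> u" using assms by auto
  then have D: "?D = ?S \<inter> C" by (rule tuple_event_insert)
  have "P (A \<inter> ?S, C) - P (A, ?D) * P (?S, C) = 0"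
  proof (rule coherent_three_eq)
    show "(A \<inter> ?S, C) \<in> process_domain \<Omega>" "(?S, C) \<in> process_domain \<Omega>"
      using S assms(1) by (auto intro!: process_domainI u xu event_algebra.Int)
    show "(A, ?D) \<in> process_domain \<Omega>"
      using assms by (intro process_domainI time_sets_insert u tuples_insert xu)
    fix \<omega> assume "\<omega> \<in> C \<union> C \<union> ?D"
    then have "\<omega> \<in> C" using D by auto
    then show "1 * indicator C \<omega> * (P (A \<inter> ?S, C) - indicator (A \<inter> ?S) \<omega>) +
        (- P (A, ?D)) * indicator C \<omega> * (P (?S, C) - indicator ?S \<omega>) +
        (- 1) * indicator ?D \<omega> * (P (A, ?D) - indicator A \<omega>) = P (A \<inter> ?S, C) - P (A, ?D) * P (?S, C)"
      unfolding D by (cases "\<omega> \<in> ?S"; cases "\<omega> \<in> A"; simp add: algebra_simps)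
  qed
  then show ?thesis by simp
qed

lemma prob_total:
  assumes "A \<in> event_algebra \<Omega> u" "A \<in> event_algebra \<Omega> (insert s u)" "0 \<le> s" "\<forall>r\<in>u. r < s"
  shows "P (A, C) = (\<Sum>y\<in>UNIV. P (state_event \<Omega> s y, C) * P (A, tuple_event \<Omega> (insert s u) (xu(s := y))))"
  using prob_sum_states[OF assms(1,3)] prob_product[OF assms] assms(4) by (simp add: mult.commute)

end

lemma trans_matrix_stochastic:
  assumes "0 \<le> t" "u \<in> time_sets_before t" "xu \<in> tuples u" "t \<le> s"
  shows "0 \<le> trans_matrix \<Omega> P u xu t s $ x $ y" "(\<Sum>y\<in>UNIV. trans_matrix \<Omega> P u xu t s $ x $ y) = 1"
proof -
  have u: "insert t u \<in> time_sets" "xu(t := x) \<in> tuples (insert t u)"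
    using assms by (auto simp: time_sets_before_def intro: time_sets_insert tuples_insert)
  have s: "s \<in> insert t u \<or> (\<forall>r\<in>insert t u. r < s)" "0 \<le> s"
    using assms by (auto simp: time_sets_before_def)
  show "0 \<le> trans_matrix \<Omega> P u xu t s $ x $ y"
    using prob_nonneg[OF u state_event_in_event_algebra[OF s(2,1)]] by (simp add: trans_matrix_def)
  show "(\<Sum>y\<in>UNIV. trans_matrix \<Omega> P u xu t s $ x $ y) = 1"
    using prob_sum_one[OF u s(2,1)] by (simp add: trans_matrix_def)
qed

end

section \<open>The lower bound\<close>

lemma norm_le_sum_entries:
  fixes A :: "real ^ 'x::finite ^ 'y::finite"
  assumes "\<And>x y. \<bar>A $ x $ y\<bar> \<le> b"
  shows "norm A \<le> real CARD('y) * (real CARD('x) * b)"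
proof -
  have row: "norm (A $ x) \<le> real CARD('x) * b" for x
    using order_trans[OF norm_le_l1_cart[of "A $ x"] sum_mono[of UNIV "\<lambda>y. \<bar>A $ x $ y\<bar>" "\<lambda>_. b"]] assms by simp
  have "norm A \<le> (\<Sum>x\<in>UNIV. norm (A $ x))" unfolding norm_vec_def by (rule L2_set_le_sum) simp
  also have "\<dots> \<le> (\<Sum>x\<in>(UNIV :: 'y set). real CARD('x) * b)" by (intro sum_mono row)
  finally show ?thesis by simp
qed

text \<open>
  By compactness, difference quotients whose limit points all lie in \<open>\<Q>\<close> are eventually close to it.
\<close>

lemma eventually_near_rate_set:
  fixes A :: "real \<Rightarrow> real ^ 'x::finite ^ 'x"
  assumes lim: "Limsup (at_right 0) (\<lambda>\<Delta>. ereal (1 / \<Delta> * op_norm ((*v) (A \<Delta>)))) < \<infinity>"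
    and rate: "eventually (\<lambda>\<Delta>. A \<Delta> \<in> rate_matrices) (at_right 0)"
    and der: "\<And>\<Delta> Q. filterlim \<Delta> (at_right 0) sequentially \<Longrightarrow> Q \<in> rate_matrices \<Longrightarrow>
      (\<lambda>i. (1 / \<Delta> i) *\<^sub>R A (\<Delta> i)) \<longlonglongrightarrow> Q \<Longrightarrow> Q \<in> \<Q>"
    and "0 < e"
  shows "eventually (\<lambda>\<Delta>. \<exists>Q\<in>\<Q>. \<forall>x y. \<bar>A \<Delta> $ x $ y - \<Delta> * Q $ x $ y\<bar> \<le> \<Delta> * e) (at_right 0)"
    (is "eventually ?near _")
proof (rule ccontr)
  assume not: "\<not> eventually ?near (at_right 0)"
  obtain b :: real where b: "Limsup (at_right 0) (\<lambda>\<Delta>. ereal (1 / \<Delta> * op_norm ((*v) (A \<Delta>)))) < ereal b"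
    using ereal_dense2[OF lim] by blast
  have "eventually (\<lambda>\<Delta>. ereal (1 / \<Delta> * op_norm ((*v) (A \<Delta>))) < ereal b) (at_right 0)"
    by (rule Limsup_lessD[OF b])
  with rate have "eventually (\<lambda>\<Delta>. A \<Delta> \<in> rate_matrices \<and> 1 / \<Delta> * op_norm ((*v) (A \<Delta>)) < b) (at_right 0)"
    by eventually_elim simp
  then obtain c where c: "0 < c" "\<And>\<Delta>. 0 < \<Delta> \<Longrightarrow> \<Delta> < c \<Longrightarrow>
      A \<Delta> \<in> rate_matrices \<and> 1 / \<Delta> * op_norm ((*v) (A \<Delta>)) < b"
    unfolding eventually_at_right_field by auto
  have bad: "\<exists>\<Delta>. 0 < \<Delta> \<and> \<Delta> < d \<and> \<not> ?near \<Delta>" if "0 < d" for d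
    using not that unfolding eventually_at_right_field by blast
  \<comment> \<open>A sequence of bad step lengths that tends to zero; staying below
    \<open>c\<close> keeps the scaled matrices bounded and in \<open>rate_matrices\<close>.\<close>
  have "\<forall>n. \<exists>\<Delta>. 0 < \<Delta> \<and> \<Delta> < min c (1 / (real n + 1)) \<and> \<not> ?near \<Delta>"
  proof
    fix n :: nat
    have "0 < min c (1 / (real n + 1))" using c(1) by simp
    then show "\<exists>\<Delta>. 0 < \<Delta> \<and> \<Delta> < min c (1 / (real n + 1)) \<and> \<not> ?near \<Delta>"
      by (rule bad)
  qed
  then obtain \<Delta> where \<Delta>: "\<And>n :: nat. 0 < \<Delta> n" "\<And>n. \<Delta> n < c" "\<And>n. \<Delta> n < 1 / (real n + 1)"
    "\<And>n. \<not> ?near (\<Delta> n)"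
    unfolding min_less_iff_conj by metis
  define B where "B n = (1 / \<Delta> n) *\<^sub>R A (\<Delta> n)" for n
  have Bb: "\<bar>B n $ x $ y\<bar> \<le> b" for n x y
  proof -
    have "\<bar>B n $ x $ y\<bar> = 1 / \<Delta> n * \<bar>A (\<Delta> n) $ x $ y\<bar>" using \<Delta>(1)[of n] by (simp add: B_def abs_mult)
    also have "\<dots> \<le> 1 / \<Delta> n * op_norm ((*v) (A (\<Delta> n)))"
      using \<Delta>(1)[of n] by (intro mult_left_mono matrix_entry_le_op_norm) simp
    also have "\<dots> \<le> b" using c(2)[OF \<Delta>(1,2)] less_imp_le by blast
    finally show ?thesis .
  qed
  then have "bounded (range B)"
    by (intro boundedI[of _ "real CARD('x) * (real CARD('x) * b)"]) (auto intro: norm_le_sum_entries)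
  then obtain Q r where r: "strict_mono r" and Q: "(B \<circ> r) \<longlonglongrightarrow> Q"
    using bounded_imp_convergent_subsequence by blast
  have \<Delta>0: "\<Delta> \<longlonglongrightarrow> 0"
  proof (rule tendsto_sandwich[OF _ _ tendsto_const])
    show "(\<lambda>n. 1 / (real n + 1)) \<longlonglongrightarrow> 0" by real_asymp
  qed (use \<Delta>(1,3) in \<open>auto intro!: always_eventually less_imp_le\<close>)
  have "filterlim (\<Delta> \<circ> r) (at_right 0) sequentially"
    unfolding filterlim_at using LIMSEQ_subseq_LIMSEQ[OF \<Delta>0 r] \<Delta>(1) by (auto simp: less_imp_neq[symmetric])
  moreover have ent: "(\<lambda>i. B (r i) $ x $ y) \<longlonglongrightarrow> Q $ x $ y" for x y
    using tendsto_vec_nth[OF tendsto_vec_nth[OF Q]] by (simp add: o_def)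
  have Brate: "(\<Sum>y\<in>UNIV. B n $ x $ y) = 0" "x \<noteq> y \<Longrightarrow> 0 \<le> B n $ x $ y" for n x y
    using c(2)[OF \<Delta>(1,2), of n] \<Delta>(1)[of n]
    by (auto simp: rate_matrices_def B_def sum_divide_distrib[symmetric])
  \<comment> \<open>The rate matrices form a closed set, so the limit of the subsequence is one of
    them and \<open>der\<close> applies.\<close>
  have "Q \<in> rate_matrices"
    unfolding rate_matrices_def
  proof (intro CollectI conjI allI impI)
    fix x
    have "(\<lambda>i. \<Sum>y\<in>UNIV. B (r i) $ x $ y) \<longlonglongrightarrow> (\<Sum>y\<in>UNIV. Q $ x $ y)" by (intro tendsto_sum ent)
    then show "(\<Sum>y\<in>UNIV. Q $ x $ y) = 0" using Brate(1) by (simp add: LIMSEQ_const_iff)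
    fix y assume "x \<noteq> y"
    then show "0 \<le> Q $ x $ y" using Brate(2) by (intro LIMSEQ_le_const[OF ent]) auto
  qed
  moreover have "(\<lambda>i. (1 / (\<Delta> \<circ> r) i) *\<^sub>R A ((\<Delta> \<circ> r) i)) \<longlonglongrightarrow> Q"
    using Q by (simp add: B_def o_def)
  ultimately have "Q \<in> \<Q>" by (rule der)
  \<comment> \<open>Entrywise convergence brings \<open>B (r i)\<close> within \<open>e\<close> of
    \<open>Q\<close>, against the choice of \<open>\<Delta>\<close>.\<close>
  have "eventually (\<lambda>i. \<forall>x\<in>UNIV. \<forall>y\<in>UNIV. \<bar>B (r i) $ x $ y - Q $ x $ y\<bar> < e) sequentially"
    using tendstoD[OF ent \<open>0 < e\<close>] by (intro eventually_ball_finite ballI) (auto simp: dist_real_def)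
  from eventually_happens'[OF sequentially_bot this]
  obtain i where i: "\<And>x y. \<bar>B (r i) $ x $ y - Q $ x $ y\<bar> < e" by auto
  have "\<bar>A (\<Delta> (r i)) $ x $ y - \<Delta> (r i) * Q $ x $ y\<bar> \<le> \<Delta> (r i) * e" for x y
  proof -
    have "A (\<Delta> (r i)) $ x $ y - \<Delta> (r i) * Q $ x $ y = \<Delta> (r i) * (B (r i) $ x $ y - Q $ x $ y)"
      using less_imp_neq[OF \<Delta>(1)[of "r i"]] by (simp add: B_def right_diff_distrib)
    then show ?thesis using i[of x y] \<Delta>(1)[of "r i"] by (simp add: abs_mult)
  qed
  then show False using \<Delta>(4)[of "r i"] \<open>Q \<in> \<Q>\<close> by blast
qed

section \<open>The lower bound for a single future time\<close>

lemma (in lower_rate) lower_trans_refl: "lower_trans q t t g = g"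
proof -
  have "infnorm (lower_trans q t t g - E [t] g) \<le> M\<^sup>2 * mesh [t] * (t - t) * infnorm g"
    by (rule lower_trans_euler) (simp_all add: partitions_def)
  then show ?thesis
    using infnorm_eq_0[of "lower_trans q t t g - g"] infnorm_pos_le[of "lower_trans q t t g - g"] by simp
qed

text \<open>The tolerance is relative to \<open>d\<close>, so that the errors of many short steps
  add up to at most a multiple of \<open>e\<close>.\<close>

definition (in rate_set) near_rates :: "real \<Rightarrow> real \<Rightarrow> real ^ 'x ^ 'x \<Rightarrow> bool" where
  "near_rates e d T \<longleftrightarrow> (\<exists>Q\<in>\<Q>. \<forall>x y. \<bar>(T - mat 1) $ x $ y - d * Q $ x $ y\<bar> \<le> d * e)"

text \<open>Split \<open>T\<close> into \<open>I + d Q\<close> and a remainder with entries at most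
  \<open>d * e\<close>; replacing \<open>Q\<close> by the lower envelope only lowers the
  value.\<close>

lemma (in rate_set) near_rate_step_ge:
  fixes T :: "real ^ 'x ^ 'x"
  assumes "Q \<in> \<Q>" "\<And>y. \<bar>(T - mat 1) $ x $ y - d * Q $ x $ y\<bar> \<le> d * e" "0 \<le> d"
  shows "g $ x + d * qlow g $ x - d * (real CARD('x) * e * infnorm g) \<le> (T *v g) $ x"
proof -
  have eq: "T = mat 1 + d *\<^sub>R Q + (T - mat 1 - d *\<^sub>R Q)" by simp
  have "(T *v g) $ x = g $ x + d * (Q *v g) $ x + ((T - mat 1 - d *\<^sub>R Q) *v g) $ x"
    by (subst eq) (simp only: matrix_vector_mult_add_rdistrib matrix_vector_mul_lid scaleR_matrix_vector_assoc[symmetric]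
        vector_add_component vector_scaleR_component real_scaleR_def)
  moreover have "\<bar>((T - mat 1 - d *\<^sub>R Q) *v g) $ x\<bar> \<le> real CARD('x) * (d * e) * infnorm g"
    using assms(2) by (intro matrix_vector_component_le) simp
  moreover have "d * qlow g $ x \<le> d * (Q *v g) $ x"
    using assms(1,3) by (intro mult_left_mono qlow_le)
  ultimately show ?thesis by (simp add: algebra_simps abs_le_iff)
qed

locale consistent_process = rate_set \<Q> m M + coherent_process \<Omega> P
  for \<Q> :: "(real ^ 'x::finite ^ 'x) set" and m M :: real
    and \<Omega> :: "(real \<Rightarrow> 'x) set" and P +
  assumes wb: "well_behaved \<Omega> P" and consistent: "consistent_rates \<Omega> P \<Q>"
begin

lemma trans_matrix_rate:
  assumes "0 \<le> t" "u \<in> time_sets_before t" "xu \<in> tuples u" "t \<le> s"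
  shows "trans_matrix \<Omega> P u xu t s - mat 1 \<in> rate_matrices"
  using trans_matrix_stochastic[OF assms] unfolding rate_matrices_def
  by (auto simp: sum_subtractf mat_def)

lemma right_near:
  assumes "0 \<le> t" "u \<in> time_sets_before t" "xu \<in> tuples u" "0 < e"
  shows "eventually (\<lambda>\<Delta>. near_rates e \<Delta> (trans_matrix \<Omega> P u xu t (t + \<Delta>))) (at_right 0)"
  unfolding near_rates_def
proof (rule eventually_near_rate_set[OF _ _ _ assms(4)])
  show "Limsup (at_right 0) (\<lambda>\<Delta>. ereal (1 / \<Delta> * op_norm ((*v) (trans_matrix \<Omega> P u xu t (t + \<Delta>) - mat 1)))) < \<infinity>"
    using wb assms unfolding well_behaved_def by blast
  show "\<forall>\<^sub>F \<Delta> in at_right 0. trans_matrix \<Omega> P u xu t (t + \<Delta>) - mat 1 \<in> rate_matrices"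
    using eventually_at_right_less[of "0 :: real"]
    by eventually_elim (intro trans_matrix_rate assms, simp)
  fix \<Delta> Q assume "filterlim \<Delta> (at_right 0) sequentially" "Q \<in> rate_matrices"
    "(\<lambda>i. (1 / \<Delta> i) *\<^sub>R (trans_matrix \<Omega> P u xu t (t + \<Delta> i) - mat 1)) \<longlonglongrightarrow> Q"
  then have "Q \<in> outer_derivative \<Omega> P u xu t"
    unfolding outer_derivative_def by (intro CollectI conjI exI[of _ \<Delta>] disjI1)
  then show "Q \<in> \<Q>" using consistent assms unfolding consistent_rates_def by blast
qed

lemma left_near:
  assumes "0 < t" "u \<in> time_sets_before t" "xu \<in> tuples u" "0 < e"
  shows "eventually (\<lambda>\<Delta>. near_rates e \<Delta> (trans_matrix \<Omega> P u xu (t - \<Delta>) t)) (at_right 0)"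
  unfolding near_rates_def
proof (rule eventually_near_rate_set[OF _ _ _ assms(4)])
  show "Limsup (at_right 0) (\<lambda>\<Delta>. ereal (1 / \<Delta> * op_norm ((*v) (trans_matrix \<Omega> P u xu (t - \<Delta>) t - mat 1)))) < \<infinity>"
    using wb assms unfolding well_behaved_def by (meson less_imp_le)
  have fin: "finite u" "\<forall>r\<in>u. r < t" using assms by (auto simp: time_sets_before_def time_sets_def)
  \<comment> \<open>The last time of the history, or \<open>0\<close>; only for
    \<open>\<Delta> < t - c\<close> does \<open>t - \<Delta>\<close> come after it.\<close>
  define c where "c = Max (insert 0 u)"
  have c: "0 \<le> c" "c < t" "\<And>r. r \<in> u \<Longrightarrow> r \<le> c" using fin assms(1) by (auto simp: c_def)
  have "\<forall>\<^sub>F \<Delta> in at_right 0. \<Delta> < t - c"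
    using c(2) unfolding eventually_at_right_field by (intro exI[of _ "t - c"]) auto
  then show "\<forall>\<^sub>F \<Delta> in at_right 0. trans_matrix \<Omega> P u xu (t - \<Delta>) t - mat 1 \<in> rate_matrices"
    using eventually_at_right_less[of "0 :: real"]
  proof eventually_elim
    case (elim \<Delta>)
    have "u \<in> time_sets_before (t - \<Delta>)"
      using assms(2) c(3) elim unfolding time_sets_before_def by fastforce
    then show ?case using elim c(1) assms by (intro trans_matrix_rate) auto
  qed
  fix \<Delta> Q assume "filterlim \<Delta> (at_right 0) sequentially" "Q \<in> rate_matrices"
    "(\<lambda>i. (1 / \<Delta> i) *\<^sub>R (trans_matrix \<Omega> P u xu (t - \<Delta> i) t - mat 1)) \<longlonglongrightarrow> Q"
  then have "Q \<in> outer_derivative \<Omega> P u xu t"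
    using assms(1) unfolding outer_derivative_def by (intro CollectI conjI exI[of _ \<Delta>] disjI2)
  then show "Q \<in> \<Q>" using consistent assms unfolding consistent_rates_def by (meson less_imp_le subsetD)
qed

context
  fixes t s :: real and u :: "real set" and xu :: "real \<Rightarrow> 'x" and x :: 'x and g :: "real ^ 'x"
  assumes t: "0 \<le> t" "t \<le> s" and u: "u \<in> time_sets_before t" and xu: "xu \<in> tuples u"
begin

abbreviation "p r y \<equiv> P (state_event \<Omega> r y, tuple_event \<Omega> (insert t u) (xu(t := x)))"

text \<open>
  The conditional expectation of \<open>(L\<^sub>r\<^sup>s g) (X\<^sub>r)\<close>, which interpolates between
  \<open>L\<^sub>t\<^sup>s g (x)\<close> at \<open>r = t\<close> and the expectation of \<open>g (X\<^sub>s)\<close> at \<open>r = s\<close>.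
\<close>

definition interpolant where "interpolant r = (\<Sum>y\<in>UNIV. p r y * lower_trans qlow r s g $ y)"

lemma history_insert: "insert t u \<in> time_sets" "xu(t := x) \<in> tuples (insert t u)" "\<forall>r\<in>u. r < t"
  using t u xu by (auto simp: time_sets_before_def intro: time_sets_insert tuples_insert)

lemma p_at_t: "p t y = (if y = x then 1 else 0)"
proof -
  have "state_event \<Omega> t y \<in> event_algebra \<Omega> (insert t u)"
    using t by (intro state_event_in_event_algebra) auto
  note S = this
  show ?thesis
  proof (cases "y = x")
    case True
    then have "tuple_event \<Omega> (insert t u) (xu(t := x)) \<subseteq> state_event \<Omega> t y"
      by (auto simp: tuple_event_def state_event_def)
    then show ?thesis using prob_one[OF history_insert(1,2) S] True by simp
  next
    case False
    then have "tuple_event \<Omega> (insert t u) (xu(t := x)) \<inter> state_event \<Omega> t y = {}"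
      by (auto simp: tuple_event_def state_event_def)
    then show ?thesis using prob_zero[OF history_insert(1,2) S] False by simp
  qed
qed

lemma p_stochastic:
  assumes "t \<le> r" shows "0 \<le> p r y" "(\<Sum>y\<in>UNIV. p r y) = 1"
proof -
  have r: "0 \<le> r" "r \<in> insert t u \<or> (\<forall>r'\<in>insert t u. r' < r)" using assms t history_insert(3) by auto
  show "0 \<le> p r y" using prob_nonneg[OF history_insert(1,2) state_event_in_event_algebra[OF r]] .
  show "(\<Sum>y\<in>UNIV. p r y) = 1" using prob_sum_one[OF history_insert(1,2) r] .
qed

text \<open>By the semigroup property the vector at \<open>a\<close> is
  \<open>lower_trans qlow a b\<close> of the vector at \<open>b\<close>, hence
  \<open>I + (b - a) qlow\<close> of it up to an error of order \<open>(b - a)\<^sup>2\<close>. A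
  transition matrix near \<open>\<Q>\<close> yields at least that much, up to the tolerance.\<close>

lemma interpolant_step:
  assumes ab: "t \<le> a" "a < b" "b \<le> s" and T: "\<And>z. p b z = (\<Sum>y\<in>UNIV. p a y * T $ y $ z)"
    and near: "near_rates e (b - a) T"
    and small: "(b - a) * M \<le> 1" and e: "0 \<le> e"
  shows "interpolant a - (b - a) * (real CARD('x) * e * infnorm g + M\<^sup>2 * (b - a) * infnorm g) \<le> interpolant b"
proof -
  let ?fb = "lower_trans qlow b s g" and ?fa = "lower_trans qlow a s g" and ?d = "b - a"
  let ?K = "real CARD('x) * e * infnorm g + M\<^sup>2 * (b - a) * infnorm g"
  have nb: "infnorm ?fb \<le> infnorm g"
    by (rule lower_transition_operator_infnorm_le[OF lower_trans_euler(1)[OF ab(3)]])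
  obtain Q where Q: "Q \<in> \<Q>" "\<And>x y. \<bar>(T - mat 1) $ x $ y - ?d * Q $ x $ y\<bar> \<le> ?d * e"
    using near unfolding near_rates_def by blast
  have le: "?fa $ y - ?d * ?K \<le> (T *v ?fb) $ y" for y
  proof -
    have "?fa = lower_trans qlow a b ?fb" using ab by (simp add: lower_trans_semigroup)
    then have "infnorm (?fa - ?fb - ?d *\<^sub>R qlow ?fb) \<le> M\<^sup>2 * ?d\<^sup>2 * infnorm ?fb"
      using lower_trans_first_order[OF ab(2) small, of ?fb] by simp
    also have "\<dots> \<le> M\<^sup>2 * ?d\<^sup>2 * infnorm g" using nb by (intro mult_left_mono) auto
    finally have "\<bar>(?fa - ?fb - ?d *\<^sub>R qlow ?fb) $ y\<bar> \<le> M\<^sup>2 * ?d\<^sup>2 * infnorm g"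
      using component_le_infnorm_cart order_trans by blast
    then have 1: "?fa $ y \<le> ?fb $ y + ?d * qlow ?fb $ y + M\<^sup>2 * ?d\<^sup>2 * infnorm g"
      by (simp add: abs_le_iff)
    have "?d * (real CARD('x) * e * infnorm ?fb) \<le> ?d * (real CARD('x) * e * infnorm g)"
      using nb ab e by (intro mult_left_mono) auto
    with 1 near_rate_step_ge[OF Q(1), of T y ?d e ?fb, OF Q(2)] ab show ?thesis
      by (simp add: power2_eq_square algebra_simps)
  qed
  have "interpolant a - ?d * ?K = (\<Sum>y\<in>UNIV. p a y * (?fa $ y - ?d * ?K))"
    using p_stochastic(2)[OF ab(1)] by (simp add: interpolant_def right_diff_distrib sum_subtractf sum_distrib_right[symmetric])
  also have "\<dots> \<le> (\<Sum>y\<in>UNIV. p a y * (T *v ?fb) $ y)"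
    by (intro sum_mono mult_left_mono le p_stochastic(1) ab(1))
  also have "\<dots> = (\<Sum>y\<in>UNIV. \<Sum>z\<in>UNIV. p a y * T $ y $ z * ?fb $ z)"
    by (simp add: matrix_vector_mult_def sum_distrib_left mult.assoc)
  also have "\<dots> = (\<Sum>z\<in>UNIV. \<Sum>y\<in>UNIV. p a y * T $ y $ z * ?fb $ z)" by (rule sum.swap)
  also have "\<dots> = interpolant b" by (simp add: interpolant_def T sum_distrib_right)
  finally show ?thesis .
qed

text \<open>After \<open>t\<close> the state at \<open>t\<close> has become history, so the
  transition matrix is taken given the states at \<open>u\<close> and at \<open>t\<close>.\<close>

lemma p_trans:
  assumes "t < a" "a < b"
  shows "p b z = (\<Sum>y\<in>UNIV. p a y * trans_matrix \<Omega> P (insert t u) (xu(t := x)) a b $ y $ z)"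
  unfolding trans_matrix_def
  using assms t history_insert by (subst prob_total[OF history_insert(1,2), of _ a]) (auto intro!: state_event_in_event_algebra)

text \<open>At \<open>t\<close> itself only the row \<open>x\<close> counts, and the history is
  \<open>u\<close> alone.\<close>

lemma p_trans_t:
  "p b z = (\<Sum>y\<in>UNIV. p t y * trans_matrix \<Omega> P u xu t b $ y $ z)"
  unfolding p_at_t by (simp add: trans_matrix_def if_distrib[of "\<lambda>c. c * _"] cong: if_cong)

text \<open>The quantified \<open>T\<close> hides which of the two transition matrices above links
  \<open>a\<close> to \<open>b\<close>.\<close>

definition near_step :: "real \<Rightarrow> real \<Rightarrow> real \<Rightarrow> bool" where
  "near_step e a b \<longleftrightarrow> (\<exists>T. (\<forall>z. p b z = (\<Sum>y\<in>UNIV. p a y * T $ y $ z)) \<and> near_rates e (b - a) T)"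

lemma near_step_right:
  assumes r: "t \<le> r" and "0 < e"
  shows "\<exists>d>0. \<forall>b. r < b \<and> b - r < d \<longrightarrow> near_step e r b"
\<comment> \<open>A history lies strictly before the current time, so \<open>t\<close> can be part
  of it only for \<open>r > t\<close>.\<close>
proof (cases "r = t")
  case True
  obtain d where d: "0 < d" "\<And>\<Delta>. 0 < \<Delta> \<Longrightarrow> \<Delta> < d \<Longrightarrow> near_rates e \<Delta> (trans_matrix \<Omega> P u xu t (t + \<Delta>))"
    using right_near[OF t(1) u xu assms(2)] unfolding eventually_at_right_field by auto
  have "near_step e r b" if "r < b \<and> b - r < d" for b
    using d(2)[of "b - r"] that p_trans_t[of b] True unfolding near_step_def
    by (intro exI[of _ "trans_matrix \<Omega> P u xu t b"]) simp
  then show ?thesis using d(1) by blast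
next
  case False
  then have u': "insert t u \<in> time_sets_before r" "0 \<le> r" "t < r"
    using history_insert r t by (auto simp: time_sets_before_def)
  obtain d where d: "0 < d" "\<And>\<Delta>. 0 < \<Delta> \<Longrightarrow> \<Delta> < d \<Longrightarrow>
      near_rates e \<Delta> (trans_matrix \<Omega> P (insert t u) (xu(t := x)) r (r + \<Delta>))"
    using right_near[OF u'(2,1) history_insert(2) assms(2)] unfolding eventually_at_right_field by auto
  have "near_step e r b" if "r < b \<and> b - r < d" for b
    using d(2)[of "b - r"] that p_trans[OF u'(3), of b] unfolding near_step_def
    by (intro exI[of _ "trans_matrix \<Omega> P (insert t u) (xu(t := x)) r b"]) simp
  then show ?thesis using d(1) by blast
qed

lemma near_step_left:
  assumes r: "t < r" and "0 < e"
  shows "\<exists>d>0. \<forall>a. t \<le> a \<and> a < r \<and> r - a < d \<longrightarrow> near_step e a r"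
proof -
  have u': "insert t u \<in> time_sets_before r" "0 < r"
    using history_insert r t by (auto simp: time_sets_before_def)
  obtain d where d: "0 < d" "\<And>\<Delta>. 0 < \<Delta> \<Longrightarrow> \<Delta> < d \<Longrightarrow>
      near_rates e \<Delta> (trans_matrix \<Omega> P (insert t u) (xu(t := x)) (r - \<Delta>) r)"
    using left_near[OF u'(2,1) history_insert(2) assms(2)] unfolding eventually_at_right_field by auto
  have "near_step e a r" if a: "t \<le> a \<and> a < r \<and> r - a < min d (r - t)" for a
  proof -
    have "t < a" "a < r" "r - a < d" using a by auto
    then show ?thesis
      using d(2)[of "r - a"] p_trans[of a r] unfolding near_step_def
      by (intro exI[of _ "trans_matrix \<Omega> P (insert t u) (xu(t := x)) a r"]) simp
  qed
  moreover have "0 < min d (r - t)" using d(1) r by simp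
  ultimately show ?thesis by blast
qed

text \<open>An interval around \<open>r\<close> is crossed in two steps, from \<open>a\<close> to
  \<open>r\<close> by the left estimate and from \<open>r\<close> to \<open>b\<close> by the right
  one. The radius depends on \<open>r\<close>, which is why the steps have to meet there.\<close>

lemma interpolant_local:
  assumes r: "t \<le> r" "r \<le> s" and "0 < \<epsilon>"
  shows "\<exists>d>0. \<forall>a b. a \<le> r \<and> r \<le> b \<and> b - a < d \<longrightarrow> t \<le> a \<longrightarrow> b \<le> s \<longrightarrow> interpolant a - \<epsilon> * (b - a) \<le> interpolant b"
proof -
  \<comment> \<open>\<open>e\<close> gives half of \<open>\<epsilon>\<close> to the rate tolerance,
    and \<open>d \<le> \<epsilon> / (2 * K)\<close> the other half to the second-order error of
    \<open>lower_trans\<close>. The additions of \<open>1\<close> keep the divisors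
    positive.\<close>
  define K where "K = M\<^sup>2 * infnorm g + 1"
  define e where "e = \<epsilon> / (2 * (real CARD('x) * infnorm g + 1))"
  have K: "0 < K" by (simp add: K_def add_nonneg_pos infnorm_pos_le)
  have den: "0 < real CARD('x) * infnorm g + 1" by (simp add: add_nonneg_pos infnorm_pos_le)
  have "\<epsilon> / (2 * c) * c = \<epsilon> / 2" if "0 < c" for c using that by simp
  from this[OF den] have e: "0 < e" "e * (real CARD('x) * infnorm g + 1) = \<epsilon> / 2"
    using \<open>0 < \<epsilon>\<close> den unfolding e_def by auto
  obtain d1 where d1: "0 < d1" "\<And>b. r < b \<Longrightarrow> b - r < d1 \<Longrightarrow> near_step e r b"
    using near_step_right[OF r(1) e(1)] by blast
  obtain d2 where d2: "0 < d2" "\<And>a. t \<le> a \<Longrightarrow> a < r \<Longrightarrow> r - a < d2 \<Longrightarrow> near_step e a r"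
  proof (cases "r = t")
    \<comment> \<open>No left step ends at \<open>r = t\<close>, so any radius will do.\<close>
    case True then show ?thesis using that[of 1] by simp
  next
    case False then show ?thesis using near_step_left[of r e] r(1) e(1) that by force
  qed
  define d where "d = min (min d1 d2) (min (1 / M) (\<epsilon> / (2 * K)))"
  have d: "0 < d" "d \<le> d1" "d \<le> d2" "d \<le> 1 / M" "d \<le> \<epsilon> / (2 * K)"
    using d1(1) d2(1) M_ge(2) K \<open>0 < \<epsilon>\<close> by (auto simp: d_def)
  have step: "interpolant a - \<epsilon> * (b - a) \<le> interpolant b"
    if ab: "t \<le> a" "a < b" "b \<le> s" "b - a < d"
      and T: "near_step e a b" for a b
  proof -
    from T obtain T where T: "\<And>z. p b z = (\<Sum>y\<in>UNIV. p a y * T $ y $ z)" "near_rates e (b - a) T"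
      unfolding near_step_def by blast
    have "b - a \<le> 1 / M" using ab d by linarith
    then have "(b - a) * M \<le> 1" using M_ge(2) by (simp add: pos_le_divide_eq)
    note st = interpolant_step[OF ab(1-3) T this less_imp_le[OF e(1)]]
    have "b - a \<le> \<epsilon> / (2 * K)" using ab d by linarith
    then have "(b - a) * K \<le> \<epsilon> / 2" using K by (simp add: field_simps)
    moreover have "M\<^sup>2 * (b - a) * infnorm g \<le> (b - a) * K" using ab by (simp add: K_def algebra_simps)
    moreover have "real CARD('x) * e * infnorm g \<le> \<epsilon> / 2" using e by (simp add: algebra_simps)
    ultimately have "real CARD('x) * e * infnorm g + M\<^sup>2 * (b - a) * infnorm g \<le> \<epsilon>" by linarith
    then have "(b - a) * (real CARD('x) * e * infnorm g + M\<^sup>2 * (b - a) * infnorm g) \<le> (b - a) * \<epsilon>"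
      using ab by (intro mult_left_mono) auto
    then show ?thesis using st by (simp add: mult.commute)
  qed
  show ?thesis
  proof (intro exI[of _ d] conjI allI impI d(1))
    fix a b assume ab: "a \<le> r \<and> r \<le> b \<and> b - a < d" "t \<le> a" "b \<le> s"
    have 1: "interpolant a - \<epsilon> * (r - a) \<le> interpolant r"
    proof (cases "a = r")
      case False then show ?thesis using ab d r by (intro step d2(2)) auto
    qed simp
    have 2: "interpolant r - \<epsilon> * (b - r) \<le> interpolant b"
    proof (cases "b = r")
      case False then show ?thesis using ab d r by (intro step d1(2)) auto
    qed simp
    show "interpolant a - \<epsilon> * (b - a) \<le> interpolant b" using 1 2 by (simp add: algebra_simps)
  qed
qed

lemma lower_trans_le_expectation:
  "lower_trans qlow t s g $ x \<le> (\<Sum>y\<in>UNIV. p s y * g $ y)"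
proof -
  have "interpolant t \<le> interpolant s"
  proof (rule field_le_epsilon)
    fix \<epsilon> :: real assume "0 < \<epsilon>"
    define \<epsilon>' where "\<epsilon>' = \<epsilon> / (s - t + 1)"
    have \<epsilon>': "0 < \<epsilon>'" "\<epsilon>' * (s - t) \<le> \<epsilon>" using \<open>0 < \<epsilon>\<close> t by (auto simp: \<epsilon>'_def field_simps)
    have "t \<le> t \<longrightarrow> s \<le> s \<longrightarrow> interpolant t - \<epsilon>' * (s - t) \<le> interpolant s"
      using t(2)
    \<comment> \<open>\<open>Bolzano\<close> makes the local property global by bisection. The
      bounds by \<open>t\<close> and \<open>s\<close> are carried inside the predicate, and the
      error \<open>\<epsilon>' * (b - a)\<close> is additive over adjacent intervals.\<close>
    proof (rule Bolzano[where P="\<lambda>a b. t \<le> a \<longrightarrow> b \<le> s \<longrightarrow> interpolant a - \<epsilon>' * (b - a) \<le> interpolant b"])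
      fix a b c assume "t \<le> a \<longrightarrow> b \<le> s \<longrightarrow> interpolant a - \<epsilon>' * (b - a) \<le> interpolant b"
        "t \<le> b \<longrightarrow> c \<le> s \<longrightarrow> interpolant b - \<epsilon>' * (c - b) \<le> interpolant c" "a \<le> b" "b \<le> c"
      moreover have "\<epsilon>' * (c - a) = \<epsilon>' * (b - a) + \<epsilon>' * (c - b)" by (simp add: algebra_simps)
      ultimately show "t \<le> a \<longrightarrow> c \<le> s \<longrightarrow> interpolant a - \<epsilon>' * (c - a) \<le> interpolant c" by linarith
    next
      fix r assume "t \<le> r" "r \<le> s"
      then show "\<exists>d>0. \<forall>a b. a \<le> r \<and> r \<le> b \<and> b - a < d \<longrightarrow> t \<le> a \<longrightarrow> b \<le> s \<longrightarrow> interpolant a - \<epsilon>' * (b - a) \<le> interpolant b"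
        using \<epsilon>'(1) by (rule interpolant_local)
    qed
    then show "interpolant t \<le> interpolant s + \<epsilon>" using \<epsilon>'(2) by simp
  qed
  moreover have "interpolant t = lower_trans qlow t s g $ x"
    unfolding interpolant_def p_at_t by (simp add: if_distrib[of "\<lambda>c. c * _"] cong: if_cong)
  ultimately show ?thesis unfolding interpolant_def[of s] lower_trans_refl by simp
qed

end

end

section \<open>Several future times\<close>

lemma sum_tuples_insert:
  fixes g :: "(real \<Rightarrow> 'x::finite) \<Rightarrow> real"
  assumes "finite S" "s \<notin> S"
  shows "(\<Sum>xv\<in>tuples (insert s S). g xv) = (\<Sum>y\<in>UNIV. \<Sum>xv\<in>tuples S. g (xv(s := y)))"
proof -
  have eq: "tuples (insert s S) = (\<lambda>(y, xv). xv(s := y)) ` (UNIV \<times> tuples S)"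
    unfolding tuples_def by (rule PiE_insert_eq)
  have inj: "inj_on (\<lambda>(y, xv). xv(s := y)) ((UNIV :: 'x set) \<times> tuples S)"
    unfolding tuples_def using inj_combinator[OF assms(2), of "\<lambda>_. UNIV :: 'x set"] by simp
  have "(\<Sum>xv\<in>tuples (insert s S). g xv) = (\<Sum>p\<in>UNIV \<times> tuples S. g ((snd p)(s := fst p)))"
    unfolding eq by (subst sum.reindex[OF inj]) (simp add: split_beta o_def)
  also have "\<dots> = (\<Sum>y\<in>UNIV. \<Sum>xv\<in>tuples S. g (xv(s := y)))"
    by (subst sum.cartesian_product) (simp add: split_beta)
  finally show ?thesis .
qed

lemma merge_insert:
  "s \<notin> S \<Longrightarrow> s \<notin> w \<Longrightarrow> merge w (insert s S) (xw, xv(s := y)) = merge (insert s w) S (xw(s := y), xv)"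
  by (auto simp: merge_def fun_eq_iff)

lemma tuple_event_upd:
  "s \<notin> S \<Longrightarrow> tuple_event \<Omega> (insert s S) (xv(s := y)) = tuple_event \<Omega> S xv \<inter> state_event \<Omega> s y"
  by (simp add: tuple_event_insert Int_commute)

context consistent_process
begin

text \<open>The bound for the single time \<open>s\<close> is applied to the vector of remaining
  iterates. The induction hypothesis bounds each of them under the condition extended by
  \<open>s\<close>, and the product rule merges the two conditional probabilities.\<close>

lemma lower_trans_iter_le_expectation:
  assumes "w \<in> time_sets" "w \<noteq> {}" "xw \<in> tuples w" "sorted_wrt (<) ss" "\<forall>r\<in>w. \<forall>s\<in>set ss. r < s"
  shows "lower_trans_iter qlow w ss f xw \<le>
    (\<Sum>xv\<in>tuples (set ss). f (merge w (set ss) (xw, xv)) * P (tuple_event \<Omega> (set ss) xv, tuple_event \<Omega> w xw))"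
  using assms
proof (induction ss arbitrary: w xw)
  case Nil
  have "merge w {} (xw, xv) = xw" for xv
    using Nil(3) by (auto simp: merge_def tuples_def PiE_def extensional_def fun_eq_iff)
  moreover have "P (tuple_event \<Omega> {} xv, tuple_event \<Omega> w xw) = 1" for xv
    using Nil by (intro prob_one) (auto simp: tuple_event_def event_algebra.top)
  ultimately show ?case by (simp add: tuples_def)
next
  case (Cons s S)
  let ?S = "set S" and ?C = "tuple_event \<Omega> w xw"
  have fin: "finite w" and w0: "\<And>r. r \<in> w \<Longrightarrow> 0 \<le> r" using Cons.prems(1) by (auto simp: time_sets_def)
  have sw: "\<forall>r\<in>w. r < s" "s \<notin> w" "s \<notin> ?S" using Cons.prems(4,5) by auto
  obtain r where r: "r \<in> w" using Cons.prems(2) by blast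
  have s0: "0 \<le> s" using w0[OF r] sw(1) r by force
  let ?D = "\<lambda>y. tuple_event \<Omega> (insert s w) (xw(s := y))"
  let ?it = "\<lambda>y. lower_trans_iter qlow (insert s w) S f (xw(s := y))"
  define t where "t = Max w"
  have t: "t \<in> w" "\<And>r. r \<in> w \<Longrightarrow> r \<le> t" using fin Cons.prems(2) by (auto simp: t_def)
  have times: "\<forall>s'\<in>?S. s < s'" using Cons.prems(4) by simp
  have prod: "P (tuple_event \<Omega> (insert s ?S) (xv(s := y)), ?C) =
      P (tuple_event \<Omega> ?S xv, ?D y) * P (state_event \<Omega> s y, ?C)" for xv y
    unfolding tuple_event_upd[OF sw(3)]
  proof (rule prob_product[OF Cons.prems(1,3)])
    show "tuple_event \<Omega> ?S xv \<in> event_algebra \<Omega> w"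
      using s0 times sw(1) by (intro tuple_event_in_event_algebra) force+
    show "tuple_event \<Omega> ?S xv \<in> event_algebra \<Omega> (insert s w)"
      using s0 times sw(1) by (intro tuple_event_in_event_algebra) force+
  qed (use s0 sw in auto)
  have IH: "?it y \<le> (\<Sum>xv\<in>tuples ?S. f (merge (insert s w) ?S (xw(s := y), xv)) * P (tuple_event \<Omega> ?S xv, ?D y))" for y
  proof (rule Cons.IH)
    show "insert s w \<in> time_sets" "xw(s := y) \<in> tuples (insert s w)"
      using Cons.prems(1,3) s0 by (auto intro: time_sets_insert tuples_insert)
    show "sorted_wrt (<) S" using Cons.prems(4) by simp
    show "\<forall>r\<in>insert s w. \<forall>s\<in>set S. r < s" using Cons.prems(4,5) by simp
  qed simp
  have nn: "0 \<le> P (state_event \<Omega> s y, ?C)" for y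
    using s0 sw by (intro prob_nonneg Cons.prems state_event_in_event_algebra) auto
  \<comment> \<open>The last time \<open>t\<close> of \<open>w\<close> is the current time; the
    other elements of \<open>w\<close> are the history.\<close>
  have "lower_trans qlow t s (\<chi> y. ?it y) $ xw t \<le>
      (\<Sum>y\<in>UNIV. P (state_event \<Omega> s y, tuple_event \<Omega> (insert t (w - {t})) ((restrict xw (w - {t}))(t := xw t))) *
        (\<chi> y. ?it y) $ y)"
  proof (rule lower_trans_le_expectation)
    show "0 \<le> t" "t \<le> s" using w0 t(1) sw(1) by (auto intro: less_imp_le)
    show "w - {t} \<in> time_sets_before t"
      using Cons.prems(1) t(2) by (auto simp: time_sets_before_def time_sets_def less_le)
    show "restrict xw (w - {t}) \<in> tuples (w - {t})" by (auto simp: tuples_def)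
  qed
  moreover have "insert t (w - {t}) = w" using t(1) by auto
  moreover have "tuple_event \<Omega> w ((restrict xw (w - {t}))(t := xw t)) = ?C" by (auto simp: tuple_event_def)
  ultimately have "lower_trans_iter qlow w (s # S) f xw \<le> (\<Sum>y\<in>UNIV. P (state_event \<Omega> s y, ?C) * ?it y)"
    by (simp add: lower_trans_tuple_def t_def)
  also have "\<dots> \<le> (\<Sum>y\<in>UNIV. P (state_event \<Omega> s y, ?C) *
      (\<Sum>xv\<in>tuples ?S. f (merge (insert s w) ?S (xw(s := y), xv)) * P (tuple_event \<Omega> ?S xv, ?D y)))"
    by (intro sum_mono mult_left_mono IH nn)
  also have "\<dots> = (\<Sum>y\<in>UNIV. \<Sum>xv\<in>tuples ?S. f (merge w (insert s ?S) (xw, xv(s := y))) *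
      P (tuple_event \<Omega> (insert s ?S) (xv(s := y)), ?C))"
    unfolding merge_insert[OF sw(3,2)] prod sum_distrib_left by (simp only: mult_ac)
  also have "\<dots> = (\<Sum>xv\<in>tuples (insert s ?S). f (merge w (insert s ?S) (xw, xv)) *
      P (tuple_event \<Omega> (insert s ?S) xv, ?C))"
    by (rule sum_tuples_insert[symmetric]) (use sw in auto)
  finally show ?case by simp
qed

end

section \<open>Controlled discrete-time processes\<close>

text \<open>The dynamic-programming form of \<open>lower_trans_iter\<close>: the current time
  \<open>a\<close> replaces the whole set \<open>w\<close>, and \<open>x\<close> is a total path. It
  can be evaluated along simulated paths and with extra time points.\<close>

fun viter ::
  "(real ^ 'x::finite \<Rightarrow> real ^ 'x) \<Rightarrow> real \<Rightarrow> real list \<Rightarrow> ((real \<Rightarrow> 'x) \<Rightarrow> real) \<Rightarrow> (real \<Rightarrow> 'x) \<Rightarrow> real" where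
  "viter q a [] g x = g x"
| "viter q a (s # ss) g x = lower_trans q a s (\<chi> y. viter q s ss g (x(s := y))) $ x a"

lemma lower_trans_iter_eq_viter:
  "finite w \<Longrightarrow> w \<noteq> {} \<Longrightarrow> sorted_wrt (<) ss \<Longrightarrow> \<forall>r\<in>w. \<forall>s\<in>set ss. r < s \<Longrightarrow>
    lower_trans_iter q w ss g x = viter q (Max w) ss g x"
proof (induction ss arbitrary: w x)
  case (Cons s ss)
  have "Max (insert s w) = s"
    using Cons.prems by (intro Max_eqI) (auto intro: less_imp_le)
  then have "lower_trans_iter q (insert s w) ss g x = viter q s ss g x" for x
    using Cons.IH[of "insert s w"] Cons.prems by simp
  then show ?case by (simp add: lower_trans_tuple_def)
qed simp

lemma viter_cong_values:
  assumes "\<And>z. z \<in> tuples (w \<union> set ss) \<Longrightarrow> f z = g z" "x \<in> tuples w"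
  shows "viter q a ss f x = viter q a ss g x"
  using assms
proof (induction ss arbitrary: w a x)
  case (Cons s ss)
  have "viter q s ss f (x(s := y)) = viter q s ss g (x(s := y))" for y
    using Cons.prems(1) tuples_insert[OF Cons.prems(2), of s y] by (intro Cons.IH[of "insert s w"]) (simp_all del: fun_upd_apply)
  then show ?case by simp
qed simp

lemma viter_upd:
  "(\<And>x y. g (x(b := y)) = g x) \<Longrightarrow> b \<noteq> a \<Longrightarrow> b \<notin> set ss \<Longrightarrow> viter q a ss g (x(b := y)) = viter q a ss g x"
proof (induction ss arbitrary: a x)
  case (Cons s ss)
  have "viter q s ss g (x(b := y, s := z)) = viter q s ss g (x(s := z))" for z
    using Cons.IH[of s "x(s := z)"] Cons.prems by (simp add: fun_upd_twist[of b s] del: fun_upd_apply)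
  moreover have "(x(b := y)) a = x a" using Cons.prems(2) by simp
  ultimately show ?case by (simp del: fun_upd_apply)
qed simp

lemma (in lower_rate) viter_bound:
  "sorted_wrt (<) (a # ss) \<Longrightarrow> (\<And>x. \<bar>g x\<bar> \<le> B) \<Longrightarrow> \<bar>viter q a ss g x\<bar> \<le> B"
proof (induction ss arbitrary: a x)
  case (Cons s ss)
  have "infnorm (\<chi> y. viter q s ss g (x(s := y))) \<le> B"
    using Cons by (auto simp: infnorm_le_cart_iff)
  moreover have "infnorm (lower_trans q a s (\<chi> y. viter q s ss g (x(s := y))))
      \<le> infnorm (\<chi> y. viter q s ss g (x(s := y)))"
    using Cons.prems by (intro lower_transition_operator_infnorm_le lower_trans_euler) simp
  ultimately show ?case using infnorm_le_cart_iff order_trans by (metis viter.simps(2))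
qed simp

text \<open>The semigroup property allows the insertion of irrelevant time points.\<close>

lemma (in lower_rate) viter_filter:
  "sorted_wrt (<) (a # bs) \<Longrightarrow> (\<And>b x y. b \<in> set bs \<Longrightarrow> b \<notin> V \<Longrightarrow> g (x(b := y)) = g x) \<Longrightarrow>
    viter q a bs g x = viter q a (filter (\<lambda>b. b \<in> V) bs) g x"
proof (induction bs arbitrary: a x)
  case (Cons b bs)
  let ?cs = "filter (\<lambda>b. b \<in> V) bs"
  have ab: "a \<le> b" using Cons.prems by simp
  have IH: "viter q b bs g x = viter q b ?cs g x" for x
    using Cons by simp
  show ?case
  proof (cases "b \<in> V")
    case True then show ?thesis by (simp add: IH)
  next
    case False
    then have g: "g (x(b := y)) = g x" for x y using Cons.prems(2)[of b x y] by (simp del: fun_upd_apply)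
    show ?thesis
    \<comment> \<open>Without a later relevant time the inner value does not depend on the state at
      \<open>b\<close>, and constants are fixed. Otherwise the operator up to \<open>b\<close>
      merges with the one up to the next relevant time.\<close>
    proof (cases ?cs)
      case Nil
      have "lower_trans q a b (\<chi> y. g x) = (\<chi> y. g x)"
        by (rule lower_transition_operator_const[OF lower_trans_euler(1)[OF ab]])
      then show ?thesis using False Nil by (simp add: IH g)
    next
      case (Cons s cs)
      have "set (s # cs) \<subseteq> set bs" using filter_is_subset[of "\<lambda>b. b \<in> V" bs] unfolding Cons .
      moreover have "sorted_wrt (<) (s # cs)"
        using sorted_wrt_filter[of "(<)" bs "\<lambda>b. b \<in> V"] Cons.prems(1) unfolding Cons by simp
      ultimately have s: "s \<in> set bs" "set cs \<subseteq> set bs" "sorted_wrt (<) (s # cs)" by auto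
      have bs: "b < r" if "r \<in> set bs" for r using Cons.prems(1) that by simp
      then have bne: "b \<noteq> s" "b \<notin> set cs" using s by auto
      let ?H = "\<chi> y. viter q s cs g (x(s := y))"
      have "viter q s cs g (x(b := y, s := z)) = viter q s cs g (x(s := z))" for y z
        using viter_upd[of g b s cs q "x(s := z)" y] g bne by (simp add: fun_upd_twist[of b s] del: fun_upd_apply)
      then have "(\<chi> y. viter q b ?cs g (x(b := y))) = lower_trans q b s ?H"
        by (simp add: Cons vec_eq_iff)
      then have "viter q a (b # bs) g x = lower_trans q a b (lower_trans q b s ?H) $ x a"
        by (simp add: IH)
      also have "\<dots> = lower_trans q a s ?H $ x a"
        using ab bs[OF s(1)] by (simp add: lower_trans_semigroup)
      also have "\<dots> = viter q a (filter (\<lambda>b. b \<in> V) (b # bs)) g x" using False Cons by simp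
      finally show ?thesis .
    qed
  qed
qed simp

text \<open>\<open>K a b x\<close> may use the whole path \<open>x\<close> recorded up to
  \<open>a\<close>, which makes history-dependent control possible. Times not yet visited keep the
  values of the start path.\<close>

fun walk :: "(real \<Rightarrow> real \<Rightarrow> (real \<Rightarrow> 'x) \<Rightarrow> 'x pmf) \<Rightarrow> real \<Rightarrow> real list \<Rightarrow> (real \<Rightarrow> 'x) \<Rightarrow> (real \<Rightarrow> 'x) pmf" where
  "walk K a [] x = return_pmf x"
| "walk K a (b # bs) x = bind_pmf (K a b x) (\<lambda>y. walk K b bs (x(b := y)))"

lemma finite_set_walk: "finite (set_pmf (walk K a bs (x :: real \<Rightarrow> 'x::finite)))"
  by (induction bs arbitrary: a x) auto

lemma walk_append: "walk K a (bs @ cs) x = bind_pmf (walk K a bs x) (walk K (last (a # bs)) cs)"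
proof (induction bs arbitrary: a x)
  case Nil then show ?case by (simp add: bind_return_pmf)
next
  case (Cons b bs)
  have "last (a # b # bs) = last (b # bs)" by simp
  then show ?case by (simp only: append_Cons walk.simps Cons.IH bind_assoc_pmf)
qed

lemma walk_expectation_Cons:
  fixes g :: "(real \<Rightarrow> 'x::finite) \<Rightarrow> real"
  shows "measure_pmf.expectation (walk K a (b # bs) x) g =
    (\<Sum>y\<in>UNIV. pmf (K a b x) y * measure_pmf.expectation (walk K b bs (x(b := y))) g)"
proof -
  have "measure_pmf.expectation (bind_pmf (K a b x) (\<lambda>y. walk K b bs (x(b := y)))) g =
      (\<Sum>y\<in>UNIV. pmf (K a b x) y *\<^sub>R measure_pmf.expectation (walk K b bs (x(b := y))) g)"
    by (rule pmf_expectation_bind) (auto intro: finite_set_walk)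
  then show ?thesis by simp
qed

lemma walk_unchanged: "x' \<in> set_pmf (walk K a bs x) \<Longrightarrow> t \<notin> set bs \<Longrightarrow> x' t = x t"
proof (induction bs arbitrary: a x)
  case (Cons b bs)
  then obtain y where "x' \<in> set_pmf (walk K b bs (x(b := y)))" by (auto simp del: fun_upd_apply)
  from Cons.IH[OF this] show ?case using Cons.prems(2) by simp
qed simp

lemma walk_reach:
  assumes "\<And>a b x y. 0 < pmf (K a b x) y" "distinct bs"
  shows "\<exists>x'\<in>set_pmf (walk K a bs x). \<forall>t\<in>set bs. x' t = z t"
  using assms(2)
proof (induction bs arbitrary: a x)
  case (Cons b bs)
  then obtain x' where x': "x' \<in> set_pmf (walk K b bs (x(b := z b)))" "\<forall>t\<in>set bs. x' t = z t" by force
  have "x' b = z b" using walk_unchanged[OF x'(1), of b] Cons.prems by simp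
  moreover have "z b \<in> set_pmf (K a b x)" using assms(1)[of a b x "z b"] by (simp add: set_pmf_iff)
  ultimately show ?case using x' by auto
qed simp

text \<open>A kernel is not told the remaining times but recovers them from a fixed grid
  \<open>l\<close> and its own time. This identity keeps that in step with the recursion of
  \<open>walk\<close>.\<close>

lemma filter_greater_sorted:
  "sorted_wrt (<) l \<Longrightarrow> filter (\<lambda>r. a < r) l = b # bs \<Longrightarrow> filter (\<lambda>r. (b :: real) < r) l = bs"
proof (induction l)
  case (Cons c l)
  show ?case
  proof (cases "a < c")
    case True
    then have "filter (\<lambda>r. a < r) l = l" using Cons.prems(1) by (intro filter_True) auto
    then have "b = c" "bs = l" using Cons.prems(2) True by auto
    moreover have "filter (\<lambda>r. c < r) l = l" using Cons.prems(1) by (intro filter_True) auto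
    ultimately show ?thesis by simp
  next
    case False
    then have f: "filter (\<lambda>r. a < r) l = b # bs" using Cons.prems by simp
    have "b \<in> set (filter (\<lambda>r. a < r) l)" unfolding f by simp
    then have "\<not> b < c" using False by auto
    then show ?thesis using Cons.IH f Cons.prems(1) by simp
  qed
qed simp

section \<open>Value and transition rates of a controlled walk\<close>

context rate_set
begin

text \<open>A step of length \<open>b - a\<close> loses \<open>(b - a) * e\<close> because the
  kernel only nearly minimises, and \<open>(b - a) * (M\<^sup>2 * d * B)\<close> because
  \<open>I + (b - a) qlow\<close> stands in for \<open>lower_trans\<close>. The losses sum to a
  multiple of the elapsed time, however many steps there are.\<close>

lemma walk_expectation_le_viter:
  assumes l: "sorted_wrt (<) l" and g: "\<And>x. \<bar>g x\<bar> \<le> B" and d: "d * M \<le> 1"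
    and K: "\<And>a b x W. a < b \<Longrightarrow> b - a \<le> d \<Longrightarrow> W = (\<chi> y. viter qlow b (filter (\<lambda>r. b < r) l) g (x(b := y))) \<Longrightarrow>
      (\<Sum>y\<in>UNIV. pmf (K a b x) y * W $ y) \<le> W $ x a + (b - a) * (qlow W $ x a + e)"
  shows "sorted_wrt (<) (a # bs) \<Longrightarrow> mesh (a # bs) \<le> d \<Longrightarrow> filter (\<lambda>r. a < r) l = bs \<Longrightarrow>
    measure_pmf.expectation (walk K a bs x) g \<le>
      viter qlow a bs g x + (last (a # bs) - a) * (e + M\<^sup>2 * d * B)"
proof (induction bs arbitrary: a x)
  case (Cons b bs)
  have bs: "filter (\<lambda>r. b < r) l = bs" using filter_greater_sorted[OF l Cons.prems(3)] .
  define W where "W = (\<chi> y. viter qlow b bs g (x(b := y)))"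
  let ?E = "\<lambda>y. measure_pmf.expectation (walk K b bs (x(b := y))) g"
  let ?c = "(last (b # bs) - b) * (e + M\<^sup>2 * d * B)"
  have ab: "a < b" "b - a \<le> d" using Cons.prems by auto
  have B: "0 \<le> B" using g[of x] by linarith
  have "?E y \<le> W $ y + ?c" for y
    using Cons.IH[of b "x(b := y)"] Cons.prems bs by (simp add: W_def del: fun_upd_apply)
  then have "measure_pmf.expectation (walk K a (b # bs) x) g \<le> (\<Sum>y\<in>UNIV. pmf (K a b x) y * (W $ y + ?c))"
    unfolding walk_expectation_Cons by (intro sum_mono mult_left_mono) auto
  also have "\<dots> = (\<Sum>y\<in>UNIV. pmf (K a b x) y * W $ y) + ?c"
    by (simp add: distrib_left sum.distrib sum_distrib_right[symmetric] sum_pmf_eq_1)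
  also have "\<dots> \<le> W $ x a + (b - a) * (qlow W $ x a + e) + ?c"
    using K[OF ab, of W x] bs by (simp add: W_def)
  also have "\<dots> \<le> lower_trans qlow a b W $ x a + (b - a) * (e + M\<^sup>2 * d * B) + ?c"
  proof -
    have "(b - a) * M \<le> 1" using ab d M_ge(2) by (meson mult_right_mono less_imp_le order_trans)
    then have "infnorm (lower_trans qlow a b W - W - (b - a) *\<^sub>R qlow W) \<le> M\<^sup>2 * (b - a)\<^sup>2 * infnorm W"
      using ab by (intro lower_trans_first_order)
    also have "\<dots> \<le> M\<^sup>2 * (b - a)\<^sup>2 * B"
    proof (intro mult_left_mono)
      show "infnorm W \<le> B"
        using viter_bound[of b bs g B] g Cons.prems(1) by (simp add: infnorm_le_cart_iff W_def)
    qed simp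
    also have "\<dots> \<le> (b - a) * (M\<^sup>2 * d * B)"
    proof -
      have "(M\<^sup>2 * (b - a) * B) * (b - a) \<le> (M\<^sup>2 * (b - a) * B) * d"
        using ab B by (intro mult_left_mono) auto
      then show ?thesis by (simp add: power2_eq_square mult_ac)
    qed
    finally have "\<bar>(lower_trans qlow a b W - W - (b - a) *\<^sub>R qlow W) $ x a\<bar> \<le> (b - a) * (M\<^sup>2 * d * B)"
      using component_le_infnorm_cart order_trans by blast
    then show ?thesis by (simp add: abs_le_iff algebra_simps)
  qed
  also have "\<dots> = viter qlow a (b # bs) g x + (last (a # b # bs) - a) * (e + M\<^sup>2 * d * B)"
    by (simp add: W_def algebra_simps)
  finally show ?case .
qed simp

text \<open>The second-order error depends on the total duration but not on the number of steps.
  Only the row of the start state is described, because other start states may need other members of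
  \<open>H\<close>.\<close>

lemma walk_row_estimate:
  assumes H: "H \<subseteq> \<Q>" "convex H" "H \<noteq> {}" and e: "0 \<le> e" "e \<le> 1"
    and K: "\<And>a b x. a < b \<Longrightarrow> b - a \<le> d \<Longrightarrow>
      \<exists>Q\<in>H. \<forall>y. \<bar>pmf (K a b x) y - ((if x a = y then 1 else 0) + (b - a) * Q $ x a $ y)\<bar> \<le> (b - a) * e"
  shows "sorted_wrt (<) (a # bs) \<Longrightarrow> mesh (a # bs) \<le> d \<Longrightarrow>
    \<exists>Q\<in>H. \<forall>y. \<bar>measure_pmf.expectation (walk K a bs x) (\<lambda>x'. indicator {y} (x' (last (a # bs))))
      - ((if x a = y then 1 else 0) + (last (a # bs) - a) * Q $ x a $ y)\<bar>
      \<le> (last (a # bs) - a) * e + m * (m + 1) * (last (a # bs) - a)\<^sup>2"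
proof (induction bs arbitrary: a x)
  case Nil
  obtain Q where "Q \<in> H" using H(3) by blast
  then show ?case by (auto simp: indicator_def)
next
  case (Cons b bs)
  let ?c = "last (b # bs)" and ?X = "x a"
  let ?D = "?c - b" and ?d = "b - a"
  define k where "k y = pmf (K a b x) y" for y
  have kn: "0 \<le> k y" for y by (simp add: k_def)
  have k1: "(\<Sum>y\<in>UNIV. k y) = 1" by (simp add: k_def sum_pmf_eq_1)
  define E :: "'x \<Rightarrow> 'x \<Rightarrow> real" where "E z y = measure_pmf.expectation (walk K b bs (x(b := z))) (\<lambda>x'. indicator {y} (x' ?c))" for z y
  have ab: "a < b" "?d \<le> d" using Cons.prems by auto
  have D: "0 \<le> ?D" using sorted_wrt_hd_le_last[of "b # bs"] Cons.prems by simp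
  obtain Q0 where Q0: "Q0 \<in> H" "\<And>y. \<bar>k y - ((if ?X = y then 1 else 0) + ?d * Q0 $ ?X $ y)\<bar> \<le> ?d * e"
    using K[OF ab, of x] unfolding k_def by blast
  have "\<forall>z. \<exists>Q\<in>H. \<forall>y. \<bar>E z y - ((if z = y then 1 else 0) + ?D * Q $ z $ y)\<bar> \<le> ?D * e + m * (m + 1) * ?D\<^sup>2"
  proof
    fix z
    show "\<exists>Q\<in>H. \<forall>y. \<bar>E z y - ((if z = y then 1 else 0) + ?D * Q $ z $ y)\<bar> \<le> ?D * e + m * (m + 1) * ?D\<^sup>2"
    proof -
      have "sorted_wrt (<) (b # bs)" "mesh (b # bs) \<le> d" using Cons.prems by auto
      from Cons.IH[OF this, of "x(b := z)"] show ?thesis unfolding E_def fun_upd_same .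
    qed
  qed
  then obtain Qz where Qz: "\<And>z. Qz z \<in> H"
    "\<And>z y. \<bar>E z y - ((if z = y then 1 else 0) + ?D * Qz z $ z $ y)\<bar> \<le> ?D * e + m * (m + 1) * ?D\<^sup>2"
    by metis
  \<comment> \<open>The chance to leave \<open>?X\<close> in the first step: the rate is at most
    \<open>m\<close>, and the kernel deviates by at most \<open>e \<le> 1\<close> per unit of
    time.\<close>
  have kX: "1 - k ?X \<le> ?d * (m + 1)"
  proof -
    have "\<bar>Q0 $ ?X $ ?X\<bar> \<le> m" using entry_le Q0(1) H(1) by blast
    then have "?d * - m \<le> ?d * Q0 $ ?X $ ?X" using ab by (intro mult_left_mono) auto
    moreover have "?d * e \<le> ?d * 1" using ab e by (intro mult_left_mono) auto
    ultimately show ?thesis using Q0(2)[of ?X] by (simp add: algebra_simps abs_le_iff)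
  qed
  \<comment> \<open>The average of the first rate and of the rate of the remaining walk from
    \<open>?X\<close>, weighted by duration.\<close>
  define Q where "Q = (?d / (?d + ?D)) *\<^sub>R Q0 + (?D / (?d + ?D)) *\<^sub>R Qz ?X"
  have QH: "Q \<in> H"
    unfolding Q_def using H(2) Q0(1) Qz(1) ab D
    by (intro convexD) (auto simp: add_divide_distrib[symmetric])
  have Qe: "(?d + ?D) * Q $ ?X $ y = ?d * Q0 $ ?X $ y + ?D * Qz ?X $ ?X $ y" for y
  proof -
    have "(?d + ?D) *\<^sub>R Q = ?d *\<^sub>R Q0 + ?D *\<^sub>R Qz ?X"
      unfolding Q_def using ab D by (simp add: scaleR_add_right)
    then have "((?d + ?D) *\<^sub>R Q) $ ?X $ y = (?d *\<^sub>R Q0 + ?D *\<^sub>R Qz ?X) $ ?X $ y" by (rule arg_cong)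
    then show ?thesis by (simp only: vector_scaleR_component vector_add_component real_scaleR_def)
  qed
  have "\<bar>(\<Sum>z\<in>UNIV. k z * E z y) - ((if ?X = y then 1 else 0) + (?d + ?D) * Q $ ?X $ y)\<bar>
      \<le> (?d + ?D) * e + m * (m + 1) * (?d + ?D)\<^sup>2" for y
  proof -
    have A: "\<bar>(\<Sum>z\<in>UNIV. k z * E z y) - (\<Sum>z\<in>UNIV. k z * ((if z = y then 1 else 0) + ?D * Qz z $ z $ y))\<bar>
        \<le> ?D * e + m * (m + 1) * ?D\<^sup>2"
    proof -
      have "\<bar>\<Sum>z\<in>UNIV. k z * (E z y - ((if z = y then 1 else 0) + ?D * Qz z $ z $ y))\<bar>
          \<le> (\<Sum>z\<in>UNIV. k z * (?D * e + m * (m + 1) * ?D\<^sup>2))"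
      proof (intro order_trans[OF sum_abs] sum_mono)
        fix z
        show "\<bar>k z * (E z y - ((if z = y then 1 else 0) + ?D * Qz z $ z $ y))\<bar> \<le> k z * (?D * e + m * (m + 1) * ?D\<^sup>2)"
          unfolding abs_mult abs_of_nonneg[OF kn] by (rule mult_left_mono[OF Qz(2) kn])
      qed
      then show ?thesis by (simp add: right_diff_distrib sum_subtractf sum_distrib_right[symmetric] k1)
    qed
    \<comment> \<open>After a first move the remaining walk follows another row, with entries that
      differ by at most \<open>2 * m\<close>; this matters only on leaving
      \<open>?X\<close>.\<close>
    have "\<bar>(\<Sum>z\<in>UNIV. k z * Qz z $ z $ y) - Qz ?X $ ?X $ y\<bar> \<le> 2 * m * (?d * (m + 1))"
    proof -
      have ent: "\<bar>Qz z $ z $ y\<bar> \<le> m" for z using entry_le Qz(1) H(1) by blast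
      have "(\<Sum>z\<in>UNIV. k z * Qz z $ z $ y) - Qz ?X $ ?X $ y = (\<Sum>z\<in>UNIV. k z * (Qz z $ z $ y - Qz ?X $ ?X $ y))"
        by (simp add: right_diff_distrib sum_subtractf sum_distrib_right[symmetric] k1)
      also have "\<bar>\<dots>\<bar> \<le> (\<Sum>z\<in>UNIV. k z * (if z = ?X then 0 else 2 * m))"
      proof (intro order_trans[OF sum_abs] sum_mono)
        fix z
        have "\<bar>Qz z $ z $ y - Qz ?X $ ?X $ y\<bar> \<le> (if z = ?X then 0 else 2 * m)"
          using ent[of z] ent[of ?X] by auto
        then show "\<bar>k z * (Qz z $ z $ y - Qz ?X $ ?X $ y)\<bar> \<le> k z * (if z = ?X then 0 else 2 * m)"
          using kn by (auto simp: abs_mult intro!: mult_left_mono)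
      qed
      also have "\<dots> = (\<Sum>z\<in>UNIV. 2 * m * k z - (if z = ?X then 2 * m * k z else 0))"
        by (intro sum.cong) auto
      also have "\<dots> = 2 * m * (1 - k ?X)"
        unfolding sum_subtractf sum_distrib_left[symmetric] k1 by (simp add: right_diff_distrib)
      also have "\<dots> \<le> 2 * m * (?d * (m + 1))" using kX m_pos by (intro mult_left_mono) auto
      finally show ?thesis .
    qed
    then have "\<bar>?D * ((\<Sum>z\<in>UNIV. k z * Qz z $ z $ y) - Qz ?X $ ?X $ y)\<bar> \<le> ?D * (2 * m * (?d * (m + 1)))"
      using D by (simp add: abs_mult mult_left_mono)
    moreover have "(\<Sum>z\<in>UNIV. k z * ((if z = y then 1 else 0) + ?D * Qz z $ z $ y))
        = k y + ?D * (\<Sum>z\<in>UNIV. k z * Qz z $ z $ y)"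
    proof -
      have "(\<Sum>z\<in>UNIV. k z * ((if z = y then 1 else 0) + ?D * Qz z $ z $ y))
          = (\<Sum>z\<in>UNIV. (if z = y then k z else 0) + ?D * (k z * Qz z $ z $ y))"
        by (intro sum.cong) (auto simp: algebra_simps)
      then show ?thesis by (simp add: sum.distrib sum_distrib_left)
    qed
    ultimately have "\<bar>(\<Sum>z\<in>UNIV. k z * E z y) - ((if ?X = y then 1 else 0) + (?d + ?D) * Q $ ?X $ y)\<bar>
        \<le> ?D * e + m * (m + 1) * ?D\<^sup>2 + ?D * (2 * m * (?d * (m + 1))) + ?d * e"
      using A Q0(2)[of y] unfolding Qe right_diff_distrib[of ?D] by linarith
    \<comment> \<open>The cross term \<open>2 * m * (m + 1) * ?d * ?D\<close> is just what the
      square of \<open>?d + ?D\<close> allows; hence the constant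
      \<open>m * (m + 1)\<close>.\<close>
    also have "\<dots> = (?d + ?D) * e + m * (m + 1) * (?D\<^sup>2 + 2 * ?D * ?d)" by (simp add: algebra_simps)
    also have "\<dots> \<le> (?d + ?D) * e + m * (m + 1) * (?d + ?D)\<^sup>2"
    proof (intro add_left_mono mult_left_mono)
      have "u\<^sup>2 + 2 * u * v \<le> (v + u)\<^sup>2" for u v :: real by (simp add: power2_sum)
      then show "?D\<^sup>2 + 2 * ?D * ?d \<le> (?d + ?D)\<^sup>2" .
    qed (use m_pos in simp)
    finally show ?thesis .
  qed
  moreover have "measure_pmf.expectation (walk K a (b # bs) x) (\<lambda>x'. indicator {y} (x' (last (a # b # bs))))
      = (\<Sum>z\<in>UNIV. k z * E z y)" for y
    unfolding walk_expectation_Cons by (simp add: k_def E_def)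
  moreover have "last (a # b # bs) - a = ?d + ?D" by simp
  ultimately show ?case using QH by (intro bexI[of _ Q]) (simp_all only: simp_thms)
qed

text \<open>By total boundedness finitely many members of \<open>\<Q>\<close> come within
  \<open>r\<close> of all of it. Their convex hull is compact even if \<open>\<Q>\<close> is not
  closed.\<close>

lemma compact_convex_subset:
  assumes "convex \<Q>" "0 < \<epsilon>"
  shows "\<exists>H\<subseteq>\<Q>. compact H \<and> convex H \<and> H \<noteq> {} \<and>
    (\<forall>W x. infnorm W \<le> B \<longrightarrow> (\<exists>Q\<in>H. (Q *v W) $ x \<le> qlow W $ x + \<epsilon>))"
proof -
  \<comment> \<open>A change of \<open>r\<close> in every entry moves \<open>(Q *v W) $ x\<close> by
    at most \<open>\<epsilon> / 2\<close>; the other half is spent on nearly attaining the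
    infimum.\<close>
  define r where "r = \<epsilon> / (2 * (real CARD('x) * (\<bar>B\<bar> + 1)))"
  have "c * (\<epsilon> / (2 * (c * k))) * k = \<epsilon> / 2" if "0 < c" "0 < k" for c k using that by (simp add: field_simps)
  from this[of "real CARD('x)" "\<bar>B\<bar> + 1"] have r: "0 < r" "real CARD('x) * r * (\<bar>B\<bar> + 1) = \<epsilon> / 2"
    using assms(2) unfolding r_def by (auto simp: add_nonneg_pos)
  have bdd: "bounded \<Q>"
    using entry_le by (intro boundedI[of _ "real CARD('x) * (real CARD('x) * m)"]) (auto intro: norm_le_sum_entries)
  have cover: "closure \<Q> \<subseteq> (\<Union>Q\<in>\<Q>. ball Q r)"
  proof
    fix Q assume "Q \<in> closure \<Q>"
    then obtain Q' where "Q' \<in> \<Q>" "dist Q' Q < r" using r(1) closure_approachable by blast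
    then show "Q \<in> (\<Union>Q\<in>\<Q>. ball Q r)" by auto
  qed
  have "compact (closure \<Q>)" using bdd by simp
  then obtain F where F: "F \<subseteq> \<Q>" "finite F" "closure \<Q> \<subseteq> (\<Union>Q\<in>F. ball Q r)"
    by (rule compactE_image[OF _ _ cover]) auto
  have near: "\<exists>Q'\<in>F. dist Q' Q < r" if "Q \<in> \<Q>" for Q
  proof -
    have "Q \<in> (\<Union>Q\<in>F. ball Q r)" using F(3) that closure_subset[of \<Q>] by blast
    then show ?thesis by (simp add: mem_ball)
  qed
  show ?thesis
  proof (intro exI[of _ "convex hull F"] conjI allI impI)
    show "convex hull F \<subseteq> \<Q>" using F(1) assms(1) by (rule hull_minimal)
    show "compact (convex hull F)" using F(2) by (rule finite_imp_compact_convex_hull)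
    show "convex (convex hull F)" by (rule convex_convex_hull)
    show "convex hull F \<noteq> {}" using near nonempty by fastforce
    fix W :: "real ^ 'x" and x assume W: "infnorm W \<le> B"
    obtain Q where Q: "Q \<in> \<Q>" "(Q *v W) $ x < qlow W $ x + \<epsilon> / 2" using qlow_approx[of "\<epsilon> / 2"] assms(2) by auto
    obtain Q' where Q': "Q' \<in> F" "dist Q' Q < r" using near[OF Q(1)] by blast
    have "\<bar>(Q' - Q) $ x $ y\<bar> \<le> r" for y
    proof -
      have "\<bar>(Q' - Q) $ x $ y\<bar> \<le> norm (Q' - Q)"
        using Finite_Cartesian_Product.norm_nth_le[of "(Q' - Q) $ x" y]
          Finite_Cartesian_Product.norm_nth_le[of "Q' - Q" x] by simp
      then show ?thesis using Q'(2) by (simp add: dist_norm)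
    qed
    then have "\<bar>((Q' - Q) *v W) $ x\<bar> \<le> real CARD('x) * r * infnorm W" by (rule matrix_vector_component_le)
    also have "\<dots> \<le> real CARD('x) * r * (\<bar>B\<bar> + 1)" using W r(1) by (intro mult_left_mono) auto
    finally have "\<bar>(Q' *v W) $ x - (Q *v W) $ x\<bar> \<le> \<epsilon> / 2"
      unfolding r(2) by (simp add: matrix_vector_mult_diff_rdistrib)
    then have "(Q' *v W) $ x \<le> qlow W $ x + \<epsilon>" using Q(2) by linarith
    then show "\<exists>Q\<in>convex hull F. (Q *v W) $ x \<le> qlow W $ x + \<epsilon>"
      using Q'(1) by (intro bexI[of _ Q'] hull_inc)
  qed
qed

end

section \<open>Strictly positive kernels that nearly minimise\<close>

lemma pmf_mix_uniform:
  fixes f :: "'x::finite \<Rightarrow> real"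
  assumes f: "\<And>y. 0 \<le> f y" "(\<Sum>y\<in>UNIV. f y) = 1" and \<eta>: "0 < \<eta>" "\<eta> \<le> 1"
  shows "\<exists>p. \<forall>y. 0 < pmf p y \<and> \<bar>pmf p y - f y\<bar> \<le> \<eta>"
proof -
  define n where "n = real CARD('x)"
  have n: "1 \<le> n" using zero_less_card_finite[where 'a='x] by (simp add: n_def)
  \<comment> \<open>The uniform part makes all values positive; it changes each by
    \<open>\<eta> * (1 / n - f y)\<close>, which is at most \<open>\<eta>\<close> in
    modulus.\<close>
  define h where "h y = (1 - \<eta>) * f y + \<eta> / n" for y
  have hpos: "0 < h y" for y using f(1)[of y] \<eta> n by (simp add: h_def add_nonneg_pos)
  have "(\<Sum>y\<in>UNIV. h y) = (1 - \<eta>) * (\<Sum>y\<in>UNIV. f y) + n * (\<eta> / n)"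
    by (simp add: h_def sum.distrib sum_distrib_left n_def)
  then have h1: "(\<Sum>y\<in>UNIV. h y) = 1" using f(2) n by simp
  have "(\<integral>\<^sup>+y. ennreal (h y) \<partial>count_space UNIV) = 1"
    using h1 hpos by (simp add: nn_integral_count_space_finite less_imp_le)
  then have p: "pmf (embed_pmf h) y = h y" for y
    using hpos by (intro pmf_embed_pmf) (auto simp: less_imp_le)
  have f_le: "f y \<le> 1" for y using member_le_sum[of y UNIV f] f by simp
  have "\<bar>h y - f y\<bar> \<le> \<eta>" for y
  proof -
    have "h y - f y = \<eta> * (1 / n - f y)" by (simp add: h_def algebra_simps)
    moreover have "0 \<le> 1 / n" "1 / n \<le> 1" using n by simp_all
    then have "\<bar>1 / n - f y\<bar> \<le> 1" using f(1)[of y] f_le[of y] by linarith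
    ultimately show ?thesis using \<eta>(1) by (simp add: abs_mult)
  qed
  then show ?thesis using hpos p by (intro exI[of _ "embed_pmf h"]) auto
qed

lemma (in rate_set) kernel_exists:
  fixes W :: "real ^ 'x"
  assumes H: "H \<subseteq> \<Q>" and approx: "\<exists>Q\<in>H. (Q *v W) $ x \<le> qlow W $ x + \<epsilon>"
    and W: "infnorm W \<le> B" and \<eta>: "0 < \<eta>" "\<eta> \<le> 1" and d: "0 < d" "d * M \<le> 1" "d \<le> 1"
  shows "\<exists>p. (\<forall>y. 0 < pmf p y) \<and>
    (\<exists>Q\<in>H. \<forall>y. \<bar>pmf p y - ((if x = y then 1 else 0) + d * Q $ x $ y)\<bar> \<le> d * \<eta>) \<and>
    (\<Sum>y\<in>UNIV. pmf p y * W $ y) \<le> W $ x + d * (qlow W $ x + (\<epsilon> + real CARD('x) * \<eta> * B))"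
proof -
  obtain Q where Q: "Q \<in> H" "(Q *v W) $ x \<le> qlow W $ x + \<epsilon>" using approx by blast
  then have QQ: "Q \<in> \<Q>" using H by blast
  define f where "f y = (if x = y then 1 else 0) + d * Q $ x $ y" for y
  have f0: "0 \<le> f y" for y unfolding f_def using d by (intro step_nonneg QQ) auto
  have "(\<Sum>y\<in>UNIV. Q $ x $ y) = 0" using QQ rate by (auto simp: rate_matrices_def)
  then have f1: "(\<Sum>y\<in>UNIV. f y) = 1"
    by (simp add: f_def sum.distrib sum_distrib_left[symmetric])
  \<comment> \<open>The weight of the uniform distribution is \<open>d * \<eta>\<close>, so that its
    effect is small relative to the step length.\<close>
  have "d * \<eta> \<le> 1 * 1" using d \<eta> by (intro mult_mono) auto
  then obtain p where p: "\<And>y. 0 < pmf p y" "\<And>y. \<bar>pmf p y - f y\<bar> \<le> d * \<eta>"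
    using pmf_mix_uniform[of f "d * \<eta>", OF f0 f1] d \<eta> by auto
  have "(\<Sum>y\<in>UNIV. pmf p y * W $ y) - (\<Sum>y\<in>UNIV. f y * W $ y) = (\<Sum>y\<in>UNIV. (pmf p y - f y) * W $ y)"
    by (simp add: left_diff_distrib sum_subtractf)
  also have "\<dots> \<le> (\<Sum>y\<in>(UNIV :: 'x set). d * \<eta> * B)"
  proof (rule sum_mono)
    fix y
    have "\<bar>W $ y\<bar> \<le> B" using W by (simp add: infnorm_le_cart_iff)
    then have "\<bar>pmf p y - f y\<bar> * \<bar>W $ y\<bar> \<le> d * \<eta> * B" using p(2) d \<eta> by (intro mult_mono) auto
    then show "(pmf p y - f y) * W $ y \<le> d * \<eta> * B" by (metis abs_mult abs_ge_self order_trans)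
  qed
  finally have 1: "(\<Sum>y\<in>UNIV. pmf p y * W $ y) \<le> (\<Sum>y\<in>UNIV. f y * W $ y) + d * (real CARD('x) * \<eta> * B)"
    by (simp add: mult_ac)
  have "(\<Sum>y\<in>UNIV. f y * W $ y) = (\<Sum>y\<in>UNIV. (if x = y then W $ y else 0) + d * (Q $ x $ y * W $ y))"
    by (intro sum.cong) (auto simp: f_def algebra_simps)
  also have "\<dots> = W $ x + d * (Q *v W) $ x"
    by (simp add: sum.distrib sum_distrib_left[symmetric] matrix_vector_mult_def)
  also have "\<dots> \<le> W $ x + d * (qlow W $ x + \<epsilon>)" using Q(2) d by simp
  finally have "(\<Sum>y\<in>UNIV. pmf p y * W $ y) \<le> W $ x + d * (qlow W $ x + (\<epsilon> + real CARD('x) * \<eta> * B))"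
    using 1 by (simp add: distrib_left)
  then show ?thesis using p(1) Q(1) p(2)[unfolded f_def] by (intro exI[of _ p] conjI allI bexI[of _ Q])
qed

text \<open>The walk starts at \<open>hd l\<close> from a constant path, whose value there is the
  initial state and elsewhere a placeholder until the time is visited.\<close>

definition law :: "'x pmf \<Rightarrow> (real \<Rightarrow> real \<Rightarrow> (real \<Rightarrow> 'x) \<Rightarrow> 'x pmf) \<Rightarrow> real list \<Rightarrow> (real \<Rightarrow> 'x) pmf" where
  "law p0 K l = bind_pmf p0 (\<lambda>y. walk K (hd l) (tl l) (\<lambda>_. y))"

text \<open>The counterpart of \<open>tuple_event\<close> without \<open>\<Omega>\<close>: paths of
  a walk are arbitrary functions and need not lie in \<open>\<Omega>\<close>.\<close>

definition cylinder :: "real set \<Rightarrow> (real \<Rightarrow> 'x) \<Rightarrow> (real \<Rightarrow> 'x) set" where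
  "cylinder u z = {x. \<forall>t\<in>u. x t = z t}"

section \<open>Laws on a grid, conditioned on part of the history\<close>

lemma finite_set_law: "finite (set_pmf (law p0 K l :: (real \<Rightarrow> 'x::finite) pmf))"
  by (simp add: law_def finite_set_walk)

lemma law_append: "law p0 K (ys @ t # cs) = bind_pmf (law p0 K (ys @ [t])) (walk K t cs)"
proof (cases ys)
  case Nil then show ?thesis by (simp add: law_def bind_assoc_pmf bind_return_pmf)
next
  case (Cons a ys')
  have "walk K a (ys' @ t # cs) x = bind_pmf (walk K a (ys' @ [t]) x) (walk K t cs)" for x
    using walk_append[of K a "ys' @ [t]" cs x] by simp
  then show ?thesis by (simp add: Cons law_def bind_assoc_pmf)
qed

lemma expectation_bind_finite:
  fixes g :: "'b \<Rightarrow> real"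
  assumes "finite (set_pmf p)" "\<And>x. finite (set_pmf (k x))"
  shows "measure_pmf.expectation (bind_pmf p k) g =
    (\<Sum>x\<in>set_pmf p. pmf p x * measure_pmf.expectation (k x) g)"
  using pmf_expectation_bind[of "set_pmf p" k p g] assms by simp

text \<open>The steps over \<open>cs\<close> leave the times in \<open>u\<close> untouched, so the
  cylinder is decided by the path up to \<open>t\<close> and comes out as a factor.\<close>

lemma expectation_law_append:
  fixes G :: "(real \<Rightarrow> 'x::finite) \<Rightarrow> real"
  assumes "u \<inter> set cs = {}"
  shows "measure_pmf.expectation (law p0 K (ys @ t # cs)) (\<lambda>x. indicator (cylinder u z) x * G x) =
    (\<Sum>x\<in>set_pmf (law p0 K (ys @ [t])). pmf (law p0 K (ys @ [t])) x * indicator (cylinder u z) x *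
      measure_pmf.expectation (walk K t cs x) G)"
proof -
  have "measure_pmf.expectation (walk K t cs x) (\<lambda>x. indicator (cylinder u z) x * G x) =
      indicator (cylinder u z) x * measure_pmf.expectation (walk K t cs x) G" for x
  proof -
    have "x' \<in> cylinder u z \<longleftrightarrow> x \<in> cylinder u z" if "x' \<in> set_pmf (walk K t cs x)" for x'
    proof -
      have "x' r = x r" if "r \<in> u" for r
        using walk_unchanged[OF \<open>x' \<in> set_pmf (walk K t cs x)\<close>, of r] that assms by blast
      then show ?thesis by (simp add: cylinder_def)
    qed
    then have "measure_pmf.expectation (walk K t cs x) (\<lambda>x. indicator (cylinder u z) x * G x) =
        measure_pmf.expectation (walk K t cs x) (\<lambda>x'. indicator (cylinder u z) x * G x')"
      by (intro integral_cong_AE) (auto simp: AE_measure_pmf_iff indicator_def)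
    then show ?thesis by simp
  qed
  then show ?thesis
    unfolding law_append[of p0 K ys t cs]
    by (subst expectation_bind_finite) (auto simp: finite_set_law finite_set_walk mult.assoc)
qed

lemma expectation_walk_append:
  fixes G :: "(real \<Rightarrow> 'x::finite) \<Rightarrow> real"
  assumes "\<And>x x'. (\<And>r. r \<notin> set cs \<Longrightarrow> x r = x' r) \<Longrightarrow> G x = G x'"
  shows "measure_pmf.expectation (walk K t (bs @ cs) x) G = measure_pmf.expectation (walk K t bs x) G"
proof -
  have "measure_pmf.expectation (walk K r cs z) G = G z" for r z
  proof -
    have "measure_pmf.expectation (walk K r cs z) G = measure_pmf.expectation (walk K r cs z) (\<lambda>_. G z)"
    proof (rule integral_cong_AE)
      show "AE x' in walk K r cs z. G x' = G z"
        unfolding AE_measure_pmf_iff using walk_unchanged by (intro ballI assms) blast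
    qed auto
    then show ?thesis by simp
  qed
  then have "measure_pmf.expectation (walk K t (bs @ cs) x) G =
      (\<Sum>z\<in>set_pmf (walk K t bs x). pmf (walk K t bs x) z * G z)"
    unfolding walk_append by (subst expectation_bind_finite) (auto simp: finite_set_walk)
  also have "\<dots> = measure_pmf.expectation (walk K t bs x) G"
    by (subst integral_measure_pmf_real[of "set_pmf (walk K t bs x)"]) (auto simp: finite_set_walk mult.commute)
  finally show ?thesis .
qed

text \<open>Conditioning on part of the history averages over the complete histories compatible with
  it. Each has its own member of \<open>H\<close>, and convexity supplies one for the
  average.\<close>

lemma weighted_average_row:
  fixes H :: "(real ^ 'x::finite ^ 'x) set"
  assumes "finite Z" "convex H" and w: "\<And>z. z \<in> Z \<Longrightarrow> 0 \<le> w z" and D: "0 < (\<Sum>z\<in>Z. w z)"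
    and Q: "\<And>z. z \<in> Z \<Longrightarrow> w z \<noteq> 0 \<Longrightarrow> \<exists>Q\<in>H. \<forall>y. \<bar>E z y - (\<alpha> y + \<beta> * Q $ x $ y)\<bar> \<le> err"
  shows "\<exists>Q\<in>H. \<forall>y. \<bar>(\<Sum>z\<in>Z. w z * E z y) / (\<Sum>z\<in>Z. w z) - (\<alpha> y + \<beta> * Q $ x $ y)\<bar> \<le> err"
proof -
  \<comment> \<open>Terms of weight zero are discarded, since the hypothesis gives them no member of
    \<open>H\<close>.\<close>
  define Z' where "Z' = {z \<in> Z. w z \<noteq> 0}"
  have Z': "finite Z'" "\<And>h. (\<Sum>z\<in>Z'. w z * h z) = (\<Sum>z\<in>Z. w z * h z)"
    using assms(1) by (auto simp: Z'_def intro!: sum.mono_neutral_left)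
  have DZ: "(\<Sum>z\<in>Z'. w z) = (\<Sum>z\<in>Z. w z)" using Z'(2)[of "\<lambda>_. 1"] by simp
  define c where "c z = w z / (\<Sum>z\<in>Z. w z)" for z
  have c: "\<And>z. z \<in> Z' \<Longrightarrow> 0 \<le> c z" "(\<Sum>z\<in>Z'. c z) = 1"
    using w D DZ by (auto simp: c_def Z'_def sum_divide_distrib[symmetric] less_imp_le)
  have "\<forall>z\<in>Z'. \<exists>Q\<in>H. \<forall>y. \<bar>E z y - (\<alpha> y + \<beta> * Q $ x $ y)\<bar> \<le> err" using Q by (auto simp: Z'_def)
  then obtain Qz where Qz: "\<And>z. z \<in> Z' \<Longrightarrow> Qz z \<in> H"
    "\<And>z y. z \<in> Z' \<Longrightarrow> \<bar>E z y - (\<alpha> y + \<beta> * Qz z $ x $ y)\<bar> \<le> err" by metis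
  have "(\<Sum>z\<in>Z'. c z *\<^sub>R Qz z) \<in> H" using Z'(1) assms(2) c Qz(1) by (intro convex_sum) auto
  moreover have "\<bar>(\<Sum>z\<in>Z. w z * E z y) / (\<Sum>z\<in>Z. w z) - (\<alpha> y + \<beta> * (\<Sum>z\<in>Z'. c z *\<^sub>R Qz z) $ x $ y)\<bar> \<le> err" for y
  proof -
    have "(\<Sum>z\<in>Z. w z * E z y) / (\<Sum>z\<in>Z. w z) = (\<Sum>z\<in>Z'. c z * E z y)"
      unfolding Z'(2)[symmetric] by (simp add: c_def sum_divide_distrib)
    moreover have "\<alpha> y + \<beta> * (\<Sum>z\<in>Z'. c z *\<^sub>R Qz z) $ x $ y = (\<Sum>z\<in>Z'. c z * (\<alpha> y + \<beta> * Qz z $ x $ y))"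
    proof -
      have "(\<Sum>z\<in>Z'. c z * (\<alpha> y + \<beta> * Qz z $ x $ y)) = (\<Sum>z\<in>Z'. c z) * \<alpha> y + \<beta> * (\<Sum>z\<in>Z'. c z * Qz z $ x $ y)"
        by (simp add: distrib_left sum.distrib sum_distrib_right sum_distrib_left mult_ac)
      then show ?thesis by (simp add: c(2))
    qed
    ultimately have "(\<Sum>z\<in>Z. w z * E z y) / (\<Sum>z\<in>Z. w z) - (\<alpha> y + \<beta> * (\<Sum>z\<in>Z'. c z *\<^sub>R Qz z) $ x $ y)
        = (\<Sum>z\<in>Z'. c z * (E z y - (\<alpha> y + \<beta> * Qz z $ x $ y)))"
      by (simp add: right_diff_distrib sum_subtractf)
    also have "\<bar>\<dots>\<bar> \<le> (\<Sum>z\<in>Z'. c z * err)"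
      using Qz(2) c(1) by (intro order_trans[OF sum_abs] sum_mono) (auto simp: abs_mult intro!: mult_left_mono)
    also have "\<dots> = err" by (simp add: sum_distrib_right[symmetric] c(2))
    finally show ?thesis .
  qed
  ultimately show ?thesis by blast
qed

lemma viter_agree:
  "(\<And>x x'. (\<forall>t\<in>w \<union> set ss. x t = x' t) \<Longrightarrow> g x = g x') \<Longrightarrow> \<forall>t\<in>w. x t = x' t \<Longrightarrow> a \<in> w \<Longrightarrow>
    viter q a ss g x = viter q a ss g x'"
proof (induction ss arbitrary: w a x x')
  case (Cons s ss)
  have "viter q s ss g (x(s := y)) = viter q s ss g (x'(s := y))" for y
  proof (rule Cons.IH)
    show "\<forall>t\<in>insert s w. (x(s := y)) t = (x'(s := y)) t" using Cons.prems(2) by simp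
    show "g x = g x'" if "\<forall>t\<in>insert s w \<union> set ss. x t = x' t" for x x'
      using that by (intro Cons.prems(1)) simp
  qed simp
  then show ?case using Cons.prems(2,3) by simp
qed simp

lemma measure_law_cylinder_pos:
  fixes l :: "real list"
  assumes K: "\<And>a b x (y :: 'x::finite). 0 < pmf (K a b x) y" and p0: "\<And>y. 0 < pmf p0 y"
    and l: "l \<noteq> []" "distinct l" "u \<subseteq> set l"
  shows "0 < measure (law p0 K l) (cylinder u z)"
proof -
  obtain a bs where ab: "l = a # bs" using l(1) by (cases l) auto
  obtain x where x: "x \<in> set_pmf (walk K a bs (\<lambda>_. z a))" "\<forall>t\<in>set bs. x t = z t"
    using walk_reach[of K bs a "\<lambda>_. z a" z] K l(2) ab by auto
  have "x a = z a" using walk_unchanged[OF x(1), of a] l(2) ab by simp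
  then have "x \<in> cylinder u z" using x(2) l(3) by (auto simp: cylinder_def ab)
  moreover have "z a \<in> set_pmf p0" using p0[of "z a"] by (simp add: set_pmf_iff)
  then have "x \<in> set_pmf (law p0 K l)" using x(1) by (auto simp: law_def ab)
  ultimately show ?thesis by (intro measure_pmf_posI)
qed

lemma measure_law_hd:
  assumes "distinct (a # bs)"
  shows "measure (law p0 K (a # bs)) {x. x a = y} = pmf p0 y"
proof -
  have "map_pmf (\<lambda>x. x a) (walk K a bs (\<lambda>_. y)) = return_pmf y" for y
  proof -
    have "map_pmf (\<lambda>x. x a) (walk K a bs (\<lambda>_. y)) = map_pmf (\<lambda>_. y) (walk K a bs (\<lambda>_. y))"
    proof (rule map_pmf_cong[OF refl])
      fix x assume "x \<in> set_pmf (walk K a bs (\<lambda>_. y))"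
      then show "x a = y" using walk_unchanged[of x K a bs "\<lambda>_. y" a] assms by simp
    qed
    then show ?thesis by simp
  qed
  then have "map_pmf (\<lambda>x. x a) (law p0 K (a # bs)) = p0"
    by (simp add: law_def map_bind_pmf bind_return_pmf')
  then have "pmf p0 y = measure (map_pmf (\<lambda>x. x a) (law p0 K (a # bs))) {y}" by (simp add: measure_pmf_single)
  also have "\<dots> = measure (law p0 K (a # bs)) {x. x a = y}" by (simp add: vimage_def)
  finally show ?thesis by simp
qed

context rate_set
begin

text \<open>The grid is split at \<open>t\<close> and \<open>t'\<close>: complete histories up to
  \<open>t\<close> contribute their probabilities as weights, \<open>walk_row_estimate\<close>
  treats the piece between, and the grid beyond \<open>t'\<close> has no influence.\<close>

lemma law_row_estimate:
  assumes H: "H \<subseteq> \<Q>" "convex H" "H \<noteq> {}" and e: "0 \<le> e" "e \<le> 1"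
    and K: "\<And>a b x. a < b \<Longrightarrow> b - a \<le> d \<Longrightarrow>
      \<exists>Q\<in>H. \<forall>y. \<bar>pmf (K a b x) y - ((if x a = y then 1 else 0) + (b - a) * Q $ x a $ y)\<bar> \<le> (b - a) * e"
    and l: "sorted_wrt (<) l" "mesh l \<le> d"
    and t: "t \<in> set l" "t' \<in> set l" "t < t'" and u: "t \<in> u" "\<forall>r\<in>u. r \<le> t"
    and pos: "0 < measure (law p0 K l) (cylinder u z)"
  shows "\<exists>Q\<in>H. \<forall>y. \<bar>measure (law p0 K l) (cylinder u z \<inter> {x. x t' = y}) / measure (law p0 K l) (cylinder u z)
      - ((if z t = y then 1 else 0) + (t' - t) * Q $ z t $ y)\<bar> \<le> (t' - t) * e + m * (m + 1) * (t' - t)\<^sup>2"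
proof -
  obtain ys cs where l1: "l = ys @ t # cs" using t(1) by (auto dest: split_list)
  have "t' \<in> set cs" using t(2,3) l(1) by (auto simp: l1 sorted_wrt_append)
  then obtain cs1 cs2 where cs: "cs = cs1 @ t' # cs2" by (auto dest: split_list)
  have srt: "sorted_wrt (<) (t # cs1 @ [t'])" using l(1) by (simp add: l1 cs sorted_wrt_append)
  have msh: "mesh (t # cs1 @ [t']) \<le> d"
    using l(2) mesh_append[of ys t cs] mesh_append[of "t # cs1" t' cs2] by (simp add: l1 cs)
  have uc: "u \<inter> set cs = {}" using u(2) l(1) by (force simp: l1 sorted_wrt_append)
  have t'c: "t' \<notin> set cs2" using l(1) by (auto simp: l1 cs sorted_wrt_append)
  define \<nu> where "\<nu> = law p0 K (ys @ [t])"
  define E :: "(real \<Rightarrow> 'x) \<Rightarrow> 'x \<Rightarrow> real"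
    where "E x y = measure_pmf.expectation (walk K t (cs1 @ [t']) x) (\<lambda>x'. indicator {y} (x' t'))" for x y
  have Ecs: "measure_pmf.expectation (walk K t cs x) (\<lambda>x'. indicator {y} (x' t')) = E x y" for x y
    unfolding E_def cs using expectation_walk_append[of cs2 "\<lambda>x'. indicator {y} (x' t')" K t "cs1 @ [t']" x] t'c by simp
  define wt where "wt x = pmf \<nu> x * indicator (cylinder u z) x" for x
  have num: "measure (law p0 K l) (cylinder u z \<inter> {x. x t' = y}) = (\<Sum>x\<in>set_pmf \<nu>. wt x * E x y)" for y
  proof -
    have "measure (law p0 K l) (cylinder u z \<inter> {x. x t' = y}) =
        measure_pmf.expectation (law p0 K l) (\<lambda>x. indicator (cylinder u z) x * indicator {y} (x t'))"
    proof -
      have "(\<lambda>x. indicator (cylinder u z) x * indicator {y} (x t') :: real) = indicator (cylinder u z \<inter> {x. x t' = y})"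
        by (auto simp: fun_eq_iff indicator_def)
      then show ?thesis by simp
    qed
    then show ?thesis unfolding l1 expectation_law_append[OF uc] by (simp add: wt_def \<nu>_def Ecs)
  qed
  have den: "measure (law p0 K l) (cylinder u z) = (\<Sum>x\<in>set_pmf \<nu>. wt x)"
    using expectation_law_append[OF uc, of p0 K ys t z "\<lambda>_. 1"] by (simp add: l1 wt_def \<nu>_def)
  have "\<exists>Q\<in>H. \<forall>y. \<bar>(\<Sum>x\<in>set_pmf \<nu>. wt x * E x y) / (\<Sum>x\<in>set_pmf \<nu>. wt x)
      - ((if z t = y then 1 else 0) + (t' - t) * Q $ z t $ y)\<bar> \<le> (t' - t) * e + m * (m + 1) * (t' - t)\<^sup>2"
  proof (rule weighted_average_row)
    show "finite (set_pmf \<nu>)" by (simp add: \<nu>_def finite_set_law)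
    show "0 < (\<Sum>x\<in>set_pmf \<nu>. wt x)" using pos den by simp
    fix x assume "wt x \<noteq> 0"
    then have "x t = z t" using u(1) by (auto simp: wt_def cylinder_def indicator_def split: if_splits)
    then show "\<exists>Q\<in>H. \<forall>y. \<bar>E x y - ((if z t = y then 1 else 0) + (t' - t) * Q $ z t $ y)\<bar>
        \<le> (t' - t) * e + m * (m + 1) * (t' - t)\<^sup>2"
      using walk_row_estimate[where H=H and K=K and d=d and e=e, OF H e K srt msh, of x] by (simp add: E_def)
  qed (simp_all add: wt_def H)
  then show ?thesis unfolding num den .
qed

lemma law_expectation_le_viter:
  assumes B: "\<And>x. \<bar>g x\<bar> \<le> B" and d: "d * M \<le> 1" and l: "sorted_wrt (<) l" "mesh l \<le> d"
    and u: "u \<subseteq> set l" "u \<noteq> {}" and v: "v \<subseteq> set l" "v \<noteq> {}" and uv: "\<forall>r\<in>u. \<forall>s\<in>v. r < s"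
    and g: "\<And>x x'. \<forall>t\<in>u \<union> v. x t = x' t \<Longrightarrow> g x = g x'" and e: "0 \<le> e"
    and K: "\<And>a b x W. a < b \<Longrightarrow> b - a \<le> d \<Longrightarrow>
      W = (\<chi> y. viter qlow b (filter (\<lambda>r. b < r) (filter (\<lambda>r. r \<le> Max v) l)) g (x(b := y))) \<Longrightarrow>
      (\<Sum>y\<in>UNIV. pmf (K a b x) y * W $ y) \<le> W $ x a + (b - a) * (qlow W $ x a + e)"
  shows "measure_pmf.expectation (law p0 K l) (\<lambda>x. indicator (cylinder u z) x * g x) \<le>
    measure (law p0 K l) (cylinder u z) *
      (viter qlow (Max u) (sorted_list_of_set v) g z + (Max v - Max u) * (e + M\<^sup>2 * d * B))"
proof -
  define t where "t = Max u"
  define s where "s = Max v"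
  have fin: "finite u" "finite v" using u v by (auto intro: finite_subset)
  have t: "t \<in> u" "\<And>r. r \<in> u \<Longrightarrow> r \<le> t" and s: "s \<in> v" "\<And>r. r \<in> v \<Longrightarrow> r \<le> s"
    using fin u v by (auto simp: t_def s_def)
  have ts: "t < s" using uv t s by blast
  obtain ys cs where l1: "l = ys @ t # cs" using t(1) u(1) by (meson split_list subsetD)
  have "s \<in> set l" using s(1) v(1) by blast
  then have "s \<in> set cs" using ts l(1) by (auto simp: l1 sorted_wrt_append)
  then obtain cs1 cs2 where cs: "cs = cs1 @ s # cs2" by (auto dest: split_list)
  have srt: "sorted_wrt (<) (t # cs1 @ [s])" using l(1) by (simp add: l1 cs sorted_wrt_append)
  have msh: "mesh (t # cs1 @ [s]) \<le> d"
    using l(2) mesh_append[of ys t cs] mesh_append[of "t # cs1" s cs2] by (simp add: l1 cs)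
  have uc: "u \<inter> set cs = {}" using t(2) l(1) by (force simp: l1 sorted_wrt_append)
  have uvc: "(u \<union> v) \<inter> set cs2 = {}"
  proof -
    have "s < r" "t < r" if "r \<in> set cs2" for r using that l(1) by (auto simp: l1 cs sorted_wrt_append)
    then show ?thesis using s(2) t(2) by force
  qed
  \<comment> \<open>Control is planned on the grid up to \<open>s\<close> only, so that the
    accumulated error is proportional to \<open>s - t\<close> and not to the length of the
    grid.\<close>
  define l' where "l' = filter (\<lambda>r. r \<le> s) l"
  have l'srt: "sorted_wrt (<) l'" unfolding l'_def using l(1) by (rule sorted_wrt_filter)
  have fl': "filter (\<lambda>r. t < r) l' = cs1 @ [s]"
  proof -
    have "\<forall>r\<in>set ys. r < t" "\<forall>r\<in>set cs1. t < r \<and> r < s" "\<forall>r\<in>set cs2. s < r"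
      using l(1) by (auto simp: l1 cs sorted_wrt_append)
    then have "filter (\<lambda>r. t < r) (filter (\<lambda>r. r \<le> s) ys) = []"
      "filter (\<lambda>r. t < r) (filter (\<lambda>r. r \<le> s) cs1) = cs1" "filter (\<lambda>r. r \<le> s) cs2 = []"
      by (auto simp: filter_empty_conv intro!: filter_True)
    then show ?thesis using ts by (simp add: l'_def l1 cs)
  qed
  \<comment> \<open>This lets \<open>viter_filter\<close> remove the grid points outside
    \<open>v\<close> again.\<close>
  have sl: "filter (\<lambda>b. b \<in> v) (cs1 @ [s]) = sorted_list_of_set v"
  proof (rule strict_sorted_equal)
    show "sorted_wrt (<) (filter (\<lambda>b. b \<in> v) (cs1 @ [s]))"
      using srt by (intro sorted_wrt_filter) simp
    show "sorted_wrt (<) (sorted_list_of_set v)" by (rule strict_sorted_list_of_set)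
    have "r \<in> set (cs1 @ [s])" if "r \<in> v" for r
    proof -
      have "r \<in> set l" "t < r" "r \<le> s" using that v(1) uv t(1) s(2) by auto
      then have "r \<in> set (filter (\<lambda>r. t < r) l')" by (simp add: l'_def)
      then show ?thesis unfolding fl' .
    qed
    then show "set (filter (\<lambda>b. b \<in> v) (cs1 @ [s])) = set (sorted_list_of_set v)" using fin by auto
  qed
  have gupd: "g (x(b := y)) = g x" if "b \<in> set (cs1 @ [s])" "b \<notin> v" for b x y
  proof (rule g)
    have "b \<notin> u" using that uc cs by auto
    then show "\<forall>t\<in>u \<union> v. (x(b := y)) t = x t" using that(2) by auto
  qed
  let ?c = "(s - t) * (e + M\<^sup>2 * d * B)"
  have est: "measure_pmf.expectation (walk K t cs x) g \<le> viter qlow t (sorted_list_of_set v) g z + ?c"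
    if x: "x \<in> cylinder u z" for x
  proof -
    have "measure_pmf.expectation (walk K t cs x) g = measure_pmf.expectation (walk K t (cs1 @ [s]) x) g"
    proof -
      have "cs = (cs1 @ [s]) @ cs2" by (simp add: cs)
      moreover have "measure_pmf.expectation (walk K t ((cs1 @ [s]) @ cs2) x) g
          = measure_pmf.expectation (walk K t (cs1 @ [s]) x) g"
      proof (rule expectation_walk_append, rule g, rule ballI)
        fix x x' :: "real \<Rightarrow> 'x" and r
        assume agree: "\<And>r. r \<notin> set cs2 \<Longrightarrow> x r = x' r" and "r \<in> u \<union> v"
        then have "r \<notin> set cs2" using uvc by blast
        then show "x r = x' r" by (rule agree)
      qed
      ultimately show ?thesis by (simp only:)
    qed
    also have "\<dots> \<le> viter qlow t (cs1 @ [s]) g x + (last (t # cs1 @ [s]) - t) * (e + M\<^sup>2 * d * B)"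
    proof (rule walk_expectation_le_viter[where l=l' and B=B and d=d])
      show "(\<Sum>y\<in>UNIV. pmf (K a b x) y * W $ y) \<le> W $ x a + (b - a) * (qlow W $ x a + e)"
        if "a < b" "b - a \<le> d" "W = (\<chi> y. viter qlow b (filter (\<lambda>r. b < r) l') g (x(b := y)))" for a b x W
        using that(3) unfolding l'_def s_def by (rule K[OF that(1,2)])
    qed (fact l'srt B d srt msh fl')+
    also have "viter qlow t (cs1 @ [s]) g x = viter qlow t (sorted_list_of_set v) g x"
      unfolding sl[symmetric] using srt gupd by (rule viter_filter)
    also have "\<dots> = viter qlow t (sorted_list_of_set v) g z"
      using x t(1) fin g by (intro viter_agree[of u]) (auto simp: cylinder_def)
    finally show ?thesis by simp
  qed
  define \<nu> where "\<nu> = law p0 K (ys @ [t])"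
  have "measure_pmf.expectation (law p0 K l) (\<lambda>x. indicator (cylinder u z) x * g x) =
      (\<Sum>x\<in>set_pmf \<nu>. pmf \<nu> x * indicator (cylinder u z) x * measure_pmf.expectation (walk K t cs x) g)"
    unfolding l1 \<nu>_def by (rule expectation_law_append[OF uc])
  also have "\<dots> \<le> (\<Sum>x\<in>set_pmf \<nu>. pmf \<nu> x * indicator (cylinder u z) x * (viter qlow t (sorted_list_of_set v) g z + ?c))"
  proof (rule sum_mono)
    fix x
    show "pmf \<nu> x * indicator (cylinder u z) x * measure_pmf.expectation (walk K t cs x) g
        \<le> pmf \<nu> x * indicator (cylinder u z) x * (viter qlow t (sorted_list_of_set v) g z + ?c)"
      using est[of x] by (cases "x \<in> cylinder u z") (auto intro!: mult_left_mono)
  qed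
  also have "\<dots> = (\<Sum>x\<in>set_pmf \<nu>. pmf \<nu> x * indicator (cylinder u z) x) * (viter qlow t (sorted_list_of_set v) g z + ?c)"
    by (simp add: sum_distrib_right)
  also have "(\<Sum>x\<in>set_pmf \<nu>. pmf \<nu> x * indicator (cylinder u z) x) = measure (law p0 K l) (cylinder u z)"
    using expectation_law_append[OF uc, of p0 K ys t z "\<lambda>_. 1"] by (simp add: l1 \<nu>_def)
  finally show ?thesis unfolding t_def s_def .
qed

end

section \<open>Limits of discrete-time processes\<close>

abbreviation cond_prob :: "'a pmf \<Rightarrow> 'a set \<times> 'a set \<Rightarrow> real" where
  "cond_prob \<mu> p \<equiv> measure \<mu> (fst p \<inter> snd p) / measure \<mu> (snd p)"

lemma cond_prob_bounds: "0 \<le> cond_prob \<mu> p" "cond_prob \<mu> p \<le> 1"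
proof -
  have "measure \<mu> (fst p \<inter> snd p) \<le> measure \<mu> (snd p)"
    by (intro measure_pmf.finite_measure_mono) auto
  then show "cond_prob \<mu> p \<le> 1" using measure_nonneg[of \<mu> "snd p"] by (simp add: divide_le_eq)
qed simp

lemma frequently_eventually_ex:
  assumes "frequently P F" "eventually Q F"
  shows "\<exists>x. P x \<and> Q x"
proof (rule ccontr)
  assume "\<not> (\<exists>x. P x \<and> Q x)"
  then have "eventually (\<lambda>x. \<not> P x) F" using assms(2) by (auto elim: eventually_mono)
  then show False using assms(1) by (simp add: frequently_def)
qed

text \<open>Tychonoff for a power of the unit interval. Clustering is expressed by
  \<open>frequently\<close> on finitely many coordinates, which suffices because each later
  inequality involves only finitely many of them.\<close>

lemma cluster_point_exists:
  fixes R :: "'i \<Rightarrow> 'p \<Rightarrow> real"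
  assumes "F \<noteq> bot" and R: "\<And>i p. R i p \<in> {0..1}"
  shows "\<exists>P. \<forall>D e. finite D \<longrightarrow> 0 < e \<longrightarrow> frequently (\<lambda>i. \<forall>p\<in>D. \<bar>P p - R i p\<bar> < e) F"
proof -
  define S :: "('p \<Rightarrow> real) set" where "S = PiE UNIV (\<lambda>_. {0..1})"
  have "compactin (product_topology (\<lambda>_. euclidean) UNIV) S"
    unfolding S_def by (subst compactin_PiE) (auto simp: compactin_euclidean_iff)
  then have "compact S" unfolding euclidean_product_topology by (simp add: compactin_euclidean_iff)
  moreover have "filtermap R F \<noteq> bot" using assms(1) by (simp add: filtermap_bot_iff)
  moreover have "eventually (\<lambda>x. x \<in> S) (filtermap R F)"
    unfolding eventually_filtermap S_def using R by (intro always_eventually) auto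
  ultimately obtain P where P: "inf (nhds P) (filtermap R F) \<noteq> bot"
    using compact_filter[of S] by blast
  have "frequently (\<lambda>i. \<forall>p\<in>D. \<bar>P p - R i p\<bar> < e) F" if D: "finite D" "0 < e" for D e
  proof (rule ccontr)
    assume "\<not> frequently (\<lambda>i. \<forall>p\<in>D. \<bar>P p - R i p\<bar> < e) F"
    then have 1: "eventually (\<lambda>Q. \<not> (\<forall>p\<in>D. \<bar>P p - Q p\<bar> < e)) (filtermap R F)"
      by (simp add: frequently_def eventually_filtermap)
    have "eventually (\<lambda>Q. \<bar>P p - Q p\<bar> < e) (nhds P)" for p
    proof -
      have "open ((\<lambda>Q :: 'p \<Rightarrow> real. Q p) -` ball (P p) e)"
        by (intro open_vimage open_ball continuous_on_product_coordinates)
      moreover have "P \<in> (\<lambda>Q. Q p) -` ball (P p) e" using D(2) by simp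
      ultimately have "eventually (\<lambda>Q. Q \<in> (\<lambda>Q. Q p) -` ball (P p) e) (nhds P)"
        by (rule eventually_nhds_in_open)
      then show ?thesis by (simp add: dist_real_def)
    qed
    then have "eventually (\<lambda>Q. \<forall>p\<in>D. \<bar>P p - Q p\<bar> < e) (nhds P)"
      using D(1) by (intro eventually_ball_finite) auto
    with 1 have "eventually (\<lambda>_. False) (inf (nhds P) (filtermap R F))"
      unfolding eventually_inf by blast
    then show False using P by (simp add: trivial_limit_def)
  qed
  then show ?thesis by blast
qed

text \<open>
  A pointwise limit of genuine conditional probabilities is coherent, also on conditioning events
  whose probability tends to zero.
\<close>

lemma cluster_process:
  fixes \<mu> :: "'i \<Rightarrow> (real \<Rightarrow> 'x::finite) pmf"
  assumes path: "path_space \<Omega>" and F: "F \<noteq> bot"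
    and pos: "\<And>u xu. u \<in> time_sets \<Longrightarrow> eventually (\<lambda>i. 0 < measure (\<mu> i) (tuple_event \<Omega> u xu)) F"
  obtains P where "stochastic_process \<Omega> P"
    "\<And>D e. finite D \<Longrightarrow> D \<subseteq> process_domain \<Omega> \<Longrightarrow> 0 < e \<Longrightarrow>
      frequently (\<lambda>i. \<forall>p\<in>D. \<bar>P p - cond_prob (\<mu> i) p\<bar> < e) F"
proof -
  have "\<exists>P. \<forall>D e. finite D \<longrightarrow> 0 < e \<longrightarrow> frequently (\<lambda>i. \<forall>p\<in>D. \<bar>P p - cond_prob (\<mu> i) p\<bar> < e) F"
    by (rule cluster_point_exists[OF F]) (simp only: atLeastAtMost_iff cond_prob_bounds simp_thms)
  then obtain P0 where P0: "\<And>D e. finite D \<Longrightarrow> 0 < e \<Longrightarrow>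
      frequently (\<lambda>i. \<forall>p\<in>D. \<bar>P0 p - cond_prob (\<mu> i) p\<bar> < e) F" by blast
  define P where "P = restrict P0 (process_domain \<Omega>)"
  have freq: "frequently (\<lambda>i. \<forall>p\<in>D. \<bar>P p - cond_prob (\<mu> i) p\<bar> < e) F"
    if D: "finite D" "D \<subseteq> process_domain \<Omega>" "0 < e" for D e
  proof (rule frequently_elim1[OF P0[OF D(1,3)]])
    fix i assume *: "\<forall>p\<in>D. \<bar>P0 p - cond_prob (\<mu> i) p\<bar> < e"
    have "P p = P0 p" if "p \<in> D" for p using that D(2) by (auto simp: P_def)
    then show "\<forall>p\<in>D. \<bar>P p - cond_prob (\<mu> i) p\<bar> < e" using * by simp
  qed
  have "coherent \<Omega> P"
    unfolding coherent_def
  proof (intro allI impI)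
    fix n :: nat and A C :: "nat \<Rightarrow> (real \<Rightarrow> 'x) set" and c :: "nat \<Rightarrow> real"
    assume n: "1 \<le> n" and dom: "\<forall>i\<in>{1..n}. (A i, C i) \<in> process_domain \<Omega>"
    let ?I = "{1..n}"
    let ?U = "\<Union>i\<in>?I. C i"
    let ?g = "\<lambda>\<omega>. \<Sum>i\<in>?I. c i * indicator (C i) \<omega> * (P (A i, C i) - indicator (A i) \<omega>)"
    have ev: "eventually (\<lambda>j. 0 < measure (\<mu> j) (C i)) F" if "i \<in> ?I" for i
    proof -
      obtain v z where "C i = tuple_event \<Omega> v z" "v \<in> time_sets"
        using bspec[OF dom \<open>i \<in> ?I\<close>] by (auto simp: process_domain_def)
      then show ?thesis using pos by simp
    qed
    have fin: "finite (?g ` ?U)" by (rule finite_gain_image) simp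
    have "(A 1, C 1) \<in> process_domain \<Omega>" using dom n by simp
    then have "C 1 \<noteq> {}" using tuple_event_nonempty[OF path] by (auto simp: process_domain_def)
    then have ne: "?g ` ?U \<noteq> {}" using n by auto
    show "0 \<le> Max (?g ` ?U)"
    proof (rule ccontr)
      assume "\<not> 0 \<le> Max (?g ` ?U)"
      \<comment> \<open>A sure loss of at least \<open>\<delta>\<close> under \<open>P\<close> is
        moved to one of the laws: with total stake \<open>S\<close>, prices that are off by
        \<open>e\<close> change the gain by at most \<open>S * e \<le> \<delta> / 2\<close>.\<close>
      define \<delta> where "\<delta> = - Max (?g ` ?U)"
      have \<delta>: "0 < \<delta>" using \<open>\<not> 0 \<le> Max (?g ` ?U)\<close> by (simp add: \<delta>_def)
      have g: "?g \<omega> \<le> - \<delta>" if "\<omega> \<in> ?U" for \<omega>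
        unfolding \<delta>_def minus_minus by (rule Max_ge[OF fin]) (rule imageI[OF that])
      define S where "S = (\<Sum>i\<in>?I. \<bar>c i\<bar>)"
      have S: "0 \<le> S" by (simp add: S_def sum_nonneg)
      define e where "e = \<delta> / (2 * (S + 1))"
      have e: "0 < e" using \<delta> S by (simp add: e_def)
      have "S * e \<le> \<delta> / 2"
      proof -
        have "S * e \<le> (S + 1) * e" using e by simp
        moreover have "k * (\<delta> / (2 * k)) = \<delta> / 2" if "0 < k" for k using that by simp
        then have "(S + 1) * (\<delta> / (2 * (S + 1))) = \<delta> / 2" using S by (simp only: add_nonneg_pos zero_less_one)
        ultimately show ?thesis unfolding e_def by linarith
      qed
      have "frequently (\<lambda>j. \<forall>p\<in>(\<lambda>i. (A i, C i)) ` ?I. \<bar>P p - cond_prob (\<mu> j) p\<bar> < e) F"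
        by (rule freq) (use dom e in auto)
      moreover have "eventually (\<lambda>j. \<forall>i\<in>?I. 0 < measure (\<mu> j) (C i)) F"
        using ev by (intro eventually_ball_finite) auto
      ultimately have "\<exists>j. (\<forall>p\<in>(\<lambda>i. (A i, C i)) ` ?I. \<bar>P p - cond_prob (\<mu> j) p\<bar> < e) \<and>
          (\<forall>i\<in>?I. 0 < measure (\<mu> j) (C i))"
        by (rule frequently_eventually_ex)
      then obtain j where j0: "\<forall>p\<in>(\<lambda>i. (A i, C i)) ` ?I. \<bar>P p - cond_prob (\<mu> j) p\<bar> < e"
          "\<forall>i\<in>?I. 0 < measure (\<mu> j) (C i)"
        by (elim exE conjE)
      have j: "\<And>i. i \<in> ?I \<Longrightarrow> 0 < measure (\<mu> j) (C i)"
        "\<And>i. i \<in> ?I \<Longrightarrow> \<bar>P (A i, C i) - cond_prob (\<mu> j) (A i, C i)\<bar> < e"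
        using j0 by (blast, blast)
      define r where "r i = cond_prob (\<mu> j) (A i, C i)" for i
      let ?h = "\<lambda>\<omega>. \<Sum>i\<in>?I. c i * indicator (C i) \<omega> * (r i - indicator (A i) \<omega>)"
      have hU: "?h \<omega> \<le> - (\<delta> / 2) * indicator ?U \<omega>" for \<omega>
      proof (cases "\<omega> \<in> ?U")
        case True
        have "?h \<omega> - ?g \<omega> = (\<Sum>i\<in>?I. c i * indicator (C i) \<omega> * (r i - P (A i, C i)))"
          by (simp add: sum_subtractf[symmetric] right_diff_distrib)
        also have "\<dots> \<le> (\<Sum>i\<in>?I. \<bar>c i\<bar> * e)"
        proof (rule sum_mono)
          fix i assume i: "i \<in> ?I"
          have "\<bar>c i * indicator (C i) \<omega> * (r i - P (A i, C i))\<bar> \<le> \<bar>c i\<bar> * e"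
          proof (cases "\<omega> \<in> C i")
            case True
            have "\<bar>r i - P (A i, C i)\<bar> \<le> e" using j(2)[OF i] by (simp add: r_def abs_minus_commute less_imp_le)
            then show ?thesis using True by (simp add: abs_mult mult_left_mono)
          qed (use e in simp)
          then show "c i * indicator (C i) \<omega> * (r i - P (A i, C i)) \<le> \<bar>c i\<bar> * e" by linarith
        qed
        also have "\<dots> = S * e" by (simp add: S_def sum_distrib_right)
        finally show ?thesis using g[OF True] \<open>S * e \<le> \<delta> / 2\<close> True by simp
      next
        case False
        then have "?h \<omega> = 0" by (intro sum.neutral) auto
        then show ?thesis using False by simp
      qed
      have split: "c i * indicator (C i) \<omega> * (r i - indicator (A i) \<omega>) =
          c i * r i * indicator (C i) \<omega> - c i * indicator (A i \<inter> C i) \<omega>" for i \<omega>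
        by (auto simp: indicator_def right_diff_distrib)
      have int: "integrable (measure_pmf (\<mu> j)) (\<lambda>\<omega>. k * indicator X \<omega> :: real)" for k X
        by (intro integrable_mult_right integrable_real_indicator) (auto simp: measure_pmf.emeasure_eq_measure)
      \<comment> \<open>At prices that are true conditional probabilities every bet is fair, whereas
        \<open>hU\<close> leaves a loss on \<open>?U\<close>, an event of positive
        probability.\<close>
      have "measure_pmf.expectation (\<mu> j) ?h = (\<Sum>i\<in>?I. c i * r i * measure (\<mu> j) (C i) - c i * measure (\<mu> j) (A i \<inter> C i))"
      proof -
        have "measure_pmf.expectation (\<mu> j) (\<lambda>\<omega>. c i * r i * indicator (C i) \<omega> - c i * indicator (A i \<inter> C i) \<omega>)
            = c i * r i * measure (\<mu> j) (C i) - c i * measure (\<mu> j) (A i \<inter> C i)" for i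
          by (subst Bochner_Integration.integral_diff[OF int int]) simp
        then show ?thesis
          unfolding split by (subst Bochner_Integration.integral_sum[OF Bochner_Integration.integrable_diff[OF int int]]) simp
      qed
      also have "\<dots> = 0"
      proof (intro sum.neutral ballI)
        fix i assume "i \<in> ?I"
        then show "c i * r i * measure (\<mu> j) (C i) - c i * measure (\<mu> j) (A i \<inter> C i) = 0"
          using j(1)[of i] by (simp add: r_def)
      qed
      finally have "0 = measure_pmf.expectation (\<mu> j) ?h" by simp
      also have "\<dots> \<le> measure_pmf.expectation (\<mu> j) (\<lambda>\<omega>. - (\<delta> / 2) * indicator ?U \<omega>)"
      proof (rule integral_mono)
        show "integrable (measure_pmf (\<mu> j)) ?h"
          unfolding split by (intro Bochner_Integration.integrable_sum Bochner_Integration.integrable_diff int)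
        show "integrable (measure_pmf (\<mu> j)) (\<lambda>\<omega>. - (\<delta> / 2) * indicator ?U \<omega>)" by (rule int)
      qed (rule hU)
      also have "\<dots> = - (\<delta> / 2) * measure (\<mu> j) ?U" by simp
      also have "\<dots> < 0"
      proof -
        have "0 < measure (\<mu> j) (C 1)" using j(1)[of 1] n by simp
        also have "\<dots> \<le> measure (\<mu> j) ?U"
          using n by (intro measure_pmf.finite_measure_mono) auto
        finally show ?thesis using \<delta> by simp
      qed
      finally show False by simp
    qed
  qed
  then have "stochastic_process \<Omega> P" by (simp add: stochastic_process_def P_def)
  then show ?thesis using freq that by blast
qed

text \<open>The largest point is added last, so each new piece is appended at the end;
  \<open>s \<in> insert 0 w\<close> keeps the grid from overshooting that point.\<close>

lemma fine_partition_exists: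
  assumes "finite w" "w \<subseteq> {0..}" "0 < d"
  shows "\<exists>s l. s \<in> insert 0 w \<and> l \<in> partitions 0 s \<and> w \<subseteq> set l \<and> mesh l \<le> d"
  using assms(1,2)
proof (induction w rule: finite_linorder_max_induct)
  case empty
  then show ?case using assms(3) by (intro exI[of _ 0] exI[of _ "[0]"]) (simp add: partitions_def)
next
  case (insert b A)
  then obtain s l where sl: "s \<in> insert 0 A" "l \<in> partitions 0 s" "A \<subseteq> set l" "mesh l \<le> d" by auto
  have "0 \<le> b" using insert by simp
  then have "s \<le> b" using sl(1) insert(2) by (auto intro: less_imp_le)
  then obtain v where v: "v \<in> partitions s b" "mesh v \<le> d"
    using partitions_mesh_exists[OF _ assms(3)] by blast
  note app = partitions_append[OF sl(2) v(1)]
  have "b \<in> set (l @ tl v)" using app(1) last_in_set[of "l @ tl v"] by (simp add: partitions_def)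
  then have "insert b A \<subseteq> set (l @ tl v)" using sl(3) by auto
  moreover have "mesh (l @ tl v) \<le> d" using app(2) sl(4) v(2) by simp
  ultimately show ?case using app(1) by (intro exI[of _ b] exI[of _ "l @ tl v"]) auto
qed

lemma sum_tuples_indicator:
  fixes f :: "(real \<Rightarrow> 'x::finite) \<Rightarrow> real"
  assumes "finite v" "x \<in> cylinder u xu"
  shows "(\<Sum>xv\<in>tuples v. f (merge u v (xu, xv)) * indicator (cylinder v xv) x) = f (restrict x (u \<union> v))"
proof -
  have fin: "finite (tuples v :: (real \<Rightarrow> 'x) set)" unfolding tuples_def using assms(1) by (intro finite_PiE) auto
  have eq: "indicator (cylinder v xv) x = (if xv = restrict x v then 1 else 0 :: real)" if "xv \<in> tuples v" for xv
  proof -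
    have "x \<in> cylinder v xv \<longleftrightarrow> xv = restrict x v"
      using that by (fastforce simp: cylinder_def tuples_def PiE_def extensional_def fun_eq_iff)
    then show ?thesis by (simp add: indicator_def)
  qed
  have "(\<Sum>xv\<in>tuples v. f (merge u v (xu, xv)) * indicator (cylinder v xv) x) =
      (\<Sum>xv\<in>tuples v. if xv = restrict x v then f (merge u v (xu, xv)) else 0)"
    by (intro sum.cong) (auto simp: eq)
  also have "\<dots> = f (merge u v (xu, restrict x v))"
    using fin by (simp add: tuples_def)
  also have "merge u v (xu, restrict x v) = restrict x (u \<union> v)"
    using assms(2) by (auto simp: merge_def cylinder_def fun_eq_iff)
  finally show ?thesis .
qed

section \<open>Discrete laws for finite time sets and their limit\<close>

context rate_set
begin

text \<open>The parameter \<open>\<eta>\<close> of \<open>kernel_exists\<close> is set to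
  \<open>d\<close>, so that the effect of the uniform admixture vanishes with the mesh.\<close>

lemma kernel_family_exists:
  fixes W :: "real \<Rightarrow> (real \<Rightarrow> 'x) \<Rightarrow> real ^ 'x"
  assumes H: "H \<subseteq> \<Q>" and approx: "\<And>W x. infnorm W \<le> B \<Longrightarrow> \<exists>Q\<in>H. (Q *v W) $ x \<le> qlow W $ x + \<epsilon>"
    and W: "\<And>b x. infnorm (W b x) \<le> B" and d: "0 < d" "d * M \<le> 1" "d \<le> 1"
  obtains K where "\<And>a b x y. 0 < pmf (K a b x) y"
    "\<And>a b x. a < b \<Longrightarrow> b - a \<le> d \<Longrightarrow>
      \<exists>Q\<in>H. \<forall>y. \<bar>pmf (K a b x) y - ((if x a = y then 1 else 0) + (b - a) * Q $ x a $ y)\<bar> \<le> (b - a) * d"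
    "\<And>a b x. a < b \<Longrightarrow> b - a \<le> d \<Longrightarrow>
      (\<Sum>y\<in>UNIV. pmf (K a b x) y * W b x $ y) \<le> W b x $ x a + (b - a) * (qlow (W b x) $ x a + (\<epsilon> + real CARD('x) * d * B))"
proof -
  define good where "good a b x p \<longleftrightarrow> (\<forall>y. 0 < pmf p y) \<and> (a < b \<and> b - a \<le> d \<longrightarrow>
      (\<exists>Q\<in>H. \<forall>y. \<bar>pmf p y - ((if x a = y then 1 else 0) + (b - a) * Q $ x a $ y)\<bar> \<le> (b - a) * d) \<and>
      (\<Sum>y\<in>UNIV. pmf p y * W b x $ y) \<le> W b x $ x a + (b - a) * (qlow (W b x) $ x a + (\<epsilon> + real CARD('x) * d * B)))"
    for a b :: real and x :: "real \<Rightarrow> 'x" and p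
  have "\<exists>p. good a b x p" for a b x
  proof (cases "a < b \<and> b - a \<le> d")
    case True
    have "(b - a) * M \<le> 1" using True d M_ge(2) by (meson mult_right_mono less_imp_le order_trans)
    then have "0 < b - a" "b - a \<le> 1" using True d by auto
    from kernel_exists[OF H approx[OF W[of b x], of "x a"] W[of b x] d(1,3) this(1) \<open>(b - a) * M \<le> 1\<close> this(2)]
    obtain p where "good a b x p" unfolding good_def by blast
    then show ?thesis by (rule exI)
  next
    case False
    \<comment> \<open>Outside the useful step lengths the uniform distribution keeps the positivity
      that \<open>measure_law_cylinder_pos\<close> demands for all arguments.\<close>
    then have "good a b x (pmf_of_set UNIV)" by (auto simp: good_def)
    then show ?thesis by (rule exI)
  qed
  then have K: "good a b x (SOME p. good a b x p)" for a b x by (rule someI_ex)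
  define K where "K a b x = (SOME p. good a b x p)" for a b x
  note K = K[folded K_def, unfolded good_def]
  show ?thesis
  proof (rule that[of K])
    show "0 < pmf (K a b x) y" for a b x y using K[of a b x] by simp
  next
    fix a b :: real and x :: "real \<Rightarrow> 'x" assume "a < b" "b - a \<le> d"
    then show "\<exists>Q\<in>H. \<forall>y. \<bar>pmf (K a b x) y - ((if x a = y then 1 else 0) + (b - a) * Q $ x a $ y)\<bar> \<le> (b - a) * d"
      and "(\<Sum>y\<in>UNIV. pmf (K a b x) y * W b x $ y) \<le> W b x $ x a + (b - a) * (qlow (W b x) $ x a + (\<epsilon> + real CARD('x) * d * B))"
      using K[of a b x] by simp_all
  qed
qed

text \<open>\<open>pick\<close> moves the law of the walk into \<open>\<Omega>\<close> by choosing a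
  path that agrees on the grid; this preserves the probabilities of all events over the grid.
  \<open>d\<close> serves as mesh, admixture and initial tolerance at once.\<close>

lemma discrete_process_exists:
  fixes p :: "'x pmf" and f :: "(real \<Rightarrow> 'x) \<Rightarrow> real" and u v :: "real set"
  defines "g \<equiv> \<lambda>x. f (restrict x (u \<union> v))"
  assumes path: "path_space \<Omega>"
    and H: "H \<subseteq> \<Q>" "convex H" "H \<noteq> {}"
    and approx: "\<And>W x. infnorm W \<le> B \<Longrightarrow> \<exists>Q\<in>H. (Q *v W) $ x \<le> qlow W $ x + \<epsilon>" and \<epsilon>: "0 \<le> \<epsilon>"
    and B: "\<And>x. \<bar>g x\<bar> \<le> B"
    and uv: "u \<noteq> {}" "v \<noteq> {}" "\<forall>r\<in>u. \<forall>s\<in>v. r < s"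
    and w: "finite w" "w \<subseteq> {0..}" "insert 0 (u \<union> v) \<subseteq> w"
    and d: "0 < d" "d * M \<le> 1" "d \<le> 1"
  shows "\<exists>\<mu> :: (real \<Rightarrow> 'x) pmf. (\<forall>u'\<subseteq>w. \<forall>z. 0 < measure_pmf.prob \<mu> (tuple_event \<Omega> u' z)) \<and>
    measure_pmf.prob \<mu> \<Omega> = 1 \<and> (\<forall>y. \<bar>measure_pmf.prob \<mu> (state_event \<Omega> 0 y) - pmf p y\<bar> \<le> d) \<and>
    (\<forall>t t' u' z. t < t' \<longrightarrow> t' \<in> w \<longrightarrow> insert t u' \<subseteq> w \<longrightarrow> (\<forall>r\<in>u'. r \<le> t) \<longrightarrow>
      (\<exists>Q\<in>H. \<forall>y. \<bar>cond_prob \<mu> (state_event \<Omega> t' y, tuple_event \<Omega> (insert t u') z)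
        - ((if z t = y then 1 else 0) + (t' - t) * Q $ z t $ y)\<bar> \<le> (t' - t) * d + m * (m + 1) * (t' - t)\<^sup>2)) \<and>
    (\<forall>z. (\<Sum>xv\<in>tuples v. f (merge u v (z, xv)) * measure_pmf.prob \<mu> (tuple_event \<Omega> v xv \<inter> tuple_event \<Omega> u z)) \<le>
      measure_pmf.prob \<mu> (tuple_event \<Omega> u z) * (viter qlow (Max u) (sorted_list_of_set v) g z +
        (Max v - Max u) * (\<epsilon> + real CARD('x) * d * B + M\<^sup>2 * d * B)))"
proof -
  obtain s l where l: "l \<in> partitions 0 s" "w \<subseteq> set l" "mesh l \<le> d"
    using fine_partition_exists[OF w(1,2) d(1)] by blast
  have ls: "sorted_wrt (<) l" "l \<noteq> []" "hd l = 0" using l(1) by (auto simp: partitions_def)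
  have ldist: "distinct l" using ls(1) by (simp add: strict_sorted_iff)
  have l0: "\<And>r. r \<in> set l \<Longrightarrow> 0 \<le> r" using sorted_wrt_between_hd_last[OF ls(1)] ls(3) by auto
  have B0: "0 \<le> B" using B[of undefined] by linarith
  have fin: "finite u" "finite v" using w finite_subset[of "u \<union> v" w] by auto
  \<comment> \<open>The target of the control on a move to time \<open>b\<close>: the value of the
    remaining grid as a function of the state at \<open>b\<close>.\<close>
  define W where "W b x = (\<chi> y. viter qlow b (filter (\<lambda>r. b < r) (filter (\<lambda>r. r \<le> Max v) l)) g (x(b := y)))" for b x
  have W: "infnorm (W b x) \<le> B" for b x
  proof -
    have "sorted_wrt (<) (b # filter (\<lambda>r. b < r) (filter (\<lambda>r. r \<le> Max v) l))"
      using ls(1) by (auto intro!: sorted_wrt_filter simp del: filter_filter)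
    from viter_bound[OF this B] show ?thesis by (simp add: infnorm_le_cart_iff W_def del: filter_filter)
  qed
  obtain K where Kpos: "\<And>a b x y. 0 < pmf (K a b x) y"
    and Krow: "\<And>a b x. a < b \<Longrightarrow> b - a \<le> d \<Longrightarrow>
      \<exists>Q\<in>H. \<forall>y. \<bar>pmf (K a b x) y - ((if x a = y then 1 else 0) + (b - a) * Q $ x a $ y)\<bar> \<le> (b - a) * d"
    and Kval: "\<And>a b x. a < b \<Longrightarrow> b - a \<le> d \<Longrightarrow>
      (\<Sum>y\<in>UNIV. pmf (K a b x) y * W b x $ y) \<le> W b x $ x a + (b - a) * (qlow (W b x) $ x a + (\<epsilon> + real CARD('x) * d * B))"
  proof (rule kernel_family_exists[where W=W and B=B and H=H and d=d and \<epsilon>=\<epsilon>, OF H(1) _ W d])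
    show "\<exists>Q\<in>H. (Q *v W) $ x \<le> qlow W $ x + \<epsilon>" if "infnorm W \<le> B" for W x
      using that by (rule approx)
  qed (rule that; assumption)
  have "(\<Sum>y\<in>UNIV. pmf p y) = 1" by (simp add: sum_pmf_eq_1)
  \<comment> \<open>The initial distribution is made positive as well; its error \<open>d\<close>
    disappears in the limit.\<close>
  then obtain p0 where p0: "\<And>y. 0 < pmf p0 y" "\<And>y. \<bar>pmf p0 y - pmf p y\<bar> \<le> d"
    using pmf_mix_uniform[of "pmf p" d] d by auto
  have "\<exists>\<omega>\<in>\<Omega>. \<forall>t\<in>set l. \<omega> t = x t" for x
    by (rule path_space_pick[OF path]) (use l0 in auto)
  then obtain pick where pick: "\<And>x. pick x \<in> \<Omega>" "\<And>x t. t \<in> set l \<Longrightarrow> pick x t = x t" by metis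
  define \<nu> where "\<nu> = law p0 K l"
  define \<mu> where "\<mu> = map_pmf pick \<nu>"
  have tup: "pick -` tuple_event \<Omega> u' z = cylinder u' z" if "u' \<subseteq> set l" for u' z
    using that pick by (auto simp: tuple_event_def cylinder_def subset_iff)
  have st: "pick -` state_event \<Omega> t y = {x. x t = y}" if "t \<in> set l" for t y
    using that pick by (auto simp: state_event_def)
  have cyl_pos: "0 < measure \<nu> (cylinder u' z)" if "u' \<subseteq> w" for u' z
    unfolding \<nu>_def using that l(2) by (intro measure_law_cylinder_pos Kpos p0 ls ldist) auto
  have pos: "0 < measure \<mu> (tuple_event \<Omega> u' z)" if "u' \<subseteq> w" for u' z
  proof -
    have "u' \<subseteq> set l" using that l(2) by blast
    then show ?thesis using cyl_pos[OF that] by (simp add: \<mu>_def tup)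
  qed
  moreover have "measure \<mu> \<Omega> = 1"
  proof -
    have "pick -` \<Omega> = UNIV" using pick by auto
    then show ?thesis by (simp add: \<mu>_def)
  qed
  moreover have "\<bar>measure \<mu> (state_event \<Omega> 0 y) - pmf p y\<bar> \<le> d" for y
  proof -
    obtain bs where bs: "l = 0 # bs" using ls by (cases l) auto
    have "measure \<mu> (state_event \<Omega> 0 y) = pmf p0 y"
      using measure_law_hd[of 0 bs p0 K y] ldist by (simp add: \<mu>_def \<nu>_def st bs)
    then show ?thesis using p0(2) by simp
  qed
  moreover have "\<exists>Q\<in>H. \<forall>y. \<bar>cond_prob \<mu> (state_event \<Omega> t' y, tuple_event \<Omega> (insert t u') z)
        - ((if z t = y then 1 else 0) + (t' - t) * Q $ z t $ y)\<bar> \<le> (t' - t) * d + m * (m + 1) * (t' - t)\<^sup>2"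
    if t: "t < t'" "t' \<in> w" "insert t u' \<subseteq> w" "\<forall>r\<in>u'. r \<le> t" for t t' u' z
  proof -
    have sub: "insert t u' \<subseteq> set l" "t' \<in> set l" "t \<in> set l" using t l(2) by auto
    have "\<exists>Q\<in>H. \<forall>y. \<bar>measure (law p0 K l) (cylinder (insert t u') z \<inter> {x. x t' = y}) /
        measure (law p0 K l) (cylinder (insert t u') z) - ((if z t = y then 1 else 0) + (t' - t) * Q $ z t $ y)\<bar>
        \<le> (t' - t) * d + m * (m + 1) * (t' - t)\<^sup>2"
    proof (rule law_row_estimate[OF H _ _ _ ls(1) l(3) sub(3,2) t(1)])
      show "0 < measure (law p0 K l) (cylinder (insert t u') z)" using cyl_pos[OF t(3)] by (simp add: \<nu>_def)
    qed (use t d Krow in auto)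
    moreover have "cond_prob \<mu> (state_event \<Omega> t' y, tuple_event \<Omega> (insert t u') z) =
        measure (law p0 K l) (cylinder (insert t u') z \<inter> {x. x t' = y}) / measure (law p0 K l) (cylinder (insert t u') z)" for y
      by (simp add: \<mu>_def \<nu>_def vimage_Int tup[OF sub(1)] st[OF sub(2)] Int_commute)
    ultimately show ?thesis by simp
  qed
  moreover have "(\<Sum>xv\<in>tuples v. f (merge u v (z, xv)) * measure \<mu> (tuple_event \<Omega> v xv \<inter> tuple_event \<Omega> u z)) \<le>
      measure \<mu> (tuple_event \<Omega> u z) * (viter qlow (Max u) (sorted_list_of_set v) g z +
        (Max v - Max u) * (\<epsilon> + real CARD('x) * d * B + M\<^sup>2 * d * B))" for z
  proof -
    have ul: "u \<subseteq> set l" "v \<subseteq> set l" using w(3) l(2) by auto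
    have meas: "measure \<mu> (tuple_event \<Omega> v xv \<inter> tuple_event \<Omega> u z) =
        measure_pmf.expectation \<nu> (indicator (cylinder v xv \<inter> cylinder u z))" for xv
      by (simp add: \<mu>_def vimage_Int tup[OF ul(1)] tup[OF ul(2)])
    have "(\<Sum>xv\<in>tuples v. f (merge u v (z, xv)) * measure \<mu> (tuple_event \<Omega> v xv \<inter> tuple_event \<Omega> u z)) =
        measure_pmf.expectation \<nu> (\<lambda>x. \<Sum>xv\<in>tuples v. f (merge u v (z, xv)) * indicator (cylinder v xv \<inter> cylinder u z) x)"
    proof -
      have int: "integrable (measure_pmf \<nu>) (\<lambda>\<omega>. k * indicator X \<omega> :: real)" for k X
        by (intro integrable_mult_right integrable_real_indicator) (auto simp: measure_pmf.emeasure_eq_measure)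
      show ?thesis unfolding meas by (subst Bochner_Integration.integral_sum[OF int]) simp
    qed
    also have "(\<lambda>x. \<Sum>xv\<in>tuples v. f (merge u v (z, xv)) * indicator (cylinder v xv \<inter> cylinder u z) x) =
        (\<lambda>x. indicator (cylinder u z) x * g x)"
    proof
      fix x
      show "(\<Sum>xv\<in>tuples v. f (merge u v (z, xv)) * indicator (cylinder v xv \<inter> cylinder u z) x) =
        indicator (cylinder u z) x * g x"
      proof (cases "x \<in> cylinder u z")
        case True
        then have "(\<Sum>xv\<in>tuples v. f (merge u v (z, xv)) * indicator (cylinder v xv \<inter> cylinder u z) x) =
            (\<Sum>xv\<in>tuples v. f (merge u v (z, xv)) * indicator (cylinder v xv) x)"
          by (intro sum.cong) (auto simp: indicator_def)
        then show ?thesis using sum_tuples_indicator[OF fin(2) True, of f] True by (simp add: g_def)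
      qed simp
    qed
    also have "measure_pmf.expectation \<nu> (\<lambda>x. indicator (cylinder u z) x * g x) \<le>
        measure \<nu> (cylinder u z) * (viter qlow (Max u) (sorted_list_of_set v) g z +
        (Max v - Max u) * (\<epsilon> + real CARD('x) * d * B + M\<^sup>2 * d * B))"
      unfolding \<nu>_def
    proof (rule law_expectation_le_viter[OF B d(2) ls(1) l(3) ul(1) uv(1) ul(2) uv(2,3)])
      fix x x' :: "real \<Rightarrow> 'x" assume "\<forall>t\<in>u \<union> v. x t = x' t"
      then have "restrict x (u \<union> v) = restrict x' (u \<union> v)" by (intro restrict_ext) blast
      then show "g x = g x'" by (simp add: g_def)
    next
      show "0 \<le> \<epsilon> + real CARD('x) * d * B" using \<epsilon> B0 d by simp
    next
      fix a b :: real and x :: "real \<Rightarrow> 'x" and W'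
      assume ab: "a < b" "b - a \<le> d"
        and "W' = (\<chi> y. viter qlow b (filter (\<lambda>r. b < r) (filter (\<lambda>r. r \<le> Max v) l)) g (x(b := y)))"
      then have "W' = W b x" by (simp only: W_def)
      then show "(\<Sum>y\<in>UNIV. pmf (K a b x) y * W' $ y) \<le> W' $ x a + (b - a) * (qlow W' $ x a + (\<epsilon> + real CARD('x) * d * B))"
        using Kval[OF ab, of x] by simp
    qed
    finally show ?thesis by (simp add: \<mu>_def tup[OF ul(1)])
  qed
  ultimately show ?thesis by (intro exI[of _ \<mu>]) blast
qed

end

context rate_set
begin

text \<open>The laws are indexed by finite time sets, directed by inclusion, because the times of
  every event considered must eventually belong to the grid. Errors that vanish with
  \<open>d w\<close> can be made arbitrarily small at the cluster point; those of order
  \<open>(t' - t)\<^sup>2\<close> remain.\<close>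

lemma limit_process_exists:
  fixes p :: "'x pmf" and f :: "(real \<Rightarrow> 'x) \<Rightarrow> real" and u v :: "real set"
  defines "g \<equiv> \<lambda>x. f (restrict x (u \<union> v))"
  assumes path: "path_space \<Omega>"
    and H: "H \<subseteq> \<Q>" "convex H" "H \<noteq> {}"
    and B: "\<And>x. \<bar>g x\<bar> \<le> B"
    and approx: "\<And>W x. infnorm W \<le> B \<Longrightarrow> \<exists>Q\<in>H. (Q *v W) $ x \<le> qlow W $ x + \<epsilon>" and \<epsilon>: "0 \<le> \<epsilon>" "0 < \<epsilon>'"
    and uv: "u \<in> time_sets" "v \<in> time_sets" "u \<noteq> {}" "v \<noteq> {}" "\<forall>r\<in>u. \<forall>s\<in>v. r < s"
    and xu: "xu \<in> tuples u"
  obtains P where "stochastic_process \<Omega> P" "\<And>x. P (state_event \<Omega> 0 x, \<Omega>) = pmf p x"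
    "\<And>t t' u' z x. 0 \<le> t \<Longrightarrow> t < t' \<Longrightarrow> u' \<in> time_sets_before t \<Longrightarrow> z \<in> tuples u' \<Longrightarrow>
      \<exists>Q\<in>H. \<forall>y. \<bar>trans_matrix \<Omega> P u' z t t' $ x $ y - ((if x = y then 1 else 0) + (t' - t) * Q $ x $ y)\<bar>
        \<le> (m * (m + 1) + 1) * (t' - t)\<^sup>2"
    "(\<Sum>xv\<in>tuples v. f (merge u v (xu, xv)) * P (tuple_event \<Omega> v xv, tuple_event \<Omega> u xu)) \<le>
      viter qlow (Max u) (sorted_list_of_set v) g xu + (Max v - Max u) * \<epsilon> + \<epsilon>'"
proof -
  have B0: "0 \<le> B" using B[of undefined] by linarith
  have fin: "finite u" "finite v" "u \<subseteq> {0..}" "v \<subseteq> {0..}" using uv by (auto simp: time_sets_def)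
  \<comment> \<open>\<open>N\<close> gives \<open>d w * M \<le> 1\<close> and
    \<open>d w \<le> 1\<close> for every \<open>w\<close>; the cardinality of \<open>w\<close>
    drives \<open>d w\<close> to zero.\<close>
  obtain N :: nat where N: "max M 1 \<le> real N" using real_arch_simple by blast
  define d where "d w = 1 / (real (card w) + real N)" for w :: "real set"
  have dpos: "0 < d w" for w using N by (simp add: d_def)
  have d1: "d w \<le> 1" for w using N by (simp add: d_def)
  have dM: "d w * M \<le> 1" for w
  proof -
    have "M \<le> real (card w) + real N" using N by simp
    then show ?thesis using N by (simp add: d_def divide_le_eq)
  qed
  let ?F = "finite_subsets_at_top {0 :: real..}"
  let ?ok = "\<lambda>w. finite w \<and> w \<subseteq> {0..} \<and> insert 0 (u \<union> v) \<subseteq> w"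
  let ?T = "Max v - Max u"
  let ?V = "viter qlow (Max u) (sorted_list_of_set v) g"
  define \<Phi> where "\<Phi> w \<mu> \<longleftrightarrow> (\<forall>u'\<subseteq>w. \<forall>z. 0 < measure_pmf.prob \<mu> (tuple_event \<Omega> u' z)) \<and>
    measure_pmf.prob \<mu> \<Omega> = 1 \<and> (\<forall>y. \<bar>measure_pmf.prob \<mu> (state_event \<Omega> 0 y) - pmf p y\<bar> \<le> d w) \<and>
    (\<forall>t t' u' z. t < t' \<longrightarrow> t' \<in> w \<longrightarrow> insert t u' \<subseteq> w \<longrightarrow> (\<forall>r\<in>u'. r \<le> t) \<longrightarrow>
      (\<exists>Q\<in>H. \<forall>y. \<bar>cond_prob \<mu> (state_event \<Omega> t' y, tuple_event \<Omega> (insert t u') z)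
        - ((if z t = y then 1 else 0) + (t' - t) * Q $ z t $ y)\<bar> \<le> (t' - t) * d w + m * (m + 1) * (t' - t)\<^sup>2)) \<and>
    (\<forall>z. (\<Sum>xv\<in>tuples v. f (merge u v (z, xv)) * measure_pmf.prob \<mu> (tuple_event \<Omega> v xv \<inter> tuple_event \<Omega> u z)) \<le>
      measure_pmf.prob \<mu> (tuple_event \<Omega> u z) * (?V z + ?T * (\<epsilon> + real CARD('x) * d w * B + M\<^sup>2 * d w * B)))"
    for w and \<mu> :: "(real \<Rightarrow> 'x) pmf"
  have ex: "\<exists>\<mu>. \<Phi> w \<mu>" if "?ok w" for w
  proof -
    from that have w: "finite w" "w \<subseteq> {0..}" "insert 0 (u \<union> v) \<subseteq> w" by auto
    show ?thesis
      unfolding \<Phi>_def g_def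
    proof (rule discrete_process_exists[where f=f and u=u and v=v and B=B and \<epsilon>=\<epsilon> and d="d w" and w=w and H=H and \<Omega>=\<Omega>,
          OF path H _ \<epsilon>(1) B[unfolded g_def] uv(3-5) w dpos dM d1])
      show "\<exists>Q\<in>H. (Q *v W) $ x \<le> qlow W $ x + \<epsilon>" if "infnorm W \<le> B" for W x
        using that by (rule approx)
    qed
  qed
  define \<mu> where "\<mu> w = (SOME \<mu>. \<Phi> w \<mu>)" for w
  have \<mu>: "\<Phi> w (\<mu> w)" if "?ok w" for w
    unfolding \<mu>_def by (rule someI_ex[OF ex[OF that]])
  have \<mu>pos: "0 < measure_pmf.prob (\<mu> w) (tuple_event \<Omega> u' z)" if "?ok w" "u' \<subseteq> w" for w u' z
    using \<mu>[of w] that unfolding \<Phi>_def by simp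
  have \<mu>one: "measure_pmf.prob (\<mu> w) \<Omega> = 1" if "?ok w" for w
    using \<mu>[of w] that unfolding \<Phi>_def by simp
  have \<mu>init: "\<bar>measure_pmf.prob (\<mu> w) (state_event \<Omega> 0 y) - pmf p y\<bar> \<le> d w" if "?ok w" for w y
    using \<mu>[of w] that unfolding \<Phi>_def by simp
  have \<mu>row: "\<exists>Q\<in>H. \<forall>y. \<bar>cond_prob (\<mu> w) (state_event \<Omega> t' y, tuple_event \<Omega> (insert t u') z)
        - ((if z t = y then 1 else 0) + (t' - t) * Q $ z t $ y)\<bar> \<le> (t' - t) * d w + m * (m + 1) * (t' - t)\<^sup>2"
    if "?ok w" "t < t'" "t' \<in> w" "insert t u' \<subseteq> w" "\<forall>r\<in>u'. r \<le> t" for w t t' u' z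
    using \<mu>[OF that(1)] that(2-5) unfolding \<Phi>_def by blast
  have \<mu>val: "(\<Sum>xv\<in>tuples v. f (merge u v (z, xv)) * measure_pmf.prob (\<mu> w) (tuple_event \<Omega> v xv \<inter> tuple_event \<Omega> u z)) \<le>
      measure_pmf.prob (\<mu> w) (tuple_event \<Omega> u z) * (?V z + ?T * (\<epsilon> + real CARD('x) * d w * B + M\<^sup>2 * d w * B))"
    if "?ok w" for w z
    using \<mu>[OF that(1)] unfolding \<Phi>_def by blast
  have evw: "eventually (\<lambda>w. finite w \<and> w \<subseteq> {0..} \<and> w0 \<subseteq> w) ?F" if "finite w0" "w0 \<subseteq> {0..}" for w0
    unfolding eventually_finite_subsets_at_top using that by blast
  have evok: "eventually (\<lambda>w. ?ok w \<and> w0 \<subseteq> w) ?F" if "finite w0" "w0 \<subseteq> {0..}" for w0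
    using evw[of "insert 0 (u \<union> v) \<union> w0"] that fin by (auto elim!: eventually_mono)
  have evd: "eventually (\<lambda>w. d w \<le> e) ?F" if "0 < e" for e
  proof -
    obtain n :: nat where n: "1 / e < real n" using reals_Archimedean2 by blast
    have "eventually (\<lambda>w. finite w \<and> w \<subseteq> {0..} \<and> real ` {..<n} \<subseteq> w) ?F" by (rule evw) auto
    then show ?thesis
    proof eventually_elim
      case (elim w)
      have "card (real ` {..<n}) = n" by (subst card_image) (auto intro: inj_onI)
      then have "n \<le> card w" using card_mono[of w "real ` {..<n}"] elim by simp
      then have "1 / e \<le> real (card w) + real N" using n by linarith
      moreover have "0 < 1 / e" using that by simp
      moreover from calculation have "0 < real (card w) + real N" by linarith
      ultimately have "1 / (real (card w) + real N) \<le> 1 / (1 / e)" by (intro divide_left_mono mult_pos_pos) auto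
      then show ?case by (simp add: d_def)
    qed
  qed
  have pos: "eventually (\<lambda>w. 0 < measure (\<mu> w) (tuple_event \<Omega> u' z)) ?F" if "u' \<in> time_sets" for u' z
  proof -
    have "eventually (\<lambda>w. ?ok w \<and> u' \<subseteq> w) ?F" using that by (intro evok) (auto simp: time_sets_def)
    then show ?thesis by (rule eventually_mono) (blast intro: \<mu>pos)
  qed
  obtain P where P: "stochastic_process \<Omega> P"
    and freq: "\<And>D e. finite D \<Longrightarrow> D \<subseteq> process_domain \<Omega> \<Longrightarrow> 0 < e \<Longrightarrow>
      frequently (\<lambda>w. \<forall>p\<in>D. \<bar>P p - cond_prob (\<mu> w) p\<bar> < e) ?F"
    using cluster_process[OF path finite_subsets_at_top_neq_bot pos] by blast
  \<comment> \<open>What holds frequently combines with what holds eventually, which yields one fine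
    law for each finite purpose.\<close>
  have near_law: "\<exists>w. (\<forall>p\<in>D. \<bar>P p - cond_prob (\<mu> w) p\<bar> < e) \<and> ?ok w \<and> w0 \<subseteq> w \<and> d w \<le> e'"
    if "finite D" "D \<subseteq> process_domain \<Omega>" "0 < e" "finite w0" "w0 \<subseteq> {0..}" "0 < e'" for D e w0 e'
    using frequently_eventually_ex[OF freq[OF that(1-3)] eventually_conj[OF evok[OF that(4,5)] evd[OF that(6)]]]
    by blast
  show ?thesis
  proof (rule that[OF P])
    fix x
    have dom: "(state_event \<Omega> 0 x, \<Omega>) \<in> process_domain \<Omega>"
    proof -
      have "(state_event \<Omega> 0 x, tuple_event \<Omega> {} (\<lambda>_. undefined)) \<in> process_domain \<Omega>"
        by (intro process_domainI state_event_in_event_algebra) (auto simp: time_sets_def tuples_def)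
      then show ?thesis by (simp add: tuple_event_def)
    qed
    have "\<bar>P (state_event \<Omega> 0 x, \<Omega>) - pmf p x\<bar> \<le> 0 + e" if e: "0 < e" for e
    proof -
      obtain w where w: "\<forall>p\<in>{(state_event \<Omega> 0 x, \<Omega>)}. \<bar>P p - cond_prob (\<mu> w) p\<bar> < e / 2" "?ok w" "d w \<le> e / 2"
        using near_law[of "{(state_event \<Omega> 0 x, \<Omega>)}" "e / 2" "{}" "e / 2"] dom e by auto
      have "state_event \<Omega> 0 x \<inter> \<Omega> = state_event \<Omega> 0 x" by (auto simp: state_event_def)
      then have "\<bar>P (state_event \<Omega> 0 x, \<Omega>) - measure_pmf.prob (\<mu> w) (state_event \<Omega> 0 x)\<bar> < e / 2"
        using w(1) \<mu>one[OF w(2)] by simp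
      then show ?thesis using \<mu>init[OF w(2), of x] w(3) by linarith
    qed
    then have "\<bar>P (state_event \<Omega> 0 x, \<Omega>) - pmf p x\<bar> \<le> 0" by (rule field_le_epsilon)
    then show "P (state_event \<Omega> 0 x, \<Omega>) = pmf p x" by simp
  next
    fix t t' :: real and u' and z :: "real \<Rightarrow> 'x" and x assume t: "0 \<le> t" "t < t'" and u': "u' \<in> time_sets_before t" and z: "z \<in> tuples u'"
    let ?C = "tuple_event \<Omega> (insert t u') (z(t := x))"
    let ?D = "(\<lambda>y. (state_event \<Omega> t' y, ?C)) ` UNIV"
    have u'': "u' \<in> time_sets" "\<forall>r\<in>u'. r < t" using u' by (auto simp: time_sets_before_def)
    have dom: "?D \<subseteq> process_domain \<Omega>"
    proof (rule image_subsetI, rule process_domainI)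
      fix y
      show "insert t u' \<in> time_sets" using u''(1) t(1) by (rule time_sets_insert)
      show "z(t := x) \<in> tuples (insert t u')" using z by (rule tuples_insert)
      show "state_event \<Omega> t' y \<in> event_algebra \<Omega> (insert t u')"
        using t u'' by (intro state_event_in_event_algebra) auto
    qed
    \<comment> \<open>The times \<open>t\<close> and \<open>t'\<close> are fixed before the law is
      chosen, so its distance \<open>e\<close> and the term \<open>(t' - t) * d w\<close> are each
      kept within \<open>(t' - t)\<^sup>2 / 2\<close>. Together they make the \<open>+ 1\<close> in
      the constant.\<close>
    define e where "e = (t' - t)\<^sup>2 / 2"
    have e: "0 < e" "0 < (t' - t) / 2" using t by (auto simp: e_def)
    have w0: "finite (insert t' (insert t u'))" "insert t' (insert t u') \<subseteq> {0..}"
      using u'' t by (auto simp: time_sets_def)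
    obtain w where w: "\<forall>p\<in>?D. \<bar>P p - cond_prob (\<mu> w) p\<bar> < e" "?ok w" "insert t' (insert t u') \<subseteq> w" "d w \<le> (t' - t) / 2"
      using near_law[OF finite_imageI[OF finite_class.finite_UNIV] dom e(1) w0 e(2)] by (elim exE conjE) (rule that; blast)
    obtain Q where Q: "Q \<in> H" "\<And>y. \<bar>cond_prob (\<mu> w) (state_event \<Omega> t' y, ?C)
        - ((if x = y then 1 else 0) + (t' - t) * Q $ x $ y)\<bar> \<le> (t' - t) * d w + m * (m + 1) * (t' - t)\<^sup>2"
    proof -
      have "\<exists>Q\<in>H. \<forall>y. \<bar>cond_prob (\<mu> w) (state_event \<Omega> t' y, ?C)
        - ((if (z(t := x)) t = y then 1 else 0) + (t' - t) * Q $ (z(t := x)) t $ y)\<bar> \<le> (t' - t) * d w + m * (m + 1) * (t' - t)\<^sup>2"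
        by (rule \<mu>row[OF w(2) t(2)]) (use w(3) u''(2) in \<open>auto intro: less_imp_le\<close>)
      then show ?thesis using that unfolding fun_upd_same by blast
    qed
    have "\<bar>trans_matrix \<Omega> P u' z t t' $ x $ y - ((if x = y then 1 else 0) + (t' - t) * Q $ x $ y)\<bar>
        \<le> (m * (m + 1) + 1) * (t' - t)\<^sup>2" for y
    proof -
      have "\<bar>P (state_event \<Omega> t' y, ?C) - cond_prob (\<mu> w) (state_event \<Omega> t' y, ?C)\<bar> < e"
        by (rule bspec[OF w(1)]) simp
      moreover have "(t' - t) * d w \<le> (t' - t) * ((t' - t) / 2)" using w(4) t by (intro mult_left_mono) auto
      then have "(t' - t) * d w \<le> e" by (simp add: e_def power2_eq_square)
      ultimately have "\<bar>P (state_event \<Omega> t' y, ?C) - ((if x = y then 1 else 0) + (t' - t) * Q $ x $ y)\<bar>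
          \<le> 2 * e + m * (m + 1) * (t' - t)\<^sup>2"
        using Q(2)[of y] by linarith
      also have "\<dots> = (m * (m + 1) + 1) * (t' - t)\<^sup>2" by (simp add: e_def algebra_simps)
      finally show ?thesis by (simp add: trans_matrix_def)
    qed
    then show "\<exists>Q\<in>H. \<forall>y. \<bar>trans_matrix \<Omega> P u' z t t' $ x $ y - ((if x = y then 1 else 0) + (t' - t) * Q $ x $ y)\<bar>
        \<le> (m * (m + 1) + 1) * (t' - t)\<^sup>2" using Q(1) by blast
  next
    let ?C = "tuple_event \<Omega> u xu"
    let ?c = "\<lambda>xv. f (merge u v (xu, xv))"
    let ?D = "(\<lambda>xv. (tuple_event \<Omega> v xv, ?C)) ` tuples v"
    have finv: "finite (tuples v :: (real \<Rightarrow> 'x) set)" unfolding tuples_def using fin(2) by (intro finite_PiE) auto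
    have dom: "?D \<subseteq> process_domain \<Omega>"
    proof (rule image_subsetI, rule process_domainI[OF uv(1) xu])
      fix xv
      show "tuple_event \<Omega> v xv \<in> event_algebra \<Omega> u"
        using fin uv(5) by (intro tuple_event_in_event_algebra) auto
    qed
    define S where "S = (\<Sum>xv\<in>tuples v. \<bar>?c xv\<bar>)"
    have S: "0 \<le> S" by (simp add: S_def sum_nonneg)
    have T: "0 \<le> ?T"
      using uv(5) Max_in[OF fin(1) uv(3)] Max_in[OF fin(2) uv(4)] by (auto intro: less_imp_le)
    \<comment> \<open>\<open>R\<close> collects what is multiplied by \<open>d w\<close>;
      \<open>e\<close> and \<open>e'\<close> give half of \<open>\<epsilon>'\<close> to the distance
      from the law and half to its discretisation.\<close>
    define R where "R = ?T * (real CARD('x) * B + M\<^sup>2 * B)"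
    have R: "0 \<le> R" using T B0 by (simp add: R_def)
    have half: "k * (\<epsilon>' / (2 * (k + 1))) \<le> \<epsilon>' / 2" "0 < \<epsilon>' / (2 * (k + 1))" if "0 \<le> k" for k
    proof -
      show "0 < \<epsilon>' / (2 * (k + 1))" using \<epsilon>(2) that by simp
      then have "k * (\<epsilon>' / (2 * (k + 1))) \<le> (k + 1) * (\<epsilon>' / (2 * (k + 1)))" by (intro mult_right_mono) auto
      moreover have "c * (\<epsilon>' / (2 * c)) = \<epsilon>' / 2" if "0 < c" for c using that by simp
      then have "(k + 1) * (\<epsilon>' / (2 * (k + 1))) = \<epsilon>' / 2" using that by (simp only: add_nonneg_pos zero_less_one)
      ultimately show "k * (\<epsilon>' / (2 * (k + 1))) \<le> \<epsilon>' / 2" by linarith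
    qed
    define e where "e = \<epsilon>' / (2 * (S + 1))"
    define e' where "e' = \<epsilon>' / (2 * (R + 1))"
    have e: "S * e \<le> \<epsilon>' / 2" "0 < e" "R * e' \<le> \<epsilon>' / 2" "0 < e'"
      unfolding e_def e'_def using half[OF S] half[OF R] by auto
    obtain w where w: "\<forall>p\<in>?D. \<bar>P p - cond_prob (\<mu> w) p\<bar> < e" "?ok w" "d w \<le> e'"
      using near_law[OF finite_imageI[OF finv] dom e(2) finite.emptyI empty_subsetI e(4)]
      by (elim exE conjE) (rule that; blast)
    have C: "0 < measure_pmf.prob (\<mu> w) ?C" by (rule \<mu>pos[OF w(2)]) (use w(2) in auto)
    have "(\<Sum>xv\<in>tuples v. ?c xv * P (tuple_event \<Omega> v xv, ?C)) - (\<Sum>xv\<in>tuples v. ?c xv * cond_prob (\<mu> w) (tuple_event \<Omega> v xv, ?C))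
        = (\<Sum>xv\<in>tuples v. ?c xv * (P (tuple_event \<Omega> v xv, ?C) - cond_prob (\<mu> w) (tuple_event \<Omega> v xv, ?C)))"
      by (simp only: sum_subtractf right_diff_distrib)
    also have "\<dots> \<le> (\<Sum>xv\<in>tuples v. \<bar>?c xv\<bar> * e)"
    proof (rule sum_mono)
      fix xv :: "real \<Rightarrow> 'x" assume "xv \<in> tuples v"
      then have "\<bar>P (tuple_event \<Omega> v xv, ?C) - cond_prob (\<mu> w) (tuple_event \<Omega> v xv, ?C)\<bar> \<le> e"
        by (intro less_imp_le bspec[OF w(1)] imageI)
      then have "\<bar>?c xv * (P (tuple_event \<Omega> v xv, ?C) - cond_prob (\<mu> w) (tuple_event \<Omega> v xv, ?C))\<bar> \<le> \<bar>?c xv\<bar> * e"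
        unfolding abs_mult by (intro mult_left_mono) auto
      then show "?c xv * (P (tuple_event \<Omega> v xv, ?C) - cond_prob (\<mu> w) (tuple_event \<Omega> v xv, ?C)) \<le> \<bar>?c xv\<bar> * e"
        by linarith
    qed
    also have "\<dots> = S * e" by (simp add: S_def sum_distrib_right)
    finally have 1: "(\<Sum>xv\<in>tuples v. ?c xv * P (tuple_event \<Omega> v xv, ?C)) \<le>
        (\<Sum>xv\<in>tuples v. ?c xv * cond_prob (\<mu> w) (tuple_event \<Omega> v xv, ?C)) + S * e" by linarith
    have "(\<Sum>xv\<in>tuples v. ?c xv * cond_prob (\<mu> w) (tuple_event \<Omega> v xv, ?C)) =
        (\<Sum>xv\<in>tuples v. ?c xv * measure_pmf.prob (\<mu> w) (tuple_event \<Omega> v xv \<inter> ?C)) / measure_pmf.prob (\<mu> w) ?C"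
      by (simp add: sum_divide_distrib)
    also have "\<dots> \<le> ?V xu + ?T * (\<epsilon> + real CARD('x) * d w * B + M\<^sup>2 * d w * B)"
      using \<mu>val[OF w(2), of xu] C by (simp add: pos_divide_le_eq mult.commute)
    also have "\<dots> = ?V xu + ?T * \<epsilon> + R * d w" by (simp add: R_def algebra_simps)
    also have "\<dots> \<le> ?V xu + ?T * \<epsilon> + R * e'" using w(3) R by (intro add_left_mono mult_left_mono)
    finally show "(\<Sum>xv\<in>tuples v. ?c xv * P (tuple_event \<Omega> v xv, ?C)) \<le> ?V xu + ?T * \<epsilon> + \<epsilon>'"
      using 1 e(1,3) by linarith
  qed
qed

end

section \<open>Well-behavedness and consistency of the limit process\<close>

context rate_set
begin

text \<open>For \<open>0 < \<Delta> < 1\<close> the quadratic error is at most linear, so the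
  difference quotients have entries of modulus at most \<open>m + c\<close>.\<close>

lemma first_order_Limsup_finite:
  fixes A :: "real \<Rightarrow> real ^ 'x ^ 'x"
  assumes H: "H \<subseteq> \<Q>" and "0 \<le> c"
    and est: "eventually (\<lambda>\<Delta>. \<forall>x. \<exists>Q\<in>H. \<forall>y. \<bar>A \<Delta> $ x $ y - \<Delta> * Q $ x $ y\<bar> \<le> c * \<Delta>\<^sup>2) (at_right 0)"
  shows "Limsup (at_right 0) (\<lambda>\<Delta>. ereal (1 / \<Delta> * op_norm ((*v) (A \<Delta>)))) < \<infinity>"
proof -
  have lt1: "eventually (\<lambda>\<Delta> :: real. \<Delta> < 1) (at_right 0)"
    unfolding eventually_at_right_field by (intro exI[of _ 1]) simp
  have "eventually (\<lambda>\<Delta>. ereal (1 / \<Delta> * op_norm ((*v) (A \<Delta>))) \<le> ereal (real CARD('x) * (m + c))) (at_right 0)"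
    using est eventually_at_right_less[of 0] lt1
  proof eventually_elim
    case (elim \<Delta>)
    have "\<bar>A \<Delta> $ x $ y\<bar> \<le> \<Delta> * (m + c)" for x y
    proof -
      obtain Q where Q: "Q \<in> H" "\<bar>A \<Delta> $ x $ y - \<Delta> * Q $ x $ y\<bar> \<le> c * \<Delta>\<^sup>2" using elim(1) by blast
      have "\<bar>Q $ x $ y\<bar> \<le> m" using entry_le Q(1) H by blast
      then have "\<bar>\<Delta> * Q $ x $ y\<bar> \<le> \<Delta> * m" using elim(2) by (simp add: abs_mult)
      moreover have "c * \<Delta>\<^sup>2 \<le> c * \<Delta>"
        using elim \<open>0 \<le> c\<close> by (intro mult_left_mono) (auto simp: power2_eq_square intro: mult_left_le_one_le)
      ultimately have "\<bar>A \<Delta> $ x $ y\<bar> \<le> \<Delta> * m + c * \<Delta>" using Q(2) by linarith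
      then show ?thesis by (simp add: algebra_simps)
    qed
    then have "op_norm ((*v) (A \<Delta>)) \<le> real CARD('x) * (\<Delta> * (m + c))" by (rule op_norm_matrix_le)
    then have "1 / \<Delta> * op_norm ((*v) (A \<Delta>)) \<le> 1 / \<Delta> * (real CARD('x) * (\<Delta> * (m + c)))"
      using elim(2) by (intro mult_left_mono) auto
    also have "\<dots> = real CARD('x) * (m + c)" using elim(2) by simp
    finally show ?case by simp
  qed
  then have "Limsup (at_right 0) (\<lambda>\<Delta>. ereal (1 / \<Delta> * op_norm ((*v) (A \<Delta>)))) \<le> ereal (real CARD('x) * (m + c))"
    by (rule Limsup_bounded)
  then show ?thesis using le_less_trans by fastforce
qed

text \<open>The members of \<open>H\<close> that belong to the step lengths have a convergent
  subsequence, and the error \<open>c * \<Delta>\<^sup>2\<close> vanishes after division by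
  \<open>\<Delta>\<close>. Different rows may lead to different members of \<open>H\<close>.\<close>

lemma first_order_limit_row:
  fixes A :: "real \<Rightarrow> real ^ 'x ^ 'x"
  assumes H: "compact H"
    and est: "eventually (\<lambda>\<Delta>. \<forall>x. \<exists>Q\<in>H. \<forall>y. \<bar>A \<Delta> $ x $ y - \<Delta> * Q $ x $ y\<bar> \<le> c * \<Delta>\<^sup>2) (at_right 0)"
    and \<Delta>: "filterlim \<Delta> (at_right 0) sequentially"
    and lim: "(\<lambda>i. (1 / \<Delta> i) *\<^sub>R A (\<Delta> i)) \<longlonglongrightarrow> Q"
  shows "\<exists>Q'\<in>H. Q $ x = Q' $ x"
proof -
  have "eventually (\<lambda>i. (\<forall>x. \<exists>Q\<in>H. \<forall>y. \<bar>A (\<Delta> i) $ x $ y - \<Delta> i * Q $ x $ y\<bar> \<le> c * (\<Delta> i)\<^sup>2) \<and> 0 < \<Delta> i) sequentially"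
    using eventually_compose_filterlim[OF eventually_conj[OF est eventually_at_right_less[of 0]] \<Delta>] .
  then obtain i0 where i0: "\<And>i. i0 \<le> i \<Longrightarrow> \<exists>Q\<in>H. \<forall>y. \<bar>A (\<Delta> i) $ x $ y - \<Delta> i * Q $ x $ y\<bar> \<le> c * (\<Delta> i)\<^sup>2"
      "\<And>i. i0 \<le> i \<Longrightarrow> 0 < \<Delta> i"
    unfolding eventually_sequentially by blast
  \<comment> \<open>The shift by \<open>i0\<close> makes the estimate valid at every index, so that
    a matrix can be chosen for each.\<close>
  have "\<forall>i. \<exists>Q. Q \<in> H \<and> (\<forall>y. \<bar>A (\<Delta> (i + i0)) $ x $ y - \<Delta> (i + i0) * Q $ x $ y\<bar> \<le> c * (\<Delta> (i + i0))\<^sup>2)"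
  proof
    fix i show "\<exists>Q. Q \<in> H \<and> (\<forall>y. \<bar>A (\<Delta> (i + i0)) $ x $ y - \<Delta> (i + i0) * Q $ x $ y\<bar> \<le> c * (\<Delta> (i + i0))\<^sup>2)"
      using i0(1)[of "i + i0"] by auto
  qed
  from choice[OF this] obtain q where q: "\<And>i. q i \<in> H"
    "\<And>i y. \<bar>A (\<Delta> (i + i0)) $ x $ y - \<Delta> (i + i0) * q i $ x $ y\<bar> \<le> c * (\<Delta> (i + i0))\<^sup>2" by blast
  obtain Q' r where r: "Q' \<in> H" "strict_mono r" "(q \<circ> r) \<longlonglongrightarrow> Q'"
    using H q(1) unfolding compact_def by metis
  have \<Delta>0: "(\<lambda>i. \<Delta> (r i + i0)) \<longlonglongrightarrow> 0"
  proof -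
    have "\<Delta> \<longlonglongrightarrow> 0" using \<Delta> by (simp add: filterlim_at)
    then have "(\<lambda>i. \<Delta> (i + i0)) \<longlonglongrightarrow> 0" by (rule LIMSEQ_ignore_initial_segment)
    from LIMSEQ_subseq_LIMSEQ[OF this r(2)] show ?thesis by (simp add: o_def)
  qed
  have "Q $ x $ y = Q' $ x $ y" for y
  proof -
    let ?B = "\<lambda>i. (1 / \<Delta> (r i + i0)) * A (\<Delta> (r i + i0)) $ x $ y"
    have "(\<lambda>i. (1 / \<Delta> (i + i0)) *\<^sub>R A (\<Delta> (i + i0))) \<longlonglongrightarrow> Q" using lim by (rule LIMSEQ_ignore_initial_segment)
    from LIMSEQ_subseq_LIMSEQ[OF this r(2)]
    have "(\<lambda>i. (1 / \<Delta> (r i + i0)) *\<^sub>R A (\<Delta> (r i + i0))) \<longlonglongrightarrow> Q" by (simp add: o_def)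
    from tendsto_vec_nth[OF tendsto_vec_nth[OF this], of x y] have 1: "?B \<longlonglongrightarrow> Q $ x $ y" by simp
    have 2: "(\<lambda>i. q (r i) $ x $ y) \<longlonglongrightarrow> Q' $ x $ y"
      using tendsto_vec_nth[OF tendsto_vec_nth[OF r(3)], of x y] by (simp add: o_def)
    have "(\<lambda>i. ?B i - q (r i) $ x $ y) \<longlonglongrightarrow> 0"
    proof (rule Lim_null_comparison)
      show "eventually (\<lambda>i. norm (?B i - q (r i) $ x $ y) \<le> c * \<Delta> (r i + i0)) sequentially"
      proof (intro always_eventually allI)
        fix i
        let ?d = "\<Delta> (r i + i0)"
        have d: "0 < ?d" using i0(2) by simp
        have "?B i - q (r i) $ x $ y = (A ?d $ x $ y - ?d * q (r i) $ x $ y) / ?d" using d by (simp add: diff_divide_distrib)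
        then have "norm (?B i - q (r i) $ x $ y) = \<bar>A ?d $ x $ y - ?d * q (r i) $ x $ y\<bar> / ?d" using d by simp
        also have "\<dots> \<le> (c * ?d\<^sup>2) / ?d" using q(2)[of "r i" y] d by (intro divide_right_mono) auto
        also have "\<dots> = c * ?d" using d by (simp add: power2_eq_square)
        finally show "norm (?B i - q (r i) $ x $ y) \<le> c * ?d" .
      qed
      show "(\<lambda>i. c * \<Delta> (r i + i0)) \<longlonglongrightarrow> 0" using tendsto_mult_left[OF \<Delta>0, of c] by simp
    qed
    from tendsto_add[OF this 2] have "?B \<longlonglongrightarrow> Q' $ x $ y" by simp
    from LIMSEQ_unique[OF 1 this] show ?thesis .
  qed
  then have "Q $ x = Q' $ x" by (simp add: vec_eq_iff)
  then show ?thesis using r(1) by blast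
qed

lemma well_behaved_process_exists:
  fixes f :: "(real \<Rightarrow> 'x) \<Rightarrow> real" and u v :: "real set"
  defines "g \<equiv> \<lambda>x. f (restrict x (u \<union> v))"
  assumes path: "path_space \<Omega>" and \<M>: "\<M> \<noteq> {}" and conv: "convex \<Q>" and rows: "separately_specified_rows \<Q>"
    and uv: "u \<in> time_sets" "v \<in> time_sets" "u \<noteq> {}" "v \<noteq> {}" "\<forall>r\<in>u. \<forall>s\<in>v. r < s"
    and xu: "xu \<in> tuples u" and \<epsilon>: "0 < \<epsilon>"
  shows "\<exists>P\<in>well_behaved_processes \<Omega> \<Q> \<M>.
    (\<Sum>xv\<in>tuples v. f (merge u v (xu, xv)) * P (tuple_event \<Omega> v xv, tuple_event \<Omega> u xu)) \<le>
      viter qlow (Max u) (sorted_list_of_set v) g xu + \<epsilon>"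
proof -
  obtain p where p: "p \<in> \<M>" using \<M> by blast
  have fin: "finite u" "finite v" using uv by (auto simp: time_sets_def)
  let ?X = "tuples (u \<union> v) :: (real \<Rightarrow> 'x) set"
  have finX: "finite ?X" unfolding tuples_def using fin by (intro finite_PiE) auto
  \<comment> \<open>\<open>f\<close> matters only on the finitely many tuples over
    \<open>u \<union> v\<close>, so \<open>g\<close> is bounded although \<open>f\<close> need not
    be.\<close>
  define B where "B = (\<Sum>z\<in>?X. \<bar>f z\<bar>)"
  have B: "\<bar>g x\<bar> \<le> B" for x
    unfolding B_def g_def using finX by (intro member_le_sum[of _ _ "\<lambda>z. \<bar>f z\<bar>"]) (auto simp: tuples_def)
  have T: "0 < Max v - Max u"
    using uv(5) Max_in[OF fin(1) uv(3)] Max_in[OF fin(2) uv(4)] by auto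
  \<comment> \<open>The control loses \<open>\<epsilon>1\<close> per unit of time over the horizon,
    half of \<open>\<epsilon>\<close> in total; the passage to the limit gets the other
    half.\<close>
  define \<epsilon>1 where "\<epsilon>1 = \<epsilon> / (2 * (Max v - Max u))"
  have "k * (\<epsilon> / (2 * k)) = \<epsilon> / 2" if "0 < k" for k using that by simp
  from this[OF T] have \<epsilon>1: "0 < \<epsilon>1" "(Max v - Max u) * \<epsilon>1 = \<epsilon> / 2" unfolding \<epsilon>1_def using T \<epsilon> by simp_all
  obtain H where H: "H \<subseteq> \<Q>" "compact H" "convex H" "H \<noteq> {}"
    and approx: "\<And>W x. infnorm W \<le> B \<Longrightarrow> \<exists>Q\<in>H. (Q *v W) $ x \<le> qlow W $ x + \<epsilon>1"
    using compact_convex_subset[OF conv \<epsilon>1(1), of B] by blast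
  define c where "c = m * (m + 1) + 1"
  have c: "0 \<le> c" using m_pos by (simp add: c_def)
  obtain P where P: "stochastic_process \<Omega> P" and init: "\<And>x. P (state_event \<Omega> 0 x, \<Omega>) = pmf p x"
    and row: "\<And>t t' u' z x. 0 \<le> t \<Longrightarrow> t < t' \<Longrightarrow> u' \<in> time_sets_before t \<Longrightarrow> z \<in> tuples u' \<Longrightarrow>
      \<exists>Q\<in>H. \<forall>y. \<bar>trans_matrix \<Omega> P u' z t t' $ x $ y - ((if x = y then 1 else 0) + (t' - t) * Q $ x $ y)\<bar>
        \<le> c * (t' - t)\<^sup>2"
    and val: "(\<Sum>xv\<in>tuples v. f (merge u v (xu, xv)) * P (tuple_event \<Omega> v xv, tuple_event \<Omega> u xu)) \<le>
      viter qlow (Max u) (sorted_list_of_set v) g xu + (Max v - Max u) * \<epsilon>1 + \<epsilon> / 2"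
  proof (rule limit_process_exists[where f=f and u=u and v=v and B=B and H=H and \<epsilon>=\<epsilon>1 and \<epsilon>'="\<epsilon> / 2" and p=p and xu=xu,
        OF path H(1,3,4) B[unfolded g_def] _ _ _ uv xu])
    show "\<exists>Q\<in>H. (Q *v W) $ x \<le> qlow W $ x + \<epsilon>1" if "infnorm W \<le> B" for W x using that by (rule approx)
    show "0 \<le> \<epsilon>1" "0 < \<epsilon> / 2" using \<epsilon>1 \<epsilon> by auto
  qed (rule that; (unfold c_def g_def)?; assumption)
  have right: "eventually (\<lambda>\<Delta>. \<forall>x. \<exists>Q\<in>H. \<forall>y. \<bar>(trans_matrix \<Omega> P u' z t (t + \<Delta>) - mat 1) $ x $ y - \<Delta> * Q $ x $ y\<bar> \<le> c * \<Delta>\<^sup>2)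
      (at_right 0)"
    if t: "0 \<le> t" "u' \<in> time_sets_before t" "z \<in> tuples u'" for t u' z
    using eventually_at_right_less[of 0]
  proof eventually_elim
    case (elim \<Delta>)
    show ?case
    proof
      fix x
      show "\<exists>Q\<in>H. \<forall>y. \<bar>(trans_matrix \<Omega> P u' z t (t + \<Delta>) - mat 1) $ x $ y - \<Delta> * Q $ x $ y\<bar> \<le> c * \<Delta>\<^sup>2"
        using row[of t "t + \<Delta>" u' z x] t elim by (simp add: mat_def diff_diff_eq)
    qed
  qed
  have left: "eventually (\<lambda>\<Delta>. \<forall>x. \<exists>Q\<in>H. \<forall>y. \<bar>(trans_matrix \<Omega> P u' z (t - \<Delta>) t - mat 1) $ x $ y - \<Delta> * Q $ x $ y\<bar> \<le> c * \<Delta>\<^sup>2)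
      (at_right 0)"
    if t: "0 < t" "u' \<in> time_sets_before t" "z \<in> tuples u'" for t u' z
  proof -
    have fin: "finite u'" "\<forall>r\<in>u'. r < t" using t by (auto simp: time_sets_before_def time_sets_def)
    define b where "b = Max (insert 0 u')"
    have b: "0 \<le> b" "b < t" "\<And>r. r \<in> u' \<Longrightarrow> r \<le> b" using fin t(1) by (auto simp: b_def)
    have "eventually (\<lambda>\<Delta>. \<Delta> < t - b) (at_right 0)"
      using b(2) unfolding eventually_at_right_field by (intro exI[of _ "t - b"]) auto
    then show ?thesis
      using eventually_at_right_less[of 0]
    proof eventually_elim
      case (elim \<Delta>)
      have before: "u' \<in> time_sets_before (t - \<Delta>)"
        using t(2) b(3) elim(1) unfolding time_sets_before_def by fastforce
      show ?case
      proof
        fix x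
        show "\<exists>Q\<in>H. \<forall>y. \<bar>(trans_matrix \<Omega> P u' z (t - \<Delta>) t - mat 1) $ x $ y - \<Delta> * Q $ x $ y\<bar> \<le> c * \<Delta>\<^sup>2"
          using row[of "t - \<Delta>" t u' z x] t before b(1) elim by (simp add: mat_def diff_diff_eq)
      qed
    qed
  qed
  have "well_behaved \<Omega> P"
    unfolding well_behaved_def
    using first_order_Limsup_finite[OF H(1) c right] first_order_Limsup_finite[OF H(1) c left] by blast
  moreover have "consistent_rates \<Omega> P \<Q>"
    unfolding consistent_rates_def
  proof (intro allI impI ballI subsetI)
    fix t u' z Q assume t: "0 \<le> t" "u' \<in> time_sets_before t" "z \<in> tuples u'" and "Q \<in> outer_derivative \<Omega> P u' z t"
    then obtain \<Delta> where Q: "Q \<in> rate_matrices" and \<Delta>: "filterlim \<Delta> (at_right 0) sequentially"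
      and lim: "(\<lambda>i. (1 / \<Delta> i) *\<^sub>R (trans_matrix \<Omega> P u' z t (t + \<Delta> i) - mat 1)) \<longlonglongrightarrow> Q \<or>
         (t > 0 \<and> (\<lambda>i. (1 / \<Delta> i) *\<^sub>R (trans_matrix \<Omega> P u' z (t - \<Delta> i) t - mat 1)) \<longlonglongrightarrow> Q)"
      unfolding outer_derivative_def by blast
    \<comment> \<open>Each row of \<open>Q\<close> is a row of some member of \<open>H\<close>; the
      separately specified rows reassemble them into a member of \<open>\<Q>\<close>.\<close>
    have "\<exists>Q'\<in>H. Q $ x = Q' $ x" for x
      using lim
    proof (elim disjE conjE)
      assume "(\<lambda>i. (1 / \<Delta> i) *\<^sub>R (trans_matrix \<Omega> P u' z t (t + \<Delta> i) - mat 1)) \<longlonglongrightarrow> Q"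
      then show ?thesis by (rule first_order_limit_row[OF H(2) right[OF t] \<Delta>])
    next
      assume "0 < t" "(\<lambda>i. (1 / \<Delta> i) *\<^sub>R (trans_matrix \<Omega> P u' z (t - \<Delta> i) t - mat 1)) \<longlonglongrightarrow> Q"
      then show ?thesis by (intro first_order_limit_row[OF H(2) left[OF _ t(2,3)] \<Delta>])
    qed
    then have "\<forall>x. Q $ x \<in> (\<lambda>Q'. Q' $ x) ` \<Q>" using H(1) by blast
    then have "Q \<in> {Q \<in> rate_matrices. \<forall>x. Q $ x \<in> (\<lambda>Q'. Q' $ x) ` \<Q>}" using Q by blast
    then show "Q \<in> \<Q>" using rows unfolding separately_specified_rows_def by simp
  qed
  moreover have "consistent_initial \<Omega> P \<M>"
    unfolding consistent_initial_def using init p by (auto simp: fun_eq_iff intro!: image_eqI[of _ pmf p])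
  ultimately have "P \<in> well_behaved_processes \<Omega> \<Q> \<M>" using P by (simp add: well_behaved_processes_def)
  then show ?thesis using val \<epsilon>1(2) by (intro bexI[of _ P]) auto
qed

end

section \<open>Combination of the two bounds\<close>

theorem corollary9p2:
  fixes \<Omega> :: "(real \<Rightarrow> 'x::finite) set"
    and \<M> :: "'x pmf set"
    and \<Q> :: "(real ^ 'x ^ 'x) set"
    and u v :: "real set"
    and f :: "(real \<Rightarrow> 'x) \<Rightarrow> real"
  assumes "path_space \<Omega>"
    and "\<M> \<noteq> {}"
    and "\<Q> \<noteq> {}" and "\<Q> \<subseteq> rate_matrices" and "bounded_matrices \<Q>" and "convex \<Q>"
    and "separately_specified_rows \<Q>"
    and "u \<in> time_sets" and "u \<noteq> {}" and "v \<in> time_sets" and "v \<noteq> {}"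
    and "\<forall>r\<in>u. \<forall>s\<in>v. r < s"
  shows "\<forall>xu\<in>tuples u.
    lower_expectation \<Omega> \<Q> \<M> f u v xu =
    lower_trans_iter (lower_envelope \<Q>) u (sorted_list_of_set v) f xu"
proof
  fix xu :: "real \<Rightarrow> 'x" assume xu: "xu \<in> tuples u"
  obtain m where m: "0 < m" "\<And>Q x y. Q \<in> \<Q> \<Longrightarrow> \<bar>Q $ x $ y\<bar> \<le> m"
    using bounded_matrices_entries[OF assms(5)] by blast
  interpret rate_set \<Q> m "real CARD('x) * m"
    by unfold_locales (use assms(3,4) m in auto)
  have fin: "finite u" "finite v" using assms by (auto simp: time_sets_def)
  let ?E = "\<lambda>P. \<Sum>xv\<in>tuples v. f (merge u v (xu, xv)) * P (tuple_event \<Omega> v xv, tuple_event \<Omega> u xu)"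
  let ?L = "lower_trans_iter (lower_envelope \<Q>) u (sorted_list_of_set v) f xu"
  have set_v: "set (sorted_list_of_set v) = v" using fin by simp
  have lower: "?L \<le> ?E P" if "P \<in> well_behaved_processes \<Omega> \<Q> \<M>" for P
  proof -
    interpret consistent_process \<Q> m "real CARD('x) * m" \<Omega> P
      by unfold_locales (use that assms(1) in \<open>auto simp: well_behaved_processes_def\<close>)
    show ?thesis
      using lower_trans_iter_le_expectation[of u xu "sorted_list_of_set v" f] assms xu
      by (simp only: set_v strict_sorted_list_of_set simp_thms)
  qed
  \<comment> \<open>Walks produce total paths, so the upper bound concerns \<open>f\<close> composed
    with the restriction to \<open>u \<union> v\<close>; on tuples nothing changes.\<close>
  have L: "?L = viter (lower_envelope \<Q>) (Max u) (sorted_list_of_set v) (\<lambda>x. f (restrict x (u \<union> v))) xu"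
  proof -
    have "?L = viter (lower_envelope \<Q>) (Max u) (sorted_list_of_set v) f xu"
      using assms fin by (intro lower_trans_iter_eq_viter) (simp_all add: strict_sorted_list_of_set)
    also have "\<dots> = viter (lower_envelope \<Q>) (Max u) (sorted_list_of_set v) (\<lambda>x. f (restrict x (u \<union> v))) xu"
    proof (rule viter_cong_values[OF _ xu])
      fix z :: "real \<Rightarrow> 'x" assume "z \<in> tuples (u \<union> set (sorted_list_of_set v))"
      then have "restrict z (u \<union> v) = z"
        unfolding set_v by (intro extensional_restrict) (auto simp: tuples_def PiE_def)
      then show "f z = f (restrict z (u \<union> v))" by simp
    qed
    finally show ?thesis .
  qed
  have upper: "\<exists>P\<in>well_behaved_processes \<Omega> \<Q> \<M>. ?E P \<le> ?L + \<epsilon>" if "0 < \<epsilon>" for \<epsilon>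
    unfolding L using assms xu that by (intro well_behaved_process_exists) auto
  \<comment> \<open>The upper bound provides a process, without which a real infimum would be
    meaningless.\<close>
  have ne: "well_behaved_processes \<Omega> \<Q> \<M> \<noteq> {}" using upper[of 1] by auto
  have bdd: "bdd_below (?E ` well_behaved_processes \<Omega> \<Q> \<M>)" using lower by (intro bdd_belowI2)
  show "lower_expectation \<Omega> \<Q> \<M> f u v xu = ?L"
    unfolding lower_expectation_def
  proof (rule antisym)
    show "?L \<le> (INF P\<in>well_behaved_processes \<Omega> \<Q> \<M>. ?E P)" by (rule cINF_greatest[OF ne lower])
    show "(INF P\<in>well_behaved_processes \<Omega> \<Q> \<M>. ?E P) \<le> ?L"
    proof (rule field_le_epsilon)
      fix \<epsilon> :: real assume "0 < \<epsilon>"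
      then obtain P where "P \<in> well_behaved_processes \<Omega> \<Q> \<M>" "?E P \<le> ?L + \<epsilon>" using upper by blast
      then show "(INF P\<in>well_behaved_processes \<Omega> \<Q> \<M>. ?E P) \<le> ?L + \<epsilon>" using cINF_lower2[OF bdd] by blast
    qed
  qed
qed

end
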